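(* Let $H_\omega=-\Delta+V_\omega$ be the Anderson model on the Sierpinski lattice $\mathbb{G}$. For $L\in\mathbb{N}$ let $B_L=\{y\in\mathbb{G}: d(O,y)\le 2^L\}$ and $H_\omega^{B_L}=\mathbb{1}_{B_L}H_\omega\mathbb{1}_{B_L}$ regarded as an operator on $\ell^2(B_L)$. Then there exists a non-random, right-continuous, non-decreasing function $N(E)$ such that almost surely $$N(E)=\lim_{L\to\infty}\frac{1}{|B_L|}\mathbb{E}\,\mathcal N(E;H_\omega^{B_L})=\lim_{L\to\infty}\frac{1}{|B_L|}\mathcal N(E;H_\omega^{B_L})$$ for all continuity points $E$ of $N$. ($N$ is called the integrated density of states.) If moreover $\inf\operatorname{supp}P_0=0$, $P_0$ is not concentrated on a single point, and there are $C,\kappa>0$ with $P_0([0,\varepsilon])\ge C\varepsilon^\kappa$ for all sufficiently small $\varepsilon>0$, then $$\lim_{E\searrow0}\frac{\log|\log N(E)|}{\log E}=-\frac{\log3}{\log5}.$$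
   Context: Let $a_1=(0,0)$, $a_2=(1,0)$, $a_3=(1/2,\sqrt3/2)$, $T_0$ the unit equilateral triangle with these vertices, $T_{n+1}=T_n\cup(T_n+2^na_2)\cup(T_n+2^na_3)$. $\mathbb{G}_n$ is the set of vertices of the unit triangles (translates of $T_0$) in $T_n$, with $x\sim y$ iff $x\ne y$ are vertices of a common unit triangle; $\mathbb{G}_n'$ is its mirror image in the $y$-axis; the Sierpinski lattice is $\mathbb{G}=\bigcup_n(\mathbb{G}_n\cup\mathbb{G}_n')$ with these edges (every vertex has degree 4). $d$ is the graph distance, $O=(0,0)$, $|A|$ is cardinality. $\Delta f(x)=\sum_{y\sim x}(f(y)-f(x))$ on $\ell^2(\mathbb{G})$. $H_\omega=-\Delta+V_\omega$ with $\{V_\omega(x)\}_{x\in\mathbb{G}}$ i.i.d. real random variables with common distribution $P_0$, $\operatorname{supp}P_0=\{x:P_0((x-\varepsilon,x+\varepsilon))>0\ \forall\varepsilon>0\}$. For a self-adjoint operator $X$ on a finite-dimensional space, $\mathcal N(E;X)$ is the number of eigenvalues (with multiplicity) of $X$ that are $\le E$. *)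

theory Defs
  imports "HOL-Probability.Probability" "Jordan_Normal_Form.Char_Poly"
begin

type_synonym pt = "real \<times> real"

definition sa1 :: pt where "sa1 = (0, 0)"
definition sa2 :: pt where "sa2 = (1, 0)"
definition sa3 :: pt where "sa3 = (1/2, sqrt 3 / 2)"

definition padd :: "pt \<Rightarrow> pt \<Rightarrow> pt" where
  "padd p q = (fst p + fst q, snd p + snd q)"
definition pscale :: "real \<Rightarrow> pt \<Rightarrow> pt" where
  "pscale c p = (c * fst p, c * snd p)"

text \<open>Translation vectors of the unit triangles of T_n: the unit triangles in T_n are
  exactly the sets T_0 + v with v in tri_pos n.\<close>
fun tri_pos :: "nat \<Rightarrow> pt set" where
  "tri_pos 0 = {(0, 0)}"
| "tri_pos (Suc n) = tri_pos n \<union> padd (pscale (2 ^ n) sa2) ` tri_pos n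
                     \<union> padd (pscale (2 ^ n) sa3) ` tri_pos n"

definition tri_verts :: "pt \<Rightarrow> pt set" where
  "tri_verts v = {padd v sa1, padd v sa2, padd v sa3}"

definition Gn_verts :: "nat \<Rightarrow> pt set" where
  "Gn_verts n = (\<Union>v\<in>tri_pos n. tri_verts v)"
definition Gn_adj :: "nat \<Rightarrow> pt \<Rightarrow> pt \<Rightarrow> bool" where
  "Gn_adj n x y \<longleftrightarrow> x \<noteq> y \<and> (\<exists>v\<in>tri_pos n. x \<in> tri_verts v \<and> y \<in> tri_verts v)"

definition mirror :: "pt \<Rightarrow> pt" where
  "mirror p = (- fst p, snd p)"

definition sier_V :: "pt set" where
  "sier_V = (\<Union>n. Gn_verts n \<union> mirror ` Gn_verts n)"
definition sier_adj :: "pt \<Rightarrow> pt \<Rightarrow> bool" where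
  "sier_adj x y \<longleftrightarrow> (\<exists>n. Gn_adj n x y \<or> Gn_adj n (mirror x) (mirror y))"

definition sier_dist :: "pt \<Rightarrow> pt \<Rightarrow> nat" where
  "sier_dist x y = (LEAST k. (x, y) \<in> {(u, v). sier_adj u v} ^^ k)"

definition origin :: pt where "origin = (0, 0)"

definition ballL :: "nat \<Rightarrow> pt set" where
  "ballL L = {y \<in> sier_V. sier_dist origin y \<le> 2 ^ L}"

text \<open>Kernel of H = -Delta + V (Delta f(x) = sum over neighbours y of f(y) - f(x)),
  given the values v of the potential.\<close>
definition H_kernel :: "(pt \<Rightarrow> real) \<Rightarrow> pt \<Rightarrow> pt \<Rightarrow> real" where
  "H_kernel v x y =
     (if x = y then real (card {z. sier_adj x z}) + v x else 0) - (if sier_adj x y then 1 else 0)"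

definition restr_mat :: "('v \<Rightarrow> 'v \<Rightarrow> real) \<Rightarrow> 'v set \<Rightarrow> real mat" where
  "restr_mat K B = (let e = (SOME e. bij_betw e {..<card B} B)
                    in mat (card B) (card B) (\<lambda>(i, j). K (e i) (e j)))"

definition eig_count :: "real \<Rightarrow> real mat \<Rightarrow> nat" where
  "eig_count E A = (\<Sum>a\<in>{a. poly (char_poly A) a = 0 \<and> a \<le> E}. order a (char_poly A))"

definition supp_measure :: "real measure \<Rightarrow> real set" where
  "supp_measure P = {x. \<forall>\<epsilon>>0. measure P {x - \<epsilon><..<x + \<epsilon>} > 0}"

end

theory Submission
  imports Defs "HOL-Real_Asymp.Real_Asymp"
begin

text \<open>Existence of the density of states: removing the three corners of a level-n triangle decouples
  its interior from the rest, so up to a bounded error the eigenvalue count of a level-(n+1) cell is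
  the sum of three independent copies of the level-n count. Hence the means divided by 3^n
  form a Cauchy sequence, and the variances grow at most like 4^n, which is summable against 9^n:
  Chebyshev and Borel-Cantelli give almost sure convergence.

  Lifshitz tail: on a level-n triangle the Dirichlet energy of a harmonic function is (3/5)^n times
  the energy of its corner values, while the number of sites is of order 3^n. A gluing of three
  harmonic functions has Rayleigh quotient of order 5^(-n), so the count is positive whenever the
  potential is of order 5^(-n) on one cell; this yields the lower bound. Conversely a function of energy
  below c 5^(-n) is nearly constant on the cell, so the cell cannot contribute unless the potential is
  small at most of its 3^n sites, an event of probability exp(-c 3^n) by Hoeffding. With E of order
  5^(-n) one has 3^n of order E^(-log 3 / log 5).\<close>

section \<open>Symmetric matrices and variational bounds on the eigenvalue count\<close>

unbundle no vec_syntax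
hide_const (open) Finite_Cartesian_Product.mat Finite_Cartesian_Product.vec Finite_Cartesian_Product.row Finite_Cartesian_Product.column

text \<open>Operators on different site sets are compared through their quadratic forms. A
  \<open>low_family\<close> bounds an eigenvalue count from below, a \<open>high_family\<close> from
  above, and \<open>low_le_high\<close> is the one place where dimensions are compared. Two
  bracketings occur. For existence the corners are deleted (Dirichlet), at the cost of a bounded
  number of sites. Near the bottom of the spectrum such an error per cell would swamp an
  exponentially small count, so the Lifshitz upper bound keeps the corners and gives each of them
  half weight in either adjacent cell (\<open>wsum\<close>); norms and forms then add exactly. For
  the lower bound, superadditivity makes \<open>cell_mean n E / 3 ^ n\<close> increase, so a single
  cell already bounds the limit. Almost sure convergence comes one energy at a time. The limit is
  made right-continuous afterwards, and rational energies give one null set for all continuity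
  points. The power law of \<open>P0\<close> near 0 enters the exponent only through a logarithm of
  E, which the double logarithm removes.\<close>

lemma symmetric_mat_eigenvector:
  fixes A :: "real mat"
  assumes A: "A \<in> carrier_mat n n" and sym: "transpose_mat A = A" and n: "n \<noteq> 0"
  shows "\<exists>v e. v \<in> carrier_vec n \<and> scalar_prod v v = 1 \<and> A *\<^sub>v v = e \<cdot>\<^sub>v v"
proof -
  define C where "C = map_mat complex_of_real A"
  have C: "C \<in> carrier_mat n n" using A by (simp add: C_def)
  obtain as where as: "char_poly C = (\<Prod>a\<leftarrow>as. [:- a, 1:])" "length as = n"
    using char_poly_factorized[OF C] by auto
  then obtain \<mu> where "\<mu> \<in> set as" using n by (cases as) auto
  then have "poly (char_poly C) \<mu> = 0" unfolding as(1) by (induct as) auto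
  then have "eigenvalue C \<mu>" using eigenvalue_root_char_poly[OF C] by simp
  then obtain z where z: "z \<in> carrier_vec n" "z \<noteq> 0\<^sub>v n" "C *\<^sub>v z = \<mu> \<cdot>\<^sub>v z"
    using C unfolding eigenvalue_def eigenvector_def by auto
  have Aij: "A $$ (i,j) = A $$ (j,i)" if "i < n" "j < n" for i j
    using sym A that by (metis carrier_matD index_transpose_mat(1))
  have ev: "(\<Sum>j<n. of_real (A $$ (i,j)) * z $ j) = \<mu> * z $ i" if "i < n" for i
  proof -
    have "(C *\<^sub>v z) $ i = (\<Sum>j<n. of_real (A $$ (i,j)) * z $ j)"
      using that C z(1) A by (auto simp: scalar_prod_def C_def atLeast0LessThan intro!: sum.cong)
    then show ?thesis using z that by simp
  qed
  define S where "S = (\<Sum>i<n. cnj (z $ i) * z $ i)"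
  have S_real: "S = of_real (\<Sum>i<n. (cmod (z $ i))\<^sup>2)"
    unfolding S_def of_real_sum by (rule sum.cong) (simp_all only: complex_norm_square mult.commute)
  have "\<exists>i<n. z $ i \<noteq> 0" using z(1,2) by (metis carrier_vecD eq_vecI index_zero_vec(1) index_zero_vec(2))
  then have Spos: "(\<Sum>i<n. (cmod (z $ i))\<^sup>2) > 0" by (auto intro!: sum_pos2)
  have form: "(\<Sum>i<n. cnj (z $ i) * (\<Sum>j<n. of_real (A $$ (i,j)) * z $ j)) = \<mu> * S"
  proof -
    have "(\<Sum>i<n. cnj (z $ i) * (\<Sum>j<n. of_real (A $$ (i,j)) * z $ j)) = (\<Sum>i<n. cnj (z $ i) * (\<mu> * z $ i))"
      by (rule sum.cong) (simp_all add: ev)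
    then show ?thesis unfolding S_def by (simp add: sum_distrib_left mult_ac)
  qed
  \<comment> \<open>Symmetry of the real matrix makes the form z* A z equal to its conjugate. It is
    also \<open>\<mu> * S\<close> with \<open>S\<close> real and nonzero, so \<mu> is real and is a
    root of the real characteristic polynomial.\<close>
  have "cnj (\<Sum>i<n. cnj (z $ i) * (\<Sum>j<n. of_real (A $$ (i,j)) * z $ j))
      = (\<Sum>i<n. \<Sum>j<n. z $ i * of_real (A $$ (i,j)) * cnj (z $ j))"
    by (simp add: sum_distrib_left mult.assoc)
  also have "\<dots> = (\<Sum>j<n. \<Sum>i<n. z $ i * of_real (A $$ (i,j)) * cnj (z $ j))"
    by (rule sum.swap)
  also have "\<dots> = (\<Sum>i<n. cnj (z $ i) * (\<Sum>j<n. of_real (A $$ (i,j)) * z $ j))"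
    unfolding sum_distrib_left by (intro sum.cong refl) (auto simp: Aij)
  finally have "cnj (\<mu> * S) = \<mu> * S" unfolding form .
  moreover have "S \<noteq> 0" unfolding S_real of_real_eq_0_iff using Spos by simp
  moreover have "cnj S = S" unfolding S_real complex_cnj_complex_of_real ..
  ultimately have "cnj \<mu> = \<mu>" by simp
  then have mu: "\<mu> = of_real (Re \<mu>)" by (simp add: complex_eq_iff)
  have "poly (char_poly C) \<mu> = 0" by fact
  moreover have "char_poly C = map_poly complex_of_real (char_poly A)"
    unfolding C_def by (rule of_real_hom.char_poly_hom[OF A])
  ultimately have "poly (map_poly complex_of_real (char_poly A)) (of_real (Re \<mu>)) = 0" using mu by simp
  then have "poly (char_poly A) (Re \<mu>) = 0"
    by (metis of_real_eq_0_iff of_real_hom.poly_map_poly)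
  then have "eigenvalue A (Re \<mu>)" using eigenvalue_root_char_poly[OF A] by simp
  then obtain x where x: "x \<in> carrier_vec n" "x \<noteq> 0\<^sub>v n" "A *\<^sub>v x = Re \<mu> \<cdot>\<^sub>v x"
    using A unfolding eigenvalue_def eigenvector_def by auto
  define s where "s = scalar_prod x x"
  have s: "s > 0"
  proof -
    have "\<exists>i<n. x $ i \<noteq> 0" using x(1,2) by (metis carrier_vecD eq_vecI index_zero_vec(1) index_zero_vec(2))
    then show ?thesis using x(1) unfolding s_def scalar_prod_def
      by (auto intro!: sum_pos2 simp: zero_less_mult_iff)
  qed
  define v where "v = (1 / sqrt s) \<cdot>\<^sub>v x"
  have "v \<in> carrier_vec n" using x by (simp add: v_def)
  moreover have "scalar_prod v v = 1"
    using x(1) s by (simp add: v_def smult_scalar_prod_distrib[of _ n] scalar_prod_smult_distrib[of _ n] flip: s_def)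
  moreover have "A *\<^sub>v v = Re \<mu> \<cdot>\<^sub>v v"
    unfolding v_def using mult_mat_vec[OF A x(1)] x(3) by (simp add: smult_smult_assoc mult.commute)
  ultimately show ?thesis by blast
qed

text \<open>The reflection in the hyperplane orthogonal to e_0 - v exchanges the unit vectors e_0
  and v. Being symmetric and an involution, it is its own inverse and transpose. For v = e_0 it
  degenerates and the identity serves.\<close>

lemma householder:
  fixes v :: "real vec"
  assumes v: "v \<in> carrier_vec n" "scalar_prod v v = 1" and n: "n \<noteq> 0"
  shows "\<exists>W \<in> carrier_mat n n. transpose_mat W = W \<and> W * W = 1\<^sub>m n \<and> col W 0 = v"
proof (cases "v = unit_vec n 0")
  case True
  then show ?thesis using n by (intro bexI[of _ "1\<^sub>m n"]) auto
next
  case False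
  define u where "u i = (if i = 0 then 1 else 0) - v $ i" for i
  define s where "s = (\<Sum>i<n. (u i)\<^sup>2)"
  have vv: "(\<Sum>i<n. (v $ i)\<^sup>2) = 1"
    using v by (auto simp: scalar_prod_def power2_eq_square atLeast0LessThan)
  have "s = (\<Sum>i<n. (if i = 0 then 1 else 0) - 2 * (if i = 0 then v $ i else 0) + (v $ i)\<^sup>2)"
    unfolding s_def by (rule sum.cong) (auto simp: u_def power2_eq_square algebra_simps)
  also have "\<dots> = 2 - 2 * v $ 0"
    using n by (simp add: sum.distrib sum_subtractf vv flip: sum_distrib_left)
  finally have s2: "s = 2 - 2 * v $ 0" .
  have "\<exists>i<n. u i \<noteq> 0"
  proof (rule ccontr)
    assume "\<not> ?thesis"
    then have "v = unit_vec n 0" using v by (intro eq_vecI) (auto simp: u_def unit_vec_def split: if_splits)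
    with False show False by simp
  qed
  then have s0: "s > 0" unfolding s_def by (auto intro!: sum_pos2)
  define W where "W = mat n n (\<lambda>(i,j). (if i = j then 1 else 0) - 2 * u i * u j / s)"
  have W: "W \<in> carrier_mat n n" by (simp add: W_def)
  have "transpose_mat W = W" by (rule eq_matI) (auto simp: W_def)
  moreover have "W * W = 1\<^sub>m n"
  proof (rule eq_matI)
    fix i j assume ij: "i < dim_row (1\<^sub>m n)" "j < dim_col (1\<^sub>m n)"
    have "(W * W) $$ (i,j) = (\<Sum>k<n. ((if i = k then 1 else 0) - 2 * u i * u k / s) * ((if k = j then 1 else 0) - 2 * u k * u j / s))"
      using ij by (simp add: W_def scalar_prod_def atLeast0LessThan)
    also have "\<dots> = (\<Sum>k<n. (if k = i then (if i = j then 1 else 0) else 0) - (if k = i then 2 * u i * u j / s else 0)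
        - (if k = j then 2 * u i * u j / s else 0) + (4 * u i * u j / s^2) * (u k)\<^sup>2)"
      using s0 by (intro sum.cong refl) (auto simp: field_simps power2_eq_square)
    also have "\<dots> = (if i = j then 1 else 0) - 2 * (2 * u i * u j / s) + (4 * u i * u j / s^2) * s"
      using ij by (simp only: sum.distrib sum_subtractf flip: sum_distrib_left) (simp add: s_def)
    also have "\<dots> = 1\<^sub>m n $$ (i,j)" using ij s0 by (simp add: power2_eq_square field_simps)
    finally show "(W * W) $$ (i,j) = 1\<^sub>m n $$ (i,j)" .
  qed (auto simp: W_def)
  moreover have "col W 0 = v"
  proof (rule eq_vecI)
    fix i assume "i < dim_vec v"
    then have i: "i < n" using v by simp
    \<comment> \<open>Here \<open>u 0 = 1 - v $ 0\<close> is half of \<open>s\<close>, so column 0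
      is e_0 - u = v.\<close>
    have "2 * u 0 / s = 1" using s0 s2 by (simp add: u_def field_simps)
    then have "2 * u i * u 0 / s = u i" by (metis mult.commute mult.left_commute mult_1 times_divide_eq_left)
    then show "col W 0 $ i = v $ i" using i n by (simp add: W_def u_def)
  qed (use v in \<open>simp add: W_def\<close>)
  ultimately show ?thesis using W by blast
qed

text \<open>Deflation: conjugating with a reflection that sends e_0 to an eigenvector clears the
  first column below its diagonal entry, symmetry clears the first row, and the induction hypothesis
  handles the remaining block.\<close>

theorem symmetric_mat_diagonalizable:
  fixes A :: "real mat"
  assumes "A \<in> carrier_mat n n" and "transpose_mat A = A"
  shows "\<exists>P D. P \<in> carrier_mat n n \<and> D \<in> carrier_mat n n \<and> transpose_mat P * P = 1\<^sub>m n \<and>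
           diagonal_mat D \<and> transpose_mat P * A * P = D"
  using assms
proof (induct n arbitrary: A)
  case 0
  then show ?case by (intro exI[of _ "1\<^sub>m 0"] exI[of _ A]) (auto simp: diagonal_mat_def)
next
  case (Suc n)
  note A = Suc.prems(1)
  obtain v e where v: "v \<in> carrier_vec (Suc n)" "scalar_prod v v = 1" "A *\<^sub>v v = e \<cdot>\<^sub>v v"
    using symmetric_mat_eigenvector[OF Suc.prems] by auto
  obtain W where W: "W \<in> carrier_mat (Suc n) (Suc n)" "transpose_mat W = W" "W * W = 1\<^sub>m (Suc n)" "col W 0 = v"
    using householder[OF v(1,2)] by auto
  define B where "B = W * A * W"
  have B: "B \<in> carrier_mat (Suc n) (Suc n)" using A W by (simp add: B_def)
  have symB: "transpose_mat B = B"
    unfolding B_def using A W Suc.prems(2)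
    by (simp add: transpose_mult[of _ "Suc n" "Suc n" _ "Suc n"] assoc_mult_mat[of _ "Suc n" "Suc n" _ "Suc n" _ "Suc n"])
  have col0: "col B 0 = e \<cdot>\<^sub>v unit_vec (Suc n) 0"
  proof -
    have "col B 0 = (W * A) *\<^sub>v v" unfolding B_def
      using W A by (metis carrier_matD(2) col_mult2 mult_carrier_mat zero_less_Suc)
    also have "\<dots> = W *\<^sub>v (e \<cdot>\<^sub>v v)" using W A v by (metis assoc_mult_mat_vec)
    also have "\<dots> = e \<cdot>\<^sub>v (W *\<^sub>v v)" using mult_mat_vec[OF W(1) v(1)] by simp
    also have "W *\<^sub>v v = col (W * W) 0" using W by (metis carrier_matD(2) col_mult2 zero_less_Suc)
    also have "\<dots> = unit_vec (Suc n) 0" using W(3) by simp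
    finally show ?thesis .
  qed
  have B0: "B $$ (i,0) = (if i = 0 then e else 0)" if "i < Suc n" for i
    using arg_cong[OF col0, of "\<lambda>x. x $ i"] that B by auto
  have B0': "B $$ (0,i) = (if i = 0 then e else 0)" if "i < Suc n" for i
    using B0[OF that] symB B that by (metis carrier_matD index_transpose_mat(1) zero_less_Suc)
  define B3 where "B3 = mat n n (\<lambda>(i,j). B $$ (Suc i, Suc j))"
  define e1 where "e1 = mat 1 1 (\<lambda>_. e)"
  have Bblock: "B = four_block_mat e1 (0\<^sub>m 1 n) (0\<^sub>m n 1) B3"
    by (rule eq_matI) (use B B0 B0' in \<open>auto simp: e1_def B3_def four_block_mat_def Let_def\<close>)
  have B3: "B3 \<in> carrier_mat n n" by (simp add: B3_def)
  have Bij: "B $$ (i,j) = B $$ (j,i)" if "i < Suc n" "j < Suc n" for i j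
    using symB B that by (metis carrier_matD index_transpose_mat(1))
  have "transpose_mat B3 = B3"
    by (rule eq_matI) (auto simp: B3_def Bij)
  from Suc.hyps[OF B3 this] obtain P3 D3 where P3: "P3 \<in> carrier_mat n n" and D3: "D3 \<in> carrier_mat n n"
    and PP3: "transpose_mat P3 * P3 = 1\<^sub>m n" and diag3: "diagonal_mat D3" and PBP3: "transpose_mat P3 * B3 * P3 = D3"
    by auto
  define R where "R = four_block_mat (1\<^sub>m 1) (0\<^sub>m 1 n) (0\<^sub>m n 1) P3"
  have R: "R \<in> carrier_mat (Suc n) (Suc n)" using P3 by (auto simp: R_def)
  have Rt: "transpose_mat R = four_block_mat (1\<^sub>m 1) (0\<^sub>m 1 n) (0\<^sub>m n 1) (transpose_mat P3)"
    unfolding R_def using P3 by (subst transpose_four_block_mat[of _ 1 1 _ n _ n]) auto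
  have e1: "e1 \<in> carrier_mat 1 1" by (simp add: e1_def)
  have RR: "transpose_mat R * R = 1\<^sub>m (Suc n)"
    unfolding Rt unfolding R_def
    using P3 PP3 by (subst mult_four_block_mat[of _ 1 1 _ n _ n _ _ 1 _ n]) (auto simp: four_block_one_mat)
  have RBR: "transpose_mat R * B * R = four_block_mat e1 (0\<^sub>m 1 n) (0\<^sub>m n 1) D3"
  proof -
    have "transpose_mat R * B = four_block_mat e1 (0\<^sub>m 1 n) (0\<^sub>m n 1) (transpose_mat P3 * B3)"
      unfolding Rt Bblock using P3 B3 e1
      by (subst mult_four_block_mat[of _ 1 1 _ n _ n _ _ 1 _ n]) auto
    then show ?thesis unfolding R_def using P3 B3 e1 PBP3
      by (simp, subst mult_four_block_mat[of _ 1 1 _ n _ n _ _ 1 _ n]) auto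
  qed
  define P where "P = W * R"
  define D where "D = four_block_mat e1 (0\<^sub>m 1 n) (0\<^sub>m n 1) D3"
  have P: "P \<in> carrier_mat (Suc n) (Suc n)" using W R by (simp add: P_def)
  have D: "D \<in> carrier_mat (Suc n) (Suc n)" using e1 D3 by (auto simp: D_def)
  have Pt: "transpose_mat P = transpose_mat R * W"
    unfolding P_def using W R by (simp add: transpose_mult[of _ "Suc n" "Suc n" _ "Suc n"])
  have Rtc: "transpose_mat R \<in> carrier_mat (Suc n) (Suc n)" using R by simp
  note as = assoc_mult_mat[of _ "Suc n" "Suc n" _ "Suc n" _ "Suc n"]
  have "transpose_mat P * P = transpose_mat R * (W * W) * R"
    unfolding Pt unfolding P_def using W(1) R Rtc by (simp add: as)
  then have PP: "transpose_mat P * P = 1\<^sub>m (Suc n)" using RR Rtc W(3) R by simp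
  have "transpose_mat P * A * P = transpose_mat R * B * R"
    unfolding Pt B_def unfolding P_def using W R Rtc A by (simp add: as)
  then have PAP: "transpose_mat P * A * P = D" unfolding D_def using RBR by simp
  have "diagonal_mat D"
    using diag3 e1 D3 unfolding diagonal_mat_def D_def four_block_mat_def Let_def by auto
  then show ?case using P D PP PAP by blast
qed

text \<open>\<open>eig_count\<close> takes multiplicities as root orders of the characteristic
  polynomial; after diagonalisation this turns them into numbers of diagonal entries.\<close>

lemma order_prod_linear:
  fixes d :: "nat \<Rightarrow> real"
  assumes "finite I"
  shows "order a (\<Prod>i\<in>I. [:- d i, 1:]) = card {i\<in>I. d i = a}"
  using assms
proof (induct rule: finite_induct)
  case empty
  then show ?case by (simp add: order_0I)
next
  case (insert k I)
  have nz: "[:- d k, 1:] * (\<Prod>i\<in>I. [:- d i, 1:]) \<noteq> 0"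
    using insert(1) by (simp only: mult_eq_0_iff prod_zero_iff) auto
  have 1: "order a [:- d k, 1:] = (if d k = a then 1 else 0)"
    using order_power_n_n[of a 1] by (auto intro: order_0I)
  have "{i \<in> insert k I. d i = a} = (if d k = a then insert k {i\<in>I. d i = a} else {i\<in>I. d i = a})" by auto
  then show ?case using insert order_mult[OF nz] 1 by simp
qed

text \<open>Gaussian elimination, one equation and one pivot unknown at a time. This is the
  dimension argument behind every comparison of eigenvalue counts.\<close>

lemma homogeneous_system:
  fixes a :: "'k \<Rightarrow> 'j \<Rightarrow> real"
  assumes "finite K" "finite J" "card K < card J"
  shows "\<exists>c. (\<exists>j\<in>J. c j \<noteq> 0) \<and> (\<forall>k\<in>K. (\<Sum>j\<in>J. a k j * c j) = 0)"
  using assms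
proof (induct K arbitrary: J a rule: finite_induct)
  case empty
  then show ?case by (intro exI[of _ "\<lambda>_. 1"]) (auto simp: card_gt_0_iff)
next
  case (insert k K)
  show ?case
  proof (cases "\<forall>j\<in>J. a k j = 0")
    case True
    have "card K < card J" using insert by simp
    from insert(3)[OF insert(4) this, of a] True show ?thesis by auto
  next
    case False
    then obtain p where p: "p \<in> J" "a k p \<noteq> 0" by auto
    \<comment> \<open>Equation \<open>k\<close> is solved for the unknown \<open>p\<close>; these
      are the coefficients after substitution.\<close>
    define a' where "a' i j = a i j - a i p * a k j / a k p" for i j
    have "card K < card (J - {p})" using insert p by simp
    from insert(3)[OF _ this, of a'] insert(4) obtain c where
      c: "\<exists>j\<in>J - {p}. c j \<noteq> 0" "\<forall>i\<in>K. (\<Sum>j\<in>J - {p}. a' i j * c j) = 0" by auto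
    define s where "s = (\<Sum>j\<in>J - {p}. a k j * c j)"
    define c' where "c' = c(p := - s / a k p)"
    have sum: "(\<Sum>j\<in>J. a i j * c' j) = (\<Sum>j\<in>J - {p}. a i j * c j) - a i p * s / a k p" for i
    proof -
      have "(\<Sum>j\<in>J. a i j * c' j) = a i p * c' p + (\<Sum>j\<in>J - {p}. a i j * c' j)"
        using insert(4) p(1) by (rule sum.remove)
      also have "(\<Sum>j\<in>J - {p}. a i j * c' j) = (\<Sum>j\<in>J - {p}. a i j * c j)"
        by (rule sum.cong) (auto simp: c'_def)
      finally show ?thesis by (simp add: c'_def)
    qed
    have "(\<Sum>j\<in>J. a i j * c' j) = 0" if "i \<in> insert k K" for i
    proof (cases "i = k")
      case True
      then show ?thesis using p by (simp add: sum s_def)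
    next
      case False
      have "(\<Sum>j\<in>J - {p}. a' i j * c j) = (\<Sum>j\<in>J - {p}. a i j * c j - a i p / a k p * (a k j * c j))"
        by (rule sum.cong) (auto simp: a'_def algebra_simps)
      also have "\<dots> = (\<Sum>j\<in>J. a i j * c' j)"
        unfolding sum by (simp add: sum_subtractf s_def sum_distrib_left sum_divide_distrib)
      finally show ?thesis using c(2) that False by auto
    qed
    moreover have "\<exists>j\<in>J. c' j \<noteq> 0" using c(1) by (auto simp: c'_def)
    ultimately show ?thesis by blast
  qed
qed

section \<open>Eigenvalue counts through test families\<close>

definition qform :: "('v \<Rightarrow> 'v \<Rightarrow> real) \<Rightarrow> 'v set \<Rightarrow> ('v \<Rightarrow> real) \<Rightarrow> real" where
  "qform K B f = (\<Sum>x\<in>B. \<Sum>y\<in>B. K x y * f x * f y)"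

text \<open>Encodes a subspace of dimension \<open>card J\<close> on which the form is at most E
  times the squared norm; the nonvanishing clause is linear independence on \<open>B\<close>.
  Arbitrary index sets let the families of several blocks be joined as a dependent sum.\<close>

definition low_family :: "real \<Rightarrow> (('v \<Rightarrow> real) \<Rightarrow> real) \<Rightarrow> 'v set \<Rightarrow> 'j set \<Rightarrow> ('j \<Rightarrow> 'v \<Rightarrow> real) \<Rightarrow> bool" where
  "low_family E q B J u \<longleftrightarrow> (\<forall>c. (\<exists>j\<in>J. c j \<noteq> 0) \<longrightarrow>
     (\<exists>x\<in>B. (\<Sum>j\<in>J. c j * u j x) \<noteq> 0) \<and>
     q (\<lambda>x. \<Sum>j\<in>J. c j * u j x) \<le> E * (\<Sum>x\<in>B. (\<Sum>j\<in>J. c j * u j x)\<^sup>2))"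

text \<open>Encodes a codimension bound: \<open>card J\<close> linear conditions that leave only
  functions with form strictly above the threshold. Strictness is what contradicts a low
  family.\<close>

definition high_family :: "real \<Rightarrow> (('v \<Rightarrow> real) \<Rightarrow> real) \<Rightarrow> 'v set \<Rightarrow> 'j set \<Rightarrow> ('j \<Rightarrow> 'v \<Rightarrow> real) \<Rightarrow> bool" where
  "high_family E q B J \<phi> \<longleftrightarrow> (\<forall>f. (\<exists>x\<in>B. f x \<noteq> 0) \<longrightarrow> (\<forall>j\<in>J. (\<Sum>x\<in>B. \<phi> j x * f x) = 0) \<longrightarrow>
     E * (\<Sum>x\<in>B. (f x)\<^sup>2) < q f)"

text \<open>More vectors than conditions leave a nontrivial combination that meets all conditions,
  and its form would be both at most and above the threshold. This takes the place of the min-max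
  principle.\<close>

lemma low_le_high:
  assumes "finite J" "finite K" "low_family E q B J u" "high_family E q B K \<phi>"
  shows "card J \<le> card K"
proof (rule ccontr)
  assume "\<not> ?thesis"
  then obtain c where c: "\<exists>j\<in>J. c j \<noteq> 0" "\<forall>k\<in>K. (\<Sum>j\<in>J. (\<Sum>x\<in>B. \<phi> k x * u j x) * c j) = 0"
    using homogeneous_system[OF assms(2,1), of "\<lambda>k j. \<Sum>x\<in>B. \<phi> k x * u j x"] by auto
  define f where "f x = (\<Sum>j\<in>J. c j * u j x)" for x
  have f: "\<exists>x\<in>B. f x \<noteq> 0" "q f \<le> E * (\<Sum>x\<in>B. (f x)\<^sup>2)"
    using assms(3) c(1) unfolding low_family_def f_def by auto
  have "(\<Sum>x\<in>B. \<phi> k x * f x) = 0" if "k \<in> K" for k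
  proof -
    have "(\<Sum>x\<in>B. \<phi> k x * f x) = (\<Sum>x\<in>B. \<Sum>j\<in>J. \<phi> k x * u j x * c j)"
      unfolding f_def by (simp add: sum_distrib_left mult_ac)
    also have "\<dots> = (\<Sum>j\<in>J. \<Sum>x\<in>B. \<phi> k x * u j x * c j)" by (rule sum.swap)
    also have "\<dots> = 0" using c(2) that by (simp add: sum_distrib_right)
    finally show ?thesis .
  qed
  then have "E * (\<Sum>x\<in>B. (f x)\<^sup>2) < q f" using assms(4) f(1) unfolding high_family_def by blast
  with f(2) show False by simp
qed

text \<open>An orthonormal eigenbasis written on \<open>B\<close> itself, so that the arbitrary
  enumeration hidden in \<open>restr_mat\<close> disappears from all later arguments.\<close>

definition diagonalises :: "('v \<Rightarrow> 'v \<Rightarrow> real) \<Rightarrow> 'v set \<Rightarrow> (nat \<Rightarrow> 'v \<Rightarrow> real) \<Rightarrow> (nat \<Rightarrow> real) \<Rightarrow> bool" where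
  "diagonalises K B w d \<longleftrightarrow>
    (\<forall>i<card B. \<forall>j<card B. (\<Sum>x\<in>B. w i x * w j x) = (if i = j then 1 else 0)) \<and>
    (\<forall>f. (\<Sum>x\<in>B. (f x)\<^sup>2) = (\<Sum>i<card B. (\<Sum>x\<in>B. w i x * f x)\<^sup>2)) \<and>
    (\<forall>f. qform K B f = (\<Sum>i<card B. d i * (\<Sum>x\<in>B. w i x * f x)\<^sup>2)) \<and>
    (\<forall>E. eig_count E (restr_mat K B) = card {i. i < card B \<and> d i \<le> E})"

lemma spectral_basis:
  fixes K :: "'v \<Rightarrow> 'v \<Rightarrow> real"
  assumes B: "finite B" and sym: "\<And>x y. x \<in> B \<Longrightarrow> y \<in> B \<Longrightarrow> K x y = K y x"
  shows "\<exists>w d. diagonalises K B w d"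
proof -
  define n where "n = card B"
  define e where "e = (SOME e. bij_betw e {..<card B} B)"
  have "\<exists>e. bij_betw e {..<card B} B" using B by (metis bij_betw_from_nat_into_finite)
  then have e: "bij_betw e {..<n} B" unfolding e_def n_def by (rule someI_ex)
  have eB: "e i \<in> B" if "i < n" for i using e that by (auto simp: bij_betw_def)
  define A where "A = restr_mat K B"
  have A_eq: "A = mat n n (\<lambda>(i,j). K (e i) (e j))"
    unfolding A_def restr_mat_def Let_def n_def e_def ..
  have A: "A \<in> carrier_mat n n" by (simp add: A_eq)
  have "transpose_mat A = A" by (rule eq_matI) (auto simp: A_eq sym eB)
  from symmetric_mat_diagonalizable[OF A this] obtain P D where
    P: "P \<in> carrier_mat n n" and D: "D \<in> carrier_mat n n" and PP: "transpose_mat P * P = 1\<^sub>m n"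
    and diag: "diagonal_mat D" and PAP: "transpose_mat P * A * P = D" by auto
  have Pt: "transpose_mat P \<in> carrier_mat n n" using P by simp
  have PP': "P * transpose_mat P = 1\<^sub>m n" using mat_mult_left_right_inverse[OF Pt P PP] .
  define d where "d i = D $$ (i,i)" for i
  have Dij: "D $$ (i,j) = (if i = j then d i else 0)" if "i < n" "j < n" for i j
    using diag D that unfolding diagonal_mat_def d_def by auto
  have "similar_mat_wit D A (transpose_mat P) P"
    by (rule similar_mat_witI[OF PP PP' PAP[symmetric] D A Pt P])
  then have "similar_mat D A" unfolding similar_mat_def by blast
  then have "char_poly A = char_poly D" by (simp add: char_poly_similar)
  also have "\<dots> = (\<Prod>a\<leftarrow>diag_mat D. [:- a, 1:])"
    by (rule char_poly_upper_triangular[OF D]) (use D Dij in \<open>auto simp: upper_triangular_def\<close>)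
  also have "\<dots> = (\<Prod>i<n. [:- d i, 1:])"
    using D by (simp add: diag_mat_def d_def o_def prod.list_conv_set_nth atLeast0LessThan)
  finally have cp: "char_poly A = (\<Prod>i<n. [:- d i, 1:])" .
  have cnt: "eig_count E A = card {i. i < n \<and> d i \<le> E}" for E
  proof -
    have "poly (char_poly A) a = 0 \<longleftrightarrow> a \<in> d ` {..<n}" for a
      unfolding cp poly_prod by (auto simp: prod_zero_iff)
    then have roots: "{a. poly (char_poly A) a = 0 \<and> a \<le> E} = {a \<in> d ` {..<n}. a \<le> E}" by auto
    have "eig_count E A = (\<Sum>a\<in>{a \<in> d ` {..<n}. a \<le> E}. card {i\<in>{..<n}. d i = a})"
      unfolding eig_count_def roots unfolding cp by (intro sum.cong refl order_prod_linear) simp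
    also have "\<dots> = card (\<Union>a\<in>{a \<in> d ` {..<n}. a \<le> E}. {i\<in>{..<n}. d i = a})"
      by (subst card_UN_disjoint) auto
    also have "(\<Union>a\<in>{a \<in> d ` {..<n}. a \<le> E}. {i\<in>{..<n}. d i = a}) = {i. i < n \<and> d i \<le> E}" by auto
    finally show ?thesis .
  qed
  \<comment> \<open>\<open>h\<close> inverts the enumeration, which turns the columns of
    \<open>P\<close> into functions on \<open>B\<close>.\<close>
  define h where "h = inv_into {..<n} e"
  have he: "h (e i) = i" if "i < n" for i using e that by (simp add: h_def bij_betw_def inv_into_f_f)
  define w where "w i x = P $$ (h x, i)" for i x
  have reidx: "(\<Sum>x\<in>B. F x) = (\<Sum>k<n. F (e k))" for F :: "'v \<Rightarrow> real"
    using sum.reindex_bij_betw[OF e, of F] by simp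
  have wf: "(\<Sum>x\<in>B. w i x * f x) = (\<Sum>k<n. P $$ (k,i) * f (e k))" for i f
    unfolding reidx by (rule sum.cong) (auto simp: w_def he)
  have orth: "(\<Sum>k<n. P $$ (k,i) * P $$ (k,j)) = (if i = j then 1 else 0)" if "i < n" "j < n" for i j
  proof -
    have "(transpose_mat P * P) $$ (i,j) = (\<Sum>k<n. P $$ (k,i) * P $$ (k,j))"
      using P that by (simp add: scalar_prod_def atLeast0LessThan)
    then show ?thesis using PP that by simp
  qed
  have orth': "(\<Sum>k<n. P $$ (i,k) * P $$ (j,k)) = (if i = j then 1 else 0)" if "i < n" "j < n" for i j
  proof -
    have "(P * transpose_mat P) $$ (i,j) = (\<Sum>k<n. P $$ (i,k) * P $$ (j,k))"
      using P that by (simp add: scalar_prod_def atLeast0LessThan)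
    then show ?thesis using PP' that by simp
  qed
  have AP: "A = P * D * transpose_mat P"
  proof -
    have "P * D * transpose_mat P = (P * transpose_mat P) * A * (P * transpose_mat P)"
      unfolding PAP[symmetric] using P Pt A by (simp add: assoc_mult_mat[of _ n n _ n _ n])
    then show ?thesis unfolding PP' using A by simp
  qed
  have Aij: "K (e i) (e j) = (\<Sum>k<n. d k * P $$ (i,k) * P $$ (j,k))" if ij: "i < n" "j < n" for i j
  proof -
    have mt: "(M * transpose_mat P) $$ (i,j) = (\<Sum>k<n. M $$ (i,k) * P $$ (j,k))" if "M \<in> carrier_mat n n" for M
      using P that ij by (simp add: scalar_prod_def atLeast0LessThan)
    have "A $$ (i,j) = (\<Sum>k<n. (P * D) $$ (i,k) * P $$ (j,k))"
      unfolding AP by (rule mt) (use P D in simp)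
    also have "\<dots> = (\<Sum>k<n. d k * P $$ (i,k) * P $$ (j,k))"
    proof (intro sum.cong refl)
      fix k assume "k \<in> {..<n}"
      then have k: "k < n" by simp
      have "(P * D) $$ (i,k) = (\<Sum>l<n. P $$ (i,l) * D $$ (l,k))"
        using P D ij k by (simp add: scalar_prod_def atLeast0LessThan)
      also have "\<dots> = (\<Sum>l<n. if l = k then P $$ (i,k) * d k else 0)"
        by (rule sum.cong) (auto simp: Dij k)
      also have "\<dots> = P $$ (i,k) * d k" using k by simp
      finally show "(P * D) $$ (i,k) * P $$ (j,k) = d k * P $$ (i,k) * P $$ (j,k)" by (simp add: mult_ac)
    qed
    finally show ?thesis using ij by (simp add: A_eq)
  qed
  have sq: "(\<Sum>k<n. P $$ (k,i) * g k)\<^sup>2 = (\<Sum>k<n. \<Sum>l<n. (P $$ (k,i) * P $$ (l,i)) * (g k * g l))" for i and g :: "nat \<Rightarrow> real"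
    unfolding power2_eq_square sum_product by (intro sum.cong refl) (simp add: mult_ac)
  have gen: "(\<Sum>i<n. a i * (\<Sum>k<n. P $$ (k,i) * g k)\<^sup>2) = (\<Sum>k<n. \<Sum>l<n. (\<Sum>i<n. a i * P $$ (k,i) * P $$ (l,i)) * (g k * g l))"
    for a and g :: "nat \<Rightarrow> real"
  proof -
    have "(\<Sum>i<n. a i * (\<Sum>k<n. P $$ (k,i) * g k)\<^sup>2) = (\<Sum>i<n. \<Sum>k<n. \<Sum>l<n. a i * P $$ (k,i) * P $$ (l,i) * (g k * g l))"
      unfolding sq by (simp add: sum_distrib_left mult_ac)
    also have "\<dots> = (\<Sum>k<n. \<Sum>i<n. \<Sum>l<n. a i * P $$ (k,i) * P $$ (l,i) * (g k * g l))" by (rule sum.swap)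
    also have "\<dots> = (\<Sum>k<n. \<Sum>l<n. \<Sum>i<n. a i * P $$ (k,i) * P $$ (l,i) * (g k * g l))"
      by (intro sum.cong refl sum.swap)
    finally show ?thesis by (simp add: sum_distrib_right)
  qed
  have 1: "(\<Sum>x\<in>B. (f x)\<^sup>2) = (\<Sum>i<n. (\<Sum>x\<in>B. w i x * f x)\<^sup>2)" for f
  proof -
    have "(\<Sum>i<n. (\<Sum>x\<in>B. w i x * f x)\<^sup>2) = (\<Sum>k<n. \<Sum>l<n. (if k = l then 1 else 0) * (f (e k) * f (e l)))"
      unfolding wf using gen[of "\<lambda>_. 1" "\<lambda>k. f (e k)"] orth' by simp
    also have "\<dots> = (\<Sum>k<n. (f (e k))\<^sup>2)"
    proof (intro sum.cong refl)
      fix k assume "k \<in> {..<n}"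
      then have "(\<Sum>l<n. (if k = l then 1 else 0) * (f (e k) * f (e l))) = (\<Sum>l<n. if l = k then (f (e k))\<^sup>2 else 0)"
        by (intro sum.cong) (auto simp: power2_eq_square)
      then show "(\<Sum>l<n. (if k = l then 1 else 0) * (f (e k) * f (e l))) = (f (e k))\<^sup>2"
        using \<open>k \<in> {..<n}\<close> by simp
    qed
    finally show ?thesis by (simp add: reidx)
  qed
  have 2: "qform K B f = (\<Sum>i<n. d i * (\<Sum>x\<in>B. w i x * f x)\<^sup>2)" for f
    unfolding wf gen qform_def reidx by (intro sum.cong refl) (simp add: Aij mult.assoc)
  have 3: "(\<Sum>x\<in>B. w i x * w j x) = (if i = j then 1 else 0)" if "i < n" "j < n" for i j
  proof -
    have "(\<Sum>x\<in>B. w i x * w j x) = (\<Sum>k<n. P $$ (k,i) * P $$ (k,j))"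
      unfolding wf by (rule sum.cong) (auto simp: w_def he)
    then show ?thesis using orth[OF that] by simp
  qed
  have "diagonalises K B w d"
    unfolding diagonalises_def n_def[symmetric] A_def[symmetric] using 1 2 3 cnt by blast
  then show ?thesis by blast
qed

text \<open>The eigenvectors with eigenvalue at most E form the family: on their span each term of
  the diagonalised form is at most E times its Parseval term.\<close>

lemma eig_count_low_family:
  fixes K :: "'v \<Rightarrow> 'v \<Rightarrow> real"
  assumes B: "finite B" and sym: "\<And>x y. x \<in> B \<Longrightarrow> y \<in> B \<Longrightarrow> K x y = K y x"
  obtains J :: "nat set" and u where "finite J" "card J = eig_count E (restr_mat K B)" "low_family E (qform K B) B J u"
proof -
  obtain w :: "nat \<Rightarrow> 'v \<Rightarrow> real" and d where wd: "diagonalises K B w d"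
    using spectral_basis[where K=K, OF B sym] by blast
  then have
    orth: "\<And>i j. i < card B \<Longrightarrow> j < card B \<Longrightarrow> (\<Sum>x\<in>B. w i x * w j x) = (if i = j then 1 else 0)" and
    nrm: "\<And>f. (\<Sum>x\<in>B. (f x)\<^sup>2) = (\<Sum>i<card B. (\<Sum>x\<in>B. w i x * f x)\<^sup>2)" and
    form: "\<And>f. qform K B f = (\<Sum>i<card B. d i * (\<Sum>x\<in>B. w i x * f x)\<^sup>2)" and
    cnt: "\<And>E. eig_count E (restr_mat K B) = card {i. i < card B \<and> d i \<le> E}"
    unfolding diagonalises_def by blast+
  define J where "J = {i. i < card B \<and> d i \<le> E}"
  have J: "finite J" by (simp add: J_def)
  have "low_family E (qform K B) B J w" unfolding low_family_def
  proof (intro allI impI)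
    fix c assume c: "\<exists>j\<in>J. c j \<noteq> (0::real)"
    define f where "f x = (\<Sum>j\<in>J. c j * w j x)" for x
    have co: "(\<Sum>x\<in>B. w i x * f x) = (if i \<in> J then c i else 0)" if "i < card B" for i
    proof -
      have "(\<Sum>x\<in>B. w i x * f x) = (\<Sum>x\<in>B. \<Sum>j\<in>J. c j * (w i x * w j x))"
        unfolding f_def by (simp add: sum_distrib_left mult_ac)
      also have "\<dots> = (\<Sum>j\<in>J. \<Sum>x\<in>B. c j * (w i x * w j x))" by (rule sum.swap)
      also have "\<dots> = (\<Sum>j\<in>J. if j = i then c i else 0)"
        by (rule sum.cong) (auto simp: orth that J_def simp flip: sum_distrib_left)
      finally show ?thesis using J by simp
    qed
    obtain j where j: "j \<in> J" "c j \<noteq> 0" using c by auto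
    have "\<exists>x\<in>B. f x \<noteq> 0"
    proof (rule ccontr)
      assume "\<not> ?thesis"
      then have "(\<Sum>x\<in>B. w j x * f x) = 0" by simp
      with co[of j] j show False by (simp add: J_def)
    qed
    moreover have "qform K B f \<le> E * (\<Sum>x\<in>B. (f x)\<^sup>2)"
      unfolding form nrm sum_distrib_left
      by (rule sum_mono) (auto simp: co J_def intro!: mult_right_mono)
    ultimately show "(\<exists>x\<in>B. (\<Sum>j\<in>J. c j * w j x) \<noteq> 0) \<and>
       qform K B (\<lambda>x. \<Sum>j\<in>J. c j * w j x) \<le> E * (\<Sum>x\<in>B. (\<Sum>j\<in>J. c j * w j x)\<^sup>2)"
      unfolding f_def by auto
  qed
  with J cnt[of E] show ?thesis by (intro that[of J w]) (simp_all add: J_def)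
qed

text \<open>The same eigenvectors serve as conditions. A nonzero function orthogonal to them has a
  nonzero coefficient at an eigenvalue above E, which makes one term of the comparison
  strict.\<close>

lemma eig_count_high_family:
  fixes K :: "'v \<Rightarrow> 'v \<Rightarrow> real"
  assumes B: "finite B" and sym: "\<And>x y. x \<in> B \<Longrightarrow> y \<in> B \<Longrightarrow> K x y = K y x"
  obtains J :: "nat set" and \<phi> where "finite J" "card J = eig_count E (restr_mat K B)" "high_family E (qform K B) B J \<phi>"
proof -
  obtain w :: "nat \<Rightarrow> 'v \<Rightarrow> real" and d where wd: "diagonalises K B w d"
    using spectral_basis[where K=K, OF B sym] by blast
  then have
    orth: "\<And>i j. i < card B \<Longrightarrow> j < card B \<Longrightarrow> (\<Sum>x\<in>B. w i x * w j x) = (if i = j then 1 else 0)" and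
    nrm: "\<And>f. (\<Sum>x\<in>B. (f x)\<^sup>2) = (\<Sum>i<card B. (\<Sum>x\<in>B. w i x * f x)\<^sup>2)" and
    form: "\<And>f. qform K B f = (\<Sum>i<card B. d i * (\<Sum>x\<in>B. w i x * f x)\<^sup>2)" and
    cnt: "\<And>E. eig_count E (restr_mat K B) = card {i. i < card B \<and> d i \<le> E}"
    unfolding diagonalises_def by blast+
  define J where "J = {i. i < card B \<and> d i \<le> E}"
  have J: "finite J" by (simp add: J_def)
  have "high_family E (qform K B) B J w" unfolding high_family_def
  proof (intro allI impI)
    fix f assume f: "\<exists>x\<in>B. f x \<noteq> (0::real)" and 0: "\<forall>j\<in>J. (\<Sum>x\<in>B. w j x * f x) = 0"
    have "(\<Sum>x\<in>B. (f x)\<^sup>2) > 0" using f B by (auto intro!: sum_pos2)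
    then have "\<exists>i<card B. (\<Sum>x\<in>B. w i x * f x) \<noteq> 0" unfolding nrm by (metis (no_types, lifting) lessThan_iff less_irrefl sum.neutral zero_power2)
    then obtain i where i: "i < card B" "(\<Sum>x\<in>B. w i x * f x) \<noteq> 0" by auto
    with 0 have "E < d i" by (force simp: J_def)
    show "E * (\<Sum>x\<in>B. (f x)\<^sup>2) < qform K B f"
      unfolding form nrm sum_distrib_left
    proof (rule sum_strict_mono_ex1)
      show "\<forall>k\<in>{..<card B}. E * (\<Sum>x\<in>B. w k x * f x)\<^sup>2 \<le> d k * (\<Sum>x\<in>B. w k x * f x)\<^sup>2"
      proof
        fix k assume "k \<in> {..<card B}"
        then show "E * (\<Sum>x\<in>B. w k x * f x)\<^sup>2 \<le> d k * (\<Sum>x\<in>B. w k x * f x)\<^sup>2"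
          using 0 by (cases "d k \<le> E") (auto simp: J_def intro!: mult_right_mono)
      qed
      show "\<exists>k\<in>{..<card B}. E * (\<Sum>x\<in>B. w k x * f x)\<^sup>2 < d k * (\<Sum>x\<in>B. w k x * f x)\<^sup>2"
        using i \<open>E < d i\<close> by (intro bexI[of _ i]) auto
    qed simp
  qed
  with J cnt[of E] show ?thesis by (intro that[of J w]) (simp_all add: J_def)
qed

lemma eig_count_ge:
  assumes "finite B" "\<And>x y. x \<in> B \<Longrightarrow> y \<in> B \<Longrightarrow> K x y = K y x" "finite J" "low_family E (qform K B) B J u"
  shows "card J \<le> eig_count E (restr_mat K B)"
proof -
  obtain I :: "nat set" and \<phi> where "finite I" "card I = eig_count E (restr_mat K B)" "high_family E (qform K B) B I \<phi>"
    by (rule eig_count_high_family[where K=K, OF assms(1,2)])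
  then show ?thesis using low_le_high[OF assms(3) _ assms(4), of I \<phi>] by simp
qed

lemma eig_count_le:
  assumes "finite B" "\<And>x y. x \<in> B \<Longrightarrow> y \<in> B \<Longrightarrow> K x y = K y x" "finite J" "high_family E (qform K B) B J \<phi>"
  shows "eig_count E (restr_mat K B) \<le> card J"
proof -
  obtain I :: "nat set" and u where "finite I" "card I = eig_count E (restr_mat K B)" "low_family E (qform K B) B I u"
    by (rule eig_count_low_family[where K=K, OF assms(1,2)])
  then show ?thesis using low_le_high[OF _ assms(3) _ assms(4), of I u] by simp
qed

lemma eig_count_le_card:
  assumes "finite B" "\<And>x y. x \<in> B \<Longrightarrow> y \<in> B \<Longrightarrow> K x y = K y x"
  shows "eig_count E (restr_mat K B) \<le> card B"
proof -
  obtain d :: "nat \<Rightarrow> real" where "\<forall>E. eig_count E (restr_mat K B) = card {i. i < card B \<and> d i \<le> E}"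
    using spectral_basis[where K=K, OF assms] unfolding diagonalises_def by blast
  then have "eig_count E (restr_mat K B) = card {i. i < card B \<and> d i \<le> E}" by blast
  also have "\<dots> \<le> card {..<card B}" by (rule card_mono) auto
  finally show ?thesis by simp
qed

lemma eig_count_mono:
  assumes "finite B" "\<And>x y. x \<in> B \<Longrightarrow> y \<in> B \<Longrightarrow> K x y = K y x" "E \<le> E'"
  shows "eig_count E (restr_mat K B) \<le> eig_count E' (restr_mat K B)"
proof -
  obtain d where "\<forall>E. eig_count E (restr_mat K B) = card {i. i < card B \<and> d i \<le> (E::real)}"
    using spectral_basis[where K=K, OF assms(1,2)] unfolding diagonalises_def by blast
  then show ?thesis using assms(3) by (auto intro!: card_mono)
qed

lemma eig_count_right_continuous:
  assumes "finite B" "\<And>x y. x \<in> B \<Longrightarrow> y \<in> B \<Longrightarrow> K x y = K y x"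
  shows "\<exists>\<epsilon>>0. eig_count (E + \<epsilon>) (restr_mat K B) = eig_count E (restr_mat K B)"
proof -
  obtain d where cnt: "\<forall>E. eig_count E (restr_mat K B) = card {i. i < card B \<and> d i \<le> (E::real)}"
    using spectral_basis[where K=K, OF assms(1,2)] unfolding diagonalises_def by blast
  \<comment> \<open>Gaps from E up to the larger eigenvalues; the 1 keeps \<open>S\<close> nonempty
    when there are none. Moving by half the least gap reaches no new eigenvalue.\<close>
  define S where "S = insert 1 {d i - E | i. i < card B \<and> d i > E}"
  have S: "finite S" "S \<noteq> {}" "\<forall>s\<in>S. s > 0" by (auto simp: S_def)
  define \<epsilon> where "\<epsilon> = Min S / 2"
  have pos: "Min S > 0" using S by simp
  have "d i \<le> E" if "i < card B" "d i \<le> E + \<epsilon>" for i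
  proof (rule ccontr)
    assume "\<not> ?thesis"
    then have "d i - E \<in> S" using that by (auto simp: S_def)
    then have "Min S \<le> d i - E" using S by simp
    then show False using that pos by (simp add: \<epsilon>_def)
  qed
  then have "{i. i < card B \<and> d i \<le> E + \<epsilon>} = {i. i < card B \<and> d i \<le> E}" using pos by (force simp: \<epsilon>_def)
  then show ?thesis using pos cnt by (intro exI[of _ \<epsilon>]) (simp add: \<epsilon>_def)
qed

section \<open>The Sierpinski lattice in integer coordinates\<close>

text \<open>Coordinates with respect to the basis \<open>sa2\<close>, \<open>sa3\<close>:
  subdivision becomes translation of natural numbers, and geometry reduces to arithmetic. A unit
  triangle is named by its lower left vertex.\<close>

type_synonym idx = "nat \<times> nat"

definition sx :: "nat \<Rightarrow> idx \<Rightarrow> idx" where "sx n p = (fst p + 2 ^ n, snd p)"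
definition sy :: "nat \<Rightarrow> idx \<Rightarrow> idx" where "sy n p = (fst p, snd p + 2 ^ n)"
definition right :: "idx \<Rightarrow> idx" where "right p = (Suc (fst p), snd p)"
definition up :: "idx \<Rightarrow> idx" where "up p = (fst p, Suc (snd p))"

fun cells :: "nat \<Rightarrow> idx set" where
  "cells 0 = {(0, 0)}"
| "cells (Suc n) = cells n \<union> sx n ` cells n \<union> sy n ` cells n"

definition cverts :: "idx \<Rightarrow> idx set" where "cverts t = {t, right t, up t}"
definition verts :: "nat \<Rightarrow> idx set" where "verts n = (\<Union>t\<in>cells n. cverts t)"
definition corners :: "nat \<Rightarrow> idx set" where "corners n = {(0, 0), (2 ^ n, 0), (0, 2 ^ n)}"
definition inner_verts :: "nat \<Rightarrow> idx set" where "inner_verts n = verts n - corners n"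

definition csum :: "(idx \<Rightarrow> real) \<Rightarrow> idx \<Rightarrow> real" where
  "csum g t = g t + g (right t) + g (up t)"

lemma sx_inj [simp]: "inj (sx n)" and sy_inj [simp]: "inj (sy n)"
  by (auto simp: inj_def sx_def sy_def prod_eq_iff)

lemma shift_right_up:
  "right (sx n p) = sx n (right p)" "up (sx n p) = sx n (up p)"
  "right (sy n p) = sy n (right p)" "up (sy n p) = sy n (up p)"
  by (auto simp: right_def up_def sx_def sy_def)

lemma cverts_shift: "cverts (sx n t) = sx n ` cverts t" "cverts (sy n t) = sy n ` cverts t"
  by (auto simp: cverts_def shift_right_up)

lemma csum_shift: "csum g (sx n t) = csum (\<lambda>p. g (sx n p)) t" "csum g (sy n t) = csum (\<lambda>p. g (sy n p)) t"
  by (auto simp: csum_def shift_right_up)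

lemma cells_bound: "t \<in> cells n \<Longrightarrow> fst t + snd t < 2 ^ n"
  by (induct n arbitrary: t) (auto simp: sx_def sy_def, force+)

lemma finite_cells [simp]: "finite (cells n)"
  by (induct n) auto

lemma cells_mono: "m \<le> n \<Longrightarrow> cells m \<subseteq> cells n"
  by (rule lift_Suc_mono_le[of cells]) auto

text \<open>Lower left vertices obey the strict bound \<open>cells_bound\<close>, so the three
  copies do not meet, whereas the vertex sets of the copies do.\<close>

lemma cells_disjoint:
  "cells n \<inter> sx n ` cells n = {}" "(cells n \<union> sx n ` cells n) \<inter> sy n ` cells n = {}"
  using cells_bound[of _ n] by (fastforce simp: sx_def sy_def)+

lemma sum_cells_Suc:
  fixes g :: "idx \<Rightarrow> real"
  shows "sum g (cells (Suc n)) = sum g (cells n) + (\<Sum>t\<in>cells n. g (sx n t)) + (\<Sum>t\<in>cells n. g (sy n t))"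
proof -
  have "sum g (cells (Suc n)) = sum g (cells n) + sum g (sx n ` cells n) + sum g (sy n ` cells n)"
    by (simp add: sum.union_disjoint cells_disjoint)
  then show ?thesis by (simp add: sum.reindex inj_on_subset[OF sx_inj] inj_on_subset[OF sy_inj] o_def)
qed

lemma card_cells: "card (cells n) = 3 ^ n"
proof (induct n)
  case (Suc n)
  have "card (cells (Suc n)) = card (cells n) + card (sx n ` cells n) + card (sy n ` cells n)"
    by (simp add: card_Un_disjoint cells_disjoint)
  then show ?case using Suc by (simp add: card_image inj_on_subset[OF sx_inj] inj_on_subset[OF sy_inj])
qed simp

lemma finite_verts [simp]: "finite (verts n)"
  by (auto simp: verts_def cverts_def)

lemma finite_corners [simp]: "finite (corners n)"
  by (auto simp: corners_def)

lemma finite_inner_verts [simp]: "finite (inner_verts n)"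
  by (auto simp: inner_verts_def)

lemma verts_0: "verts 0 = {(0, 0), (1, 0), (0, 1)}"
  by (auto simp: verts_def cverts_def right_def up_def)

lemma verts_Suc: "verts (Suc n) = verts n \<union> sx n ` verts n \<union> sy n ` verts n"
  by (auto simp: verts_def cverts_shift)

lemma verts_bound: "p \<in> verts n \<Longrightarrow> fst p + snd p \<le> 2 ^ n"
  using cells_bound[of _ n] by (fastforce simp: verts_def cverts_def right_def up_def)

lemma verts_mono: "m \<le> n \<Longrightarrow> verts m \<subseteq> verts n"
  using cells_mono unfolding verts_def by blast

lemma corners_subset: "corners n \<subseteq> verts n"
proof (induct n)
  case 0
  then show ?case by (simp add: verts_0 corners_def)
next
  case (Suc n)
  have "(0, 0) \<in> verts (Suc n)" using Suc by (auto simp: verts_Suc corners_def)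
  moreover have "(2 ^ Suc n, 0) = sx n (2 ^ n, 0)" "(0, 2 ^ Suc n) = sy n (0, 2 ^ n)"
    by (auto simp: sx_def sy_def)
  then have "(2 ^ Suc n, 0) \<in> verts (Suc n)" "(0, 2 ^ Suc n) \<in> verts (Suc n)"
    using Suc unfolding verts_Suc corners_def by blast+
  ultimately show ?case unfolding corners_def by blast
qed

lemma corner_in_verts [simp]: "(0, 0) \<in> verts n" "(2 ^ n, 0) \<in> verts n" "(0, 2 ^ n) \<in> verts n"
  using corners_subset[of n] by (auto simp: corners_def)

text \<open>Each copy lies in a triangle of side \<open>2 ^ n\<close>, and two of these translated
  triangles touch in one point. The three points are the midpoints where functions on the copies
  have to agree.\<close>

lemma verts_Int:
  "verts n \<inter> sx n ` verts n = {(2 ^ n, 0)}"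
  "verts n \<inter> sy n ` verts n = {(0, 2 ^ n)}"
  "sx n ` verts n \<inter> sy n ` verts n = {(2 ^ n, 2 ^ n)}"
proof -
  have m: "(2 ^ n, 0) = sx n (0, 0)" "(0, 2 ^ n) = sy n (0, 0)" "(2 ^ n, 2 ^ n) = sx n (0, 2 ^ n)" "(2 ^ n, 2 ^ n) = sy n (2 ^ n, 0)"
    by (auto simp: sx_def sy_def)
  show "verts n \<inter> sx n ` verts n = {(2 ^ n, 0)}"
  proof (rule equalityI)
    show "verts n \<inter> sx n ` verts n \<subseteq> {(2 ^ n, 0)}"
      using verts_bound[of _ n] by (fastforce simp: sx_def)
    show "{(2 ^ n, 0)} \<subseteq> verts n \<inter> sx n ` verts n"
      using corner_in_verts[of n] m by (metis IntI empty_subsetI image_eqI insert_subset)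
  qed
  show "verts n \<inter> sy n ` verts n = {(0, 2 ^ n)}"
  proof (rule equalityI)
    show "verts n \<inter> sy n ` verts n \<subseteq> {(0, 2 ^ n)}"
      using verts_bound[of _ n] by (fastforce simp: sy_def)
    show "{(0, 2 ^ n)} \<subseteq> verts n \<inter> sy n ` verts n"
      using corner_in_verts[of n] m by (metis IntI empty_subsetI image_eqI insert_subset)
  qed
  show "sx n ` verts n \<inter> sy n ` verts n = {(2 ^ n, 2 ^ n)}"
  proof (rule equalityI)
    show "sx n ` verts n \<inter> sy n ` verts n \<subseteq> {(2 ^ n, 2 ^ n)}"
    proof
      fix p assume "p \<in> sx n ` verts n \<inter> sy n ` verts n"
      then obtain a b where ab: "a \<in> verts n" "b \<in> verts n" "p = sx n a" "p = sy n b" by blast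
      show "p \<in> {(2 ^ n, 2 ^ n)}"
        using verts_bound[OF ab(1)] verts_bound[OF ab(2)] ab(3,4) by (auto simp: sx_def sy_def prod_eq_iff)
    qed
    show "{(2 ^ n, 2 ^ n)} \<subseteq> sx n ` verts n \<inter> sy n ` verts n"
      using corner_in_verts m by (metis IntI empty_subsetI image_eqI insert_subset)
  qed
qed

lemma sum_verts_Suc:
  fixes g :: "idx \<Rightarrow> real"
  shows "sum g (verts (Suc n)) = sum g (verts n) + (\<Sum>p\<in>verts n. g (sx n p)) + (\<Sum>p\<in>verts n. g (sy n p))
     - g (2 ^ n, 0) - g (0, 2 ^ n) - g (2 ^ n, 2 ^ n)"
proof -
  let ?A = "verts n" and ?B = "sx n ` verts n" and ?C = "sy n ` verts n"
  have "sum g (?A \<union> ?B) = sum g ?A + sum g ?B - g (2 ^ n, 0)"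
    by (simp add: sum_Un verts_Int)
  moreover have "(?A \<union> ?B) \<inter> ?C = {(0, 2 ^ n), (2 ^ n, 2 ^ n)}"
    unfolding Int_Un_distrib2 verts_Int by auto
  then have "sum g ((?A \<union> ?B) \<union> ?C) = sum g (?A \<union> ?B) + sum g ?C - (g (0, 2 ^ n) + g (2 ^ n, 2 ^ n))"
    by (subst sum_Un) simp_all
  ultimately show ?thesis unfolding verts_Suc
    by (simp add: sum.reindex inj_on_subset[OF sx_inj] inj_on_subset[OF sy_inj] o_def)
qed

lemma sum_corners: "sum g (corners n) = g (0, 0) + g (2 ^ n, 0) + g (0, 2 ^ n)" for g :: "idx \<Rightarrow> real"
  by (simp add: corners_def add.assoc)

text \<open>A vertex lies in two cells, except that a corner lies in one. Applied to constants,
  indicators and squares, this incidence count yields the number of sites, the degrees and the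
  diagonal part of the form.\<close>

lemma sum_csum_cells: "(\<Sum>t\<in>cells n. csum g t) = 2 * sum g (verts n) - sum g (corners n)"
proof (induct n arbitrary: g)
  case 0
  then show ?case by (simp add: verts_0 corners_def csum_def right_def up_def)
next
  case (Suc n)
  show ?case unfolding sum_cells_Suc csum_shift Suc sum_verts_Suc
    unfolding sum_corners by (simp add: sx_def sy_def flip: mult_2)
qed

lemma card_verts: "2 * card (verts n) = 3 ^ Suc n + 3"
proof -
  have "real (2 * card (verts n)) = real (3 ^ Suc n + 3)"
    using sum_csum_cells[of "\<lambda>_. 1" n] unfolding sum_corners by (simp add: csum_def card_cells)
  then show ?thesis unfolding of_nat_eq_iff .
qed

section \<open>The planar lattice: embedding, distance, balls, degrees\<close>

definition adj :: "idx \<Rightarrow> idx \<Rightarrow> bool" where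
  "adj a b \<longleftrightarrow> a \<noteq> b \<and> (\<exists>n. \<exists>t\<in>cells n. a \<in> cverts t \<and> b \<in> cverts t)"

definition em :: "idx \<Rightarrow> pt" where
  "em p = (real (fst p) + real (snd p) / 2, real (snd p) * (sqrt 3 / 2))"

lemma em_inj: "inj em"
  by (rule injI) (auto simp: em_def prod_eq_iff)

lemma em_eq_iff [simp]: "em a = em b \<longleftrightarrow> a = b"
  using em_inj by (simp add: inj_eq)

lemma mirror_mirror [simp]: "mirror (mirror p) = p"
  by (simp add: mirror_def)

lemma mirror_eq_iff [simp]: "mirror p = mirror q \<longleftrightarrow> p = q"
  by (metis mirror_mirror)

text \<open>\<open>em\<close> has nonnegative first coordinates, which vanish only at the origin;
  hence the two halves of the lattice share just that point.\<close>

lemma em_eq_mirror [simp]: "em a = mirror (em b) \<longleftrightarrow> a = (0, 0) \<and> b = (0, 0)"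
proof
  assume "em a = mirror (em b)"
  then have h: "real (fst a) + real (snd a) / 2 = - (real (fst b) + real (snd b) / 2)"
    by (simp add: em_def mirror_def)
  have "real (fst a) = 0 \<and> real (snd a) = 0 \<and> real (fst b) = 0 \<and> real (snd b) = 0"
    using h of_nat_0_le_iff[of "fst a", where 'a=real] of_nat_0_le_iff[of "snd a", where 'a=real]
      of_nat_0_le_iff[of "fst b", where 'a=real] of_nat_0_le_iff[of "snd b", where 'a=real]
    by linarith
  then show "a = (0, 0) \<and> b = (0, 0)" by (simp add: prod_eq_iff)
qed (simp add: em_def mirror_def)

lemma tri_pos_eq: "tri_pos n = em ` cells n"
proof (induct n)
  case 0
  then show ?case by (simp add: em_def)
next
  case (Suc n)
  have "padd (pscale (2 ^ n) sa2) (em p) = em (sx n p)" "padd (pscale (2 ^ n) sa3) (em p) = em (sy n p)" for p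
    by (auto simp: padd_def pscale_def sa2_def sa3_def em_def sx_def sy_def algebra_simps add_divide_distrib)
  then show ?case by (simp add: Suc image_Un image_image)
qed

lemma tri_verts_em: "tri_verts (em t) = em ` cverts t"
proof -
  have "padd (em t) sa1 = em t" "padd (em t) sa2 = em (right t)" "padd (em t) sa3 = em (up t)"
    by (auto simp: padd_def sa1_def sa2_def sa3_def em_def right_def up_def algebra_simps add_divide_distrib)
  then show ?thesis by (simp add: tri_verts_def cverts_def)
qed

lemma Gn_verts_eq: "Gn_verts n = em ` verts n"
  by (auto simp: Gn_verts_def tri_pos_eq tri_verts_em verts_def)

lemma Gn_adj_iff: "Gn_adj n p q \<longleftrightarrow> (\<exists>a b. p = em a \<and> q = em b \<and> a \<noteq> b \<and> (\<exists>t\<in>cells n. a \<in> cverts t \<and> b \<in> cverts t))"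
  unfolding Gn_adj_def tri_pos_eq by (auto simp: tri_verts_em)

lemma sier_adj_iff: "sier_adj p q \<longleftrightarrow> (\<exists>a b. adj a b \<and> (p = em a \<and> q = em b \<or> p = mirror (em a) \<and> q = mirror (em b)))"
proof -
  have "mirror p = em a \<longleftrightarrow> p = mirror (em a)" for p a by (metis mirror_mirror)
  then show ?thesis unfolding sier_adj_def Gn_adj_iff adj_def by auto metis+
qed

lemma sier_V_eq: "sier_V = (\<Union>n. em ` verts n \<union> (\<lambda>p. mirror (em p)) ` verts n)"
  by (simp add: sier_V_def Gn_verts_eq image_image)

lemma adj_sym: "adj a b \<longleftrightarrow> adj b a"
  by (auto simp: adj_def)

lemma sier_adj_sym: "sier_adj p q \<longleftrightarrow> sier_adj q p"
  unfolding sier_adj_iff using adj_sym by blast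

text \<open>This is the graph distance from the origin: an edge raises it by at most one
  (\<open>adj_dst\<close>), and a path of exactly this length exists
  (\<open>path_up\<close>).\<close>

definition dst :: "idx \<Rightarrow> nat" where "dst p = fst p + snd p"

lemma adj_dst: "adj a b \<Longrightarrow> dst b \<le> dst a + 1"
  unfolding adj_def dst_def cverts_def right_def up_def by auto

lemma relpow_map:
  assumes "\<And>u v. (u, v) \<in> R \<Longrightarrow> (h u, h v) \<in> S" and "(u, v) \<in> R ^^ k"
  shows "(h u, h v) \<in> S ^^ k"
  using assms(2) by (induct k arbitrary: v) (auto intro!: relcompI assms(1))

text \<open>A path into the second or third copy runs along a side of the first copy to the common
  corner, in \<open>2 ^ n\<close> steps, and continues as a translated path.\<close>

lemma path_up: "a \<in> verts n \<Longrightarrow> ((0, 0), a) \<in> {(u, v). \<exists>t\<in>cells n. u \<noteq> v \<and> u \<in> cverts t \<and> v \<in> cverts t} ^^ (dst a)"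
proof (induct n arbitrary: a)
  case 0
  from 0 consider "a = (0, 0)" | "a = (1, 0)" | "a = (0, 1)" by (auto simp: verts_0)
  then show ?case
    by cases (auto simp: dst_def cverts_def right_def up_def)
next
  case (Suc n)
  let ?R = "\<lambda>n. {(u, v). \<exists>t\<in>cells n. u \<noteq> v \<and> u \<in> cverts t \<and> v \<in> cverts t}"
  have mono: "?R n \<subseteq> ?R (Suc n)" by auto
  have shx: "(sx n u, sx n v) \<in> ?R (Suc n)" and shy: "(sy n u, sy n v) \<in> ?R (Suc n)" if uv: "(u, v) \<in> ?R n" for u v
  proof -
    obtain t where t: "t \<in> cells n" "u \<noteq> v" "u \<in> cverts t" "v \<in> cverts t" using uv by blast
    have "sx n t \<in> cells (Suc n)" "sy n t \<in> cells (Suc n)" using t(1) by auto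
    moreover have "sx n u \<noteq> sx n v" "sy n u \<noteq> sy n v" using t(2) by (auto simp: sx_def sy_def prod_eq_iff)
    moreover have "sx n u \<in> cverts (sx n t)" "sx n v \<in> cverts (sx n t)" "sy n u \<in> cverts (sy n t)" "sy n v \<in> cverts (sy n t)"
      using t(3,4) by (auto simp: cverts_shift)
    ultimately show "(sx n u, sx n v) \<in> ?R (Suc n)" "(sy n u, sy n v) \<in> ?R (Suc n)" by blast+
  qed
  have pm: "(u, v) \<in> ?R n ^^ k \<Longrightarrow> (u, v) \<in> ?R (Suc n) ^^ k" for u v k
    by (rule relpow_map[where h = "\<lambda>x. x" and R = "?R n"]) (rule subsetD[OF mono])
  have px: "(u, v) \<in> ?R n ^^ k \<Longrightarrow> (sx n u, sx n v) \<in> ?R (Suc n) ^^ k" for u v k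
    by (rule relpow_map[where h = "sx n" and R = "?R n"]) (rule shx)
  have py: "(u, v) \<in> ?R n ^^ k \<Longrightarrow> (sy n u, sy n v) \<in> ?R (Suc n) ^^ k" for u v k
    by (rule relpow_map[where h = "sy n" and R = "?R n"]) (rule shy)
  from Suc.prems consider "a \<in> verts n" | b where "b \<in> verts n" "a = sx n b" | b where "b \<in> verts n" "a = sy n b"
    unfolding verts_Suc by blast
  then show ?case
  proof cases
    case 1
    then show ?thesis using Suc.hyps pm by blast
  next
    case 2
    have "((0, 0), (2 ^ n, 0)) \<in> ?R (Suc n) ^^ (2 ^ n)" using pm Suc.hyps[of "(2 ^ n, 0)"] by (simp add: dst_def)
    moreover have "((2 ^ n, 0), a) \<in> ?R (Suc n) ^^ (dst b)"
      using px Suc.hyps[OF 2(1)] unfolding 2(2) by (fastforce simp: sx_def)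
    ultimately have "((0, 0), a) \<in> ?R (Suc n) ^^ (2 ^ n + dst b)" unfolding relpow_add by blast
    then show ?thesis using 2 by (simp add: dst_def sx_def add_ac)
  next
    case 3
    have "((0, 0), (0, 2 ^ n)) \<in> ?R (Suc n) ^^ (2 ^ n)" using pm Suc.hyps[of "(0, 2 ^ n)"] by (simp add: dst_def)
    moreover have "((0, 2 ^ n), a) \<in> ?R (Suc n) ^^ (dst b)"
      using py Suc.hyps[OF 3(1)] unfolding 3(2) by (fastforce simp: sy_def)
    ultimately have "((0, 0), a) \<in> ?R (Suc n) ^^ (2 ^ n + dst b)" unfolding relpow_add by blast
    then show ?thesis using 3 by (simp add: dst_def sy_def add_ac)
  qed
qed

text \<open>A formula for \<open>dst\<close> in planar coordinates, valid on both halves; it bounds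
  path lengths from below without asking in which half a path runs.\<close>

definition pheight :: "pt \<Rightarrow> real" where "pheight p = \<bar>fst p\<bar> + snd p / sqrt 3"

lemma pheight_em [simp]: "pheight (em a) = real (dst a)" "pheight (mirror (em a)) = real (dst a)"
  by (simp_all add: pheight_def em_def mirror_def dst_def)

lemma origin_em: "origin = em (0, 0)" "origin = mirror (em (0, 0))"
  by (auto simp: origin_def em_def mirror_def)

lemma mirror_origin: "mirror origin = origin"
  by (simp add: origin_def mirror_def)

lemma pheight_path: "(origin, p) \<in> {(u, v). sier_adj u v} ^^ k \<Longrightarrow> pheight p \<le> real k"
proof (induct k arbitrary: p)
  case 0
  then show ?case using pheight_em(1)[of "(0,0)"] by (simp flip: origin_em add: dst_def)
next
  case (Suc k)
  then obtain q where q: "(origin, q) \<in> {(u, v). sier_adj u v} ^^ k" "sier_adj q p" by auto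
  have "pheight p \<le> pheight q + 1"
    using q(2) unfolding sier_adj_iff using adj_dst by fastforce
  with Suc(1)[OF q(1)] show ?case by simp
qed

lemma sier_dist_em:
  assumes a: "a \<in> verts n"
  shows "sier_dist origin (em a) = dst a" "sier_dist origin (mirror (em a)) = dst a"
proof -
  let ?R = "{(u, v). \<exists>t\<in>cells n. u \<noteq> v \<and> u \<in> cverts t \<and> v \<in> cverts t}"
  have R: "(u, v) \<in> ?R \<Longrightarrow> adj u v" for u v unfolding adj_def by blast
  have S: "(em u, em v) \<in> {(u, v). sier_adj u v}" "(mirror (em u), mirror (em v)) \<in> {(u, v). sier_adj u v}"
    if "(u, v) \<in> ?R" for u v
    using R[OF that] unfolding sier_adj_iff by blast+
  have "(em (0,0), em a) \<in> {(u, v). sier_adj u v} ^^ (dst a)"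
    by (rule relpow_map[OF S(1) path_up[OF a]])
  then have 1: "(origin, em a) \<in> {(u, v). sier_adj u v} ^^ (dst a)" by (simp add: origin_em(1))
  have "(mirror (em (0,0)), mirror (em a)) \<in> {(u, v). sier_adj u v} ^^ (dst a)"
    by (rule relpow_map[OF S(2) path_up[OF a]])
  then have 2: "(origin, mirror (em a)) \<in> {(u, v). sier_adj u v} ^^ (dst a)" by (metis origin_em(2))
  show "sier_dist origin (em a) = dst a"
    unfolding sier_dist_def by (rule Least_equality, rule 1) (use pheight_path[of "em a"] in force)
  show "sier_dist origin (mirror (em a)) = dst a"
    unfolding sier_dist_def by (rule Least_equality, rule 2) (use pheight_path[of "mirror (em a)"] in force)
qed

text \<open>Every cell added at level n has \<open>dst\<close> at least \<open>2 ^ n\<close>, so the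
  cells close to the origin are already present at the low level. This removes the existential level
  from \<open>adj\<close>.\<close>

lemma cells_restrict: "t \<in> cells n \<Longrightarrow> dst t < 2 ^ L \<Longrightarrow> t \<in> cells L"
proof (induct n arbitrary: t)
  case 0
  then show ?case using cells_mono[of 0 L] by auto
next
  case (Suc n)
  show ?case
  proof (cases "t \<in> cells n")
    case True
    then show ?thesis using Suc by blast
  next
    case False
    then have "2 ^ n \<le> dst t" using Suc.prems(1) by (auto simp: dst_def sx_def sy_def)
    then have "(2::nat) ^ n < 2 ^ L" using Suc.prems(2) by (rule le_less_trans)
    then have "Suc n \<le> L" by simp
    then show ?thesis using cells_mono Suc.prems(1) by blast
  qed
qed

lemma verts_restrict: "a \<in> verts n \<Longrightarrow> dst a \<le> 2 ^ L \<Longrightarrow> a \<in> verts L"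
proof (induct n arbitrary: a)
  case 0
  then show ?case using verts_mono[of 0 L] by auto
next
  case (Suc n)
  show ?case
  proof (cases "a \<in> verts n")
    case True
    then show ?thesis using Suc by blast
  next
    case False
    then obtain b where b: "b \<in> verts n" "a = sx n b \<or> a = sy n b" using Suc.prems(1) unfolding verts_Suc by blast
    \<comment> \<open>The shifted origin is a corner of the unshifted copy, so it would be an old
      vertex; the exclusion makes the next inequality strict.\<close>
    have "dst b \<noteq> 0"
    proof
      assume "dst b = 0"
      then have "a = (2 ^ n, 0) \<or> a = (0, 2 ^ n)" using b(2) by (auto simp: dst_def sx_def sy_def)
      with False show False by auto
    qed
    then have "2 ^ n < dst a" using b(2) by (auto simp: dst_def sx_def sy_def)
    then have "(2::nat) ^ n < 2 ^ L" using Suc.prems(2) by (rule less_le_trans)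
    then have "Suc n \<le> L" by simp
    then show ?thesis using verts_mono Suc.prems(1) by blast
  qed
qed

text \<open>Radius \<open>2 ^ L\<close> is chosen so that the ball is a complete level-L triangle
  and its mirror image, joined at the origin.\<close>

lemma ballL_eq: "ballL L = em ` verts L \<union> (\<lambda>p. mirror (em p)) ` verts L"
proof (rule equalityI)
  show "ballL L \<subseteq> em ` verts L \<union> (\<lambda>p. mirror (em p)) ` verts L"
    unfolding ballL_def sier_V_eq using sier_dist_em verts_restrict by auto
  show "em ` verts L \<union> (\<lambda>p. mirror (em p)) ` verts L \<subseteq> ballL L"
    unfolding ballL_def sier_V_eq using sier_dist_em verts_bound by (auto simp: dst_def)
qed

lemma finite_ballL [simp]: "finite (ballL L)"
  by (simp add: ballL_eq)

lemma em_Int_mirror: "em ` verts L \<inter> (\<lambda>p. mirror (em p)) ` verts L = {origin}"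
proof (rule equalityI)
  show "em ` verts L \<inter> (\<lambda>p. mirror (em p)) ` verts L \<subseteq> {origin}"
  proof
    fix x assume "x \<in> em ` verts L \<inter> (\<lambda>p. mirror (em p)) ` verts L"
    then obtain a b where "x = em a" "x = mirror (em b)" by blast
    then show "x \<in> {origin}" using em_eq_mirror[of a b] by (simp add: origin_em(1))
  qed
  show "{origin} \<subseteq> em ` verts L \<inter> (\<lambda>p. mirror (em p)) ` verts L"
    using origin_em corner_in_verts(1)[of L] by blast
qed

lemma mirror_em_inj: "inj (\<lambda>p. mirror (em p))"
  by (simp add: inj_def)

lemma sum_ballL:
  fixes g :: "pt \<Rightarrow> real"
  shows "sum g (ballL L) = (\<Sum>a\<in>verts L. g (em a)) + (\<Sum>a\<in>verts L. g (mirror (em a))) - g origin"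
  unfolding ballL_eq
  by (simp add: sum_Un em_Int_mirror sum.reindex inj_on_subset[OF em_inj] inj_on_subset[OF mirror_em_inj] o_def)

lemma card_ballL: "card (ballL L) = 3 ^ Suc L + 2"
proof -
  have "real (card (ballL L)) = 2 * real (card (verts L)) - 1"
    using sum_ballL[of "\<lambda>_. 1" L] by simp
  moreover have "2 * real (card (verts L)) = 3 ^ Suc L + 3"
    using arg_cong[OF card_verts[of L], of real] by simp
  ultimately have "real (card (ballL L)) = real (3 ^ Suc L + 2)" by simp
  then show ?thesis unfolding of_nat_eq_iff .
qed

text \<open>Any two vertices of a cell have its lower left vertex as coordinatewise minimum. Hence
  distinct cells share at most one vertex and every edge belongs to exactly one cell.\<close>

lemma cverts_min: "a \<noteq> b \<Longrightarrow> a \<in> cverts t \<Longrightarrow> b \<in> cverts t \<Longrightarrow> t = (min (fst a) (fst b), min (snd a) (snd b))"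
  unfolding cverts_def right_def up_def by (elim insertE emptyE) simp_all

lemma cverts_unique: "s \<noteq> t \<Longrightarrow> a \<in> cverts s \<Longrightarrow> a \<in> cverts t \<Longrightarrow> b \<in> cverts s \<Longrightarrow> b \<in> cverts t \<Longrightarrow> a = b"
  using cverts_min by metis

lemma cverts_distinct [simp]: "t \<noteq> right t" "t \<noteq> up t" "right t \<noteq> up t" "right t \<noteq> t" "up t \<noteq> t" "up t \<noteq> right t"
  by (auto simp: right_def up_def prod_eq_iff)

lemma card_cverts: "card (cverts t) = 3" and finite_cverts [simp]: "finite (cverts t)"
  by (auto simp: cverts_def)

text \<open>The incidence identity \<open>sum_csum_cells\<close> applied to the indicator of
  \<open>a\<close>.\<close>

lemma card_cells_at:
  assumes "a \<in> verts n" "a \<notin> corners n"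
  shows "card {t \<in> cells n. a \<in> cverts t} = 2"
proof -
  define g where "g p = (if p = a then 1 else 0 :: real)" for p
  have "csum g t = (if a \<in> cverts t then 1 else 0)" for t
    using cverts_distinct[of t] by (auto simp: csum_def g_def cverts_def)
  then have "(\<Sum>t\<in>cells n. csum g t) = real (card {t \<in> cells n. a \<in> cverts t})"
    by (simp add: sum.If_cases Int_def)
  moreover have "sum g (verts n) = 1" "sum g (corners n) = 0" using assms by (simp_all add: g_def)
  ultimately show ?thesis using sum_csum_cells[of g n] by simp
qed

text \<open>The set of cells at \<open>a\<close> stops growing at level \<open>Suc n\<close>: from
  there on \<open>a\<close> is not a corner, so each level sees exactly two of them. At level n
  itself \<open>a\<close> could still be a corner.\<close>

lemma cells_at:
  assumes "a \<in> verts n" "a \<noteq> (0, 0)"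
  obtains s t where "s \<noteq> t" "{t. \<exists>m. t \<in> cells m \<and> a \<in> cverts t} = {s, t}"
proof -
  define A where "A m = {t \<in> cells m. a \<in> cverts t}" for m
  have a: "a \<in> verts m" "a \<notin> corners m" if "m \<ge> Suc n" for m
  proof -
    show "a \<in> verts m" using verts_mono[of n m] that assms(1) by auto
    have "(2::nat) ^ n < 2 ^ m" using that by simp
    then show "a \<notin> corners m" using verts_bound[OF assms(1)] assms(2) by (auto simp: corners_def)
  qed
  have card: "card (A m) = 2" if "m \<ge> Suc n" for m
    unfolding A_def using card_cells_at a[OF that] by blast
  have eq: "A m = A (Suc n)" if "m \<ge> Suc n" for m
    using card[OF that] card[of "Suc n"] cells_mono[OF that]
    by (intro sym[OF card_subset_eq]) (auto simp: A_def)
  have "{t. \<exists>m. t \<in> cells m \<and> a \<in> cverts t} = (\<Union>m. A m)" by (auto simp: A_def)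
  also have "\<dots> = A (Suc n)"
  proof (intro equalityI UN_least)
    fix m
    have "A m \<subseteq> A (max m (Suc n))" using cells_mono[of m "max m (Suc n)"] by (auto simp: A_def)
    then show "A m \<subseteq> A (Suc n)" using eq[of "max m (Suc n)"] by simp
  qed auto
  finally have "{t. \<exists>m. t \<in> cells m \<and> a \<in> cverts t} = A (Suc n)" .
  with card[of "Suc n"] that show ?thesis unfolding card_2_iff by auto
qed

lemma adj_nbrs: "{b. adj a b} = (\<Union>t\<in>{t. \<exists>m. t \<in> cells m \<and> a \<in> cverts t}. cverts t) - {a}"
  unfolding adj_def by blast

lemma card_adj:
  assumes "a \<in> verts n" "a \<noteq> (0, 0)"
  shows "card {b. adj a b} = 4"
proof -
  obtain s t where st: "s \<noteq> t" "{t. \<exists>m. t \<in> cells m \<and> a \<in> cverts t} = {s, t}"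
    using cells_at[OF assms] .
  then have a: "a \<in> cverts s" "a \<in> cverts t" by blast+
  have "cverts s \<inter> cverts t = {a}" using cverts_unique[OF st(1)] a by blast
  then have "card (cverts s \<union> cverts t) = 5"
    using card_Un_Int[of "cverts s" "cverts t"] by (simp add: card_cverts)
  then show ?thesis unfolding adj_nbrs st(2) using a by simp
qed

text \<open>Away from the origin two cells meet in the vertex alone, which leaves 5 - 1 neighbours;
  the origin has two neighbours in each half.\<close>

lemma card_sier_adj:
  assumes "x \<in> sier_V"
  shows "card {z. sier_adj x z} = 4"
proof (cases "x = origin")
  case True
  have "{t. \<exists>m. t \<in> cells m \<and> (0, 0) \<in> cverts t} = {(0, 0)}"
  proof
    have "t = (0,0)" if "(0, 0) \<in> cverts t" for t using that by (auto simp: cverts_def right_def up_def)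
    then show "{t. \<exists>m. t \<in> cells m \<and> (0, 0) \<in> cverts t} \<subseteq> {(0, 0)}" by auto
    show "{(0, 0)} \<subseteq> {t. \<exists>m. t \<in> cells m \<and> (0, 0) \<in> cverts t}"
      by (auto intro!: exI[of _ 0] simp: cverts_def)
  qed
  then have nb: "{b. adj (0, 0) b} = {(1, 0), (0, 1)}"
    unfolding adj_nbrs by (auto simp: cverts_def right_def up_def)
  have "sier_adj x z \<longleftrightarrow> (\<exists>b. adj (0, 0) b \<and> (z = em b \<or> z = mirror (em b)))" for z
    unfolding sier_adj_iff True using origin_em by (metis em_eq_iff mirror_eq_iff)
  then have "{z. sier_adj x z} = em ` {b. adj (0, 0) b} \<union> (\<lambda>p. mirror (em p)) ` {b. adj (0, 0) b}" by auto
  also have "\<dots> = {em (1, 0), em (0, 1), mirror (em (1, 0)), mirror (em (0, 1))}"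
    unfolding nb by auto
  also have "card \<dots> = 4" by (simp add: card_insert_if em_eq_mirror)
  finally show ?thesis .
next
  case False
  obtain n a where a: "a \<in> verts n" "x = em a \<or> x = mirror (em a)"
    using assms unfolding sier_V_eq by blast
  moreover have "a \<noteq> (0, 0)" using a(2) False origin_em by metis
  ultimately have a: "a \<in> verts n" "a \<noteq> (0, 0)" "x = em a \<or> x = mirror (em a)" by blast+
  from a(3) show ?thesis
  proof
    assume x: "x = em a"
    have "sier_adj x z \<longleftrightarrow> (\<exists>b. adj a b \<and> z = em b)" for z
      unfolding sier_adj_iff x using a(2) by (metis em_eq_iff em_eq_mirror)
    then have "{z. sier_adj x z} = em ` {b. adj a b}" by blast
    then show ?thesis using card_adj[OF a(1,2)] by (simp add: card_image inj_on_subset[OF em_inj])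
  next
    assume x: "x = mirror (em a)"
    have "sier_adj x z \<longleftrightarrow> (\<exists>b. adj a b \<and> z = mirror (em b))" for z
      unfolding sier_adj_iff x using a(2) by (metis em_eq_iff em_eq_mirror mirror_eq_iff)
    then have "{z. sier_adj x z} = (\<lambda>p. mirror (em p)) ` {b. adj a b}" by blast
    then show ?thesis using card_adj[OF a(1,2)] by (simp add: card_image inj_on_subset[OF mirror_em_inj])
  qed
qed

section \<open>The quadratic form as an energy over unit triangles\<close>

definition cell_energy :: "(idx \<Rightarrow> real) \<Rightarrow> idx \<Rightarrow> real" where
  "cell_energy f t = (f t - f (right t))\<^sup>2 + (f t - f (up t))\<^sup>2 + (f (right t) - f (up t))\<^sup>2"

definition energy :: "nat \<Rightarrow> (idx \<Rightarrow> real) \<Rightarrow> real" where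
  "energy n f = (\<Sum>t\<in>cells n. cell_energy f t)"

text \<open>Ordered pairs of neighbours are grouped by their unique cell, where 2ab = a^2 + b^2 - (a
  - b)^2 leaves squares and the energy. The corner sum records that corners have two neighbours
  inside the triangle instead of four.\<close>

lemma sum_adj_verts:
  "(\<Sum>a\<in>verts L. \<Sum>b\<in>verts L. if adj a b then f a * f b else 0)
     = 4 * (\<Sum>a\<in>verts L. (f a)\<^sup>2) - 2 * (\<Sum>a\<in>corners L. (f a)\<^sup>2) - energy L f" for f :: "idx \<Rightarrow> real"
proof -
  define A where "A t = {p \<in> cverts t \<times> cverts t. fst p \<noteq> snd p}" for t
  have At: "A t = {(t, right t), (t, up t), (right t, t), (right t, up t), (up t, t), (up t, right t)}" for t
    using cverts_distinct[of t] by (auto simp: A_def cverts_def)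
  have dis: "A s \<inter> A t = {}" if "s \<noteq> t" for s t
    using cverts_unique[OF that] by (auto simp: A_def)
  have finA: "finite (A t)" for t by (simp add: At)
  have "{p \<in> verts L \<times> verts L. adj (fst p) (snd p)} = (\<Union>t\<in>cells L. A t)"
  proof (rule equalityI)
    show "(\<Union>t\<in>cells L. A t) \<subseteq> {p \<in> verts L \<times> verts L. adj (fst p) (snd p)}"
    proof
      fix p assume "p \<in> (\<Union>t\<in>cells L. A t)"
      then obtain t where t: "t \<in> cells L" "p \<in> A t" by blast
      then have "adj (fst p) (snd p)" unfolding A_def adj_def mem_Collect_eq mem_Times_iff by blast
      then show "p \<in> {p \<in> verts L \<times> verts L. adj (fst p) (snd p)}"
        using t by (auto simp: A_def mem_Times_iff verts_def)
    qed
    show "{p \<in> verts L \<times> verts L. adj (fst p) (snd p)} \<subseteq> (\<Union>t\<in>cells L. A t)"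
    proof
      fix p assume p: "p \<in> {p \<in> verts L \<times> verts L. adj (fst p) (snd p)}"
      then obtain m t where t: "t \<in> cells m" "fst p \<noteq> snd p" "fst p \<in> cverts t" "snd p \<in> cverts t"
        by (auto simp: adj_def)
      \<comment> \<open>Of two distinct vertices one is not the lower left vertex of the cell; it
        supplies the strict inequality that \<open>cells_restrict\<close> asks for.\<close>
      have "dst t < dst (fst p) \<or> dst t < dst (snd p)"
        using t(2-4) by (auto simp: cverts_def dst_def right_def up_def)
      then have "dst t < 2 ^ L" using p verts_bound[of "fst p" L] verts_bound[of "snd p" L] by (auto simp: dst_def)
      then have "t \<in> cells L" using cells_restrict t(1) by blast
      then show "p \<in> (\<Union>t\<in>cells L. A t)" using t by (auto simp: A_def mem_Times_iff)
    qed
  qed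
  note eq = this
  have "(\<Sum>a\<in>verts L. \<Sum>b\<in>verts L. if adj a b then f a * f b else 0)
      = (\<Sum>p\<in>verts L \<times> verts L. if adj (fst p) (snd p) then f (fst p) * f (snd p) else 0)"
    by (simp add: sum.cartesian_product case_prod_unfold)
  also have "\<dots> = (\<Sum>p\<in>{p \<in> verts L \<times> verts L. adj (fst p) (snd p)}. f (fst p) * f (snd p))"
    by (subst sum.inter_filter) auto
  also have "\<dots> = (\<Sum>t\<in>cells L. \<Sum>p\<in>A t. f (fst p) * f (snd p))"
    unfolding eq by (rule sum.UNION_disjoint) (simp_all add: dis finA)
  also have "\<dots> = (\<Sum>t\<in>cells L. 2 * csum (\<lambda>p. (f p)\<^sup>2) t - cell_energy f t)"
    by (rule sum.cong) (auto simp: At csum_def cell_energy_def power2_eq_square algebra_simps)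
  also have "\<dots> = 2 * (\<Sum>t\<in>cells L. csum (\<lambda>p. (f p)\<^sup>2) t) - energy L f"
    by (simp add: sum_subtractf sum_distrib_left energy_def)
  finally show ?thesis unfolding sum_csum_cells by simp
qed

text \<open>Every edge lies in one half. No edge is counted twice, since its two distinct ends
  cannot both be the origin.\<close>

lemma sum_sier_adj_ballL:
  "(\<Sum>x\<in>ballL L. \<Sum>y\<in>ballL L. if sier_adj x y then F x y else (0::real))
    = (\<Sum>a\<in>verts L. \<Sum>b\<in>verts L. if adj a b then F (em a) (em b) else 0)
    + (\<Sum>a\<in>verts L. \<Sum>b\<in>verts L. if adj a b then F (mirror (em a)) (mirror (em b)) else 0)"
proof -
  define A where "A = {p \<in> verts L \<times> verts L. adj (fst p) (snd p)}"
  define h1 where "h1 p = (em (fst p), em (snd p))" for p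
  define h2 where "h2 p = (mirror (em (fst p)), mirror (em (snd p)))" for p
  have inj: "inj h1" "inj h2" by (auto simp: inj_def h1_def h2_def)
  have ne: "p \<in> A \<Longrightarrow> fst p \<noteq> snd p" for p by (auto simp: A_def adj_def)
  have dis: "h1 ` A \<inter> h2 ` A = {}"
  proof -
    have "h1 p \<noteq> h2 q" if "p \<in> A" for p q using ne[OF that] by (auto simp: h1_def h2_def)
    then show ?thesis by blast
  qed
  have fin: "finite A" unfolding A_def by simp
  have eq: "{p \<in> ballL L \<times> ballL L. sier_adj (fst p) (snd p)} = h1 ` A \<union> h2 ` A"
  proof (rule equalityI)
    have 1: "em a \<in> ballL L \<longleftrightarrow> a \<in> verts L" for a unfolding ballL_eq using corner_in_verts(1)[of L] by (auto)
    have 2: "mirror (em a) \<in> ballL L \<longleftrightarrow> a \<in> verts L" for a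
    proof -
      have "mirror (em a) = em b \<Longrightarrow> a = (0,0)" for b using em_eq_mirror[of b a] by metis
      then show ?thesis unfolding ballL_eq using corner_in_verts(1)[of L] by auto
    qed
    show "h1 ` A \<union> h2 ` A \<subseteq> {p \<in> ballL L \<times> ballL L. sier_adj (fst p) (snd p)}"
      unfolding A_def h1_def h2_def sier_adj_iff using 1 2 by fastforce
    show "{p \<in> ballL L \<times> ballL L. sier_adj (fst p) (snd p)} \<subseteq> h1 ` A \<union> h2 ` A"
    proof
      fix p assume p: "p \<in> {p \<in> ballL L \<times> ballL L. sier_adj (fst p) (snd p)}"
      then obtain a b where ab: "adj a b" "p = (em a, em b) \<or> p = (mirror (em a), mirror (em b))"
        unfolding mem_Collect_eq sier_adj_iff by (metis prod.collapse)
      have "a \<in> verts L \<and> b \<in> verts L" using p ab(2) 1 2 unfolding mem_Collect_eq mem_Times_iff by (metis fst_conv snd_conv)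
      then have "(a, b) \<in> A" using ab(1) by (simp add: A_def)
      moreover have "p = h1 (a, b) \<or> p = h2 (a, b)" using ab(2) by (simp add: h1_def h2_def)
      ultimately show "p \<in> h1 ` A \<union> h2 ` A" by blast
    qed
  qed
  have "(\<Sum>x\<in>ballL L. \<Sum>y\<in>ballL L. if sier_adj x y then F x y else 0)
     = (\<Sum>p\<in>ballL L \<times> ballL L. if sier_adj (fst p) (snd p) then F (fst p) (snd p) else 0)"
    by (simp add: sum.cartesian_product case_prod_unfold)
  also have "\<dots> = (\<Sum>p\<in>{p \<in> ballL L \<times> ballL L. sier_adj (fst p) (snd p)}. F (fst p) (snd p))"
    by (subst sum.inter_filter) auto
  also have "\<dots> = (\<Sum>p\<in>h1 ` A. F (fst p) (snd p)) + (\<Sum>p\<in>h2 ` A. F (fst p) (snd p))"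
    unfolding eq using fin dis by (subst sum.union_disjoint) auto
  also have "(\<Sum>p\<in>h1 ` A. F (fst p) (snd p)) = (\<Sum>p\<in>A. F (em (fst p)) (em (snd p)))"
    using inj by (subst sum.reindex) (auto simp: h1_def intro: inj_on_subset)
  also have "(\<Sum>p\<in>h2 ` A. F (fst p) (snd p)) = (\<Sum>p\<in>A. F (mirror (em (fst p))) (mirror (em (snd p))))"
    using inj by (subst sum.reindex) (auto simp: h2_def intro: inj_on_subset)
  also have "(\<Sum>p\<in>A. G (fst p) (snd p)) = (\<Sum>a\<in>verts L. \<Sum>b\<in>verts L. if adj a b then G a b else 0)" for G :: "idx \<Rightarrow> idx \<Rightarrow> real"
    unfolding A_def by (subst sum.inter_filter) (auto simp: sum.cartesian_product case_prod_unfold)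
  note this[of "\<lambda>a b. F (em a) (em b)"]
  also have "(\<Sum>p\<in>A. G (fst p) (snd p)) = (\<Sum>a\<in>verts L. \<Sum>b\<in>verts L. if adj a b then G a b else 0)" for G :: "idx \<Rightarrow> idx \<Rightarrow> real"
    unfolding A_def by (subst sum.inter_filter) (auto simp: sum.cartesian_product case_prod_unfold)
  note this[of "\<lambda>a b. F (mirror (em a)) (mirror (em b))"]
  finally show ?thesis .
qed

text \<open>The four far corners keep the lattice degree 4 on the diagonal but have two neighbours
  in the ball; the surplus is the term with factor 2. At the origin the deficits of the two halves
  cancel against its being counted once.\<close>

lemma qform_H_kernel:
  "(\<Sum>x\<in>ballL L. \<Sum>y\<in>ballL L. H_kernel v x y * f x * f y)
    = energy L (\<lambda>a. f (em a)) + energy L (\<lambda>a. f (mirror (em a)))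
      + 2 * ((f (em (2 ^ L, 0)))\<^sup>2 + (f (em (0, 2 ^ L)))\<^sup>2 + (f (mirror (em (2 ^ L, 0))))\<^sup>2 + (f (mirror (em (0, 2 ^ L))))\<^sup>2)
      + (\<Sum>x\<in>ballL L. v x * (f x)\<^sup>2)"
proof -
  have "(\<Sum>y\<in>ballL L. H_kernel v x y * f x * f y)
     = (4 + v x) * (f x)\<^sup>2 - (\<Sum>y\<in>ballL L. if sier_adj x y then f x * f y else 0)" if "x \<in> ballL L" for x
  proof -
    have "x \<in> sier_V" using that by (simp add: ballL_def)
    then have "(\<Sum>y\<in>ballL L. H_kernel v x y * f x * f y)
      = (\<Sum>y\<in>ballL L. (if y = x then (4 + v x) * (f x)\<^sup>2 else 0) - (if sier_adj x y then f x * f y else 0))"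
      by (intro sum.cong) (auto simp: H_kernel_def card_sier_adj power2_eq_square algebra_simps)
    then show ?thesis using that by (simp add: sum_subtractf)
  qed
  then have "(\<Sum>x\<in>ballL L. \<Sum>y\<in>ballL L. H_kernel v x y * f x * f y)
     = (\<Sum>x\<in>ballL L. 4 * (f x)\<^sup>2) + (\<Sum>x\<in>ballL L. v x * (f x)\<^sup>2)
       - (\<Sum>x\<in>ballL L. \<Sum>y\<in>ballL L. if sier_adj x y then f x * f y else 0)"
    by (simp add: sum_subtractf sum.distrib distrib_right)
  also have "(\<Sum>x\<in>ballL L. 4 * (f x)\<^sup>2) = 4 * (\<Sum>a\<in>verts L. (f (em a))\<^sup>2) + 4 * (\<Sum>a\<in>verts L. (f (mirror (em a)))\<^sup>2) - 4 * (f origin)\<^sup>2"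
    unfolding sum_ballL by (simp add: sum_distrib_left)
  also note sum_sier_adj_ballL[where L = L and F = "\<lambda>x y. f x * f y"]
  also note sum_adj_verts[where L = L and f = "\<lambda>a. f (em a)"]
  also note sum_adj_verts[where L = L and f = "\<lambda>a. f (mirror (em a))"]
  finally show ?thesis unfolding sum_corners origin_em(1)[symmetric] by (simp add: mirror_origin)
qed

section \<open>Decoupling of cells\<close>

lemma qform_cong: "(\<And>x. x \<in> B \<Longrightarrow> f x = g x) \<Longrightarrow> qform K B f = qform K B g"
  unfolding qform_def by (intro sum.cong refl) auto

text \<open>Decoupling in abstract form: once a function vanishes on the sites outside the blocks,
  its form is the sum of the block forms. Subdividing a cell and splitting a ball are the two
  instances.\<close>

locale block_form =
  fixes K :: "'v \<Rightarrow> 'v \<Rightarrow> real" and B :: "'v set" and C :: "nat set"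
    and I :: "nat \<Rightarrow> 'a set" and k :: "nat \<Rightarrow> 'a \<Rightarrow> 'a \<Rightarrow> real" and s :: "nat \<Rightarrow> 'a \<Rightarrow> 'v"
  assumes finB: "finite B" and finC: "finite C" and finI: "\<And>c. c \<in> C \<Longrightarrow> finite (I c)"
    and symK: "\<And>x y. x \<in> B \<Longrightarrow> y \<in> B \<Longrightarrow> K x y = K y x"
    and symk: "\<And>c x y. c \<in> C \<Longrightarrow> x \<in> I c \<Longrightarrow> y \<in> I c \<Longrightarrow> k c x y = k c y x"
    and inj: "\<And>c. c \<in> C \<Longrightarrow> inj_on (s c) (I c)"
    and sub: "\<And>c. c \<in> C \<Longrightarrow> s c ` I c \<subseteq> B"
    and dis: "\<And>c d. c \<in> C \<Longrightarrow> d \<in> C \<Longrightarrow> c \<noteq> d \<Longrightarrow> s c ` I c \<inter> s d ` I d = {}"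
    and form: "\<And>f. (\<And>x. x \<in> B \<Longrightarrow> x \<notin> (\<Union>c\<in>C. s c ` I c) \<Longrightarrow> f x = 0) \<Longrightarrow>
        qform K B f = (\<Sum>c\<in>C. qform (k c) (I c) (\<lambda>a. f (s c a)))"
begin

lemma sum_blocks:
  fixes g :: "'v \<Rightarrow> real"
  assumes "\<And>x. x \<in> B \<Longrightarrow> x \<notin> (\<Union>c\<in>C. s c ` I c) \<Longrightarrow> g x = 0"
  shows "sum g B = (\<Sum>c\<in>C. \<Sum>a\<in>I c. g (s c a))"
proof -
  have "sum g B = sum g (\<Union>c\<in>C. s c ` I c)"
    by (rule sum.mono_neutral_right) (use finB sub assms in auto)
  also have "\<dots> = (\<Sum>c\<in>C. sum g (s c ` I c))"
    by (rule sum.UNION_disjoint) (use finC finI dis in auto)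
  also have "\<dots> = (\<Sum>c\<in>C. \<Sum>a\<in>I c. g (s c a))"
    by (rule sum.cong) (auto simp: sum.reindex inj)
  finally show ?thesis .
qed

definition ext :: "nat \<Rightarrow> ('a \<Rightarrow> real) \<Rightarrow> 'v \<Rightarrow> real" where
  "ext c u x = (if x \<in> s c ` I c then u (inv_into (I c) (s c) x) else 0)"

lemma ext_s: "c \<in> C \<Longrightarrow> d \<in> C \<Longrightarrow> a \<in> I c \<Longrightarrow> ext d u (s c a) = (if c = d then u a else 0)"
proof -
  assume h: "c \<in> C" "d \<in> C" "a \<in> I c"
  show ?thesis
  proof (cases "c = d")
    case True
    then show ?thesis using inv_into_f_f[OF inj[OF h(1)] h(3)] h(3) by (simp add: ext_def)
  next
    case False
    then have "s c a \<notin> s d ` I d" using dis[OF h(1,2)] h(3) by blast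
    with False show ?thesis by (simp add: ext_def)
  qed
qed

text \<open>Low families of the blocks, extended by zero, have disjoint supports, so together they
  form a low family on \<open>B\<close>.\<close>

theorem sum_eig_count_le: "(\<Sum>c\<in>C. eig_count E (restr_mat (k c) (I c))) \<le> eig_count E (restr_mat K B)"
proof -
  have "\<exists>J u. finite (J :: nat set) \<and> card J = eig_count E (restr_mat (k c) (I c)) \<and> low_family E (qform (k c) (I c)) (I c) J u"
    if "c \<in> C" for c
    using eig_count_low_family[of "I c" "k c" E, OF finI[OF that] symk[OF that]] by blast
  then obtain J :: "nat \<Rightarrow> nat set" and u where
    J: "\<And>c. c \<in> C \<Longrightarrow> finite (J c)" "\<And>c. c \<in> C \<Longrightarrow> card (J c) = eig_count E (restr_mat (k c) (I c))"
    and u: "\<And>c. c \<in> C \<Longrightarrow> low_family E (qform (k c) (I c)) (I c) (J c) (u c)" by metis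
  define U where "U p = ext (fst p) (u (fst p) (snd p))" for p
  have fin: "finite (SIGMA c:C. J c)" using finC J by simp
  have "low_family E (qform K B) B (SIGMA c:C. J c) U" unfolding low_family_def
  proof (intro allI impI)
    fix e assume e: "\<exists>p\<in>(SIGMA c:C. J c). e p \<noteq> (0::real)"
    define f where "f x = (\<Sum>p\<in>(SIGMA c:C. J c). e p * U p x)" for x
    define w where "w c a = (\<Sum>j\<in>J c. e (c, j) * u c j a)" for c a
    have f_s: "f (s c a) = w c a" if "c \<in> C" "a \<in> I c" for c a
    proof -
      have "f (s c a) = (\<Sum>d\<in>C. \<Sum>j\<in>J d. e (d, j) * U (d, j) (s c a))"
        unfolding f_def using finC J(1) by (simp add: sum.Sigma case_prod_unfold)
      also have "\<dots> = (\<Sum>d\<in>C. if d = c then w c a else 0)"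
        using that by (intro sum.cong refl) (auto simp: U_def ext_s w_def)
      finally show ?thesis using finC that by simp
    qed
    have f0: "f x = 0" if "x \<in> B" "x \<notin> (\<Union>c\<in>C. s c ` I c)" for x
      using that unfolding f_def U_def ext_def by (intro sum.neutral) auto
    have nrm: "(\<Sum>x\<in>B. (f x)\<^sup>2) = (\<Sum>c\<in>C. \<Sum>a\<in>I c. (w c a)\<^sup>2)"
    proof -
      have "(\<Sum>x\<in>B. (f x)\<^sup>2) = (\<Sum>c\<in>C. \<Sum>a\<in>I c. (f (s c a))\<^sup>2)"
        by (rule sum_blocks) (simp add: f0)
      then show ?thesis by (simp add: f_s)
    qed
    have q: "qform K B f = (\<Sum>c\<in>C. qform (k c) (I c) (w c))"
    proof -
      have "qform K B f = (\<Sum>c\<in>C. qform (k c) (I c) (\<lambda>a. f (s c a)))"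
        by (rule form) (rule f0)
      also have "\<dots> = (\<Sum>c\<in>C. qform (k c) (I c) (w c))"
        by (intro sum.cong refl qform_cong) (simp add: f_s)
      finally show ?thesis .
    qed
    have le: "qform (k c) (I c) (w c) \<le> E * (\<Sum>a\<in>I c. (w c a)\<^sup>2)" if c: "c \<in> C" for c
    proof (cases "\<exists>j\<in>J c. e (c, j) \<noteq> 0")
      case True
      have w: "w c = (\<lambda>a. \<Sum>j\<in>J c. e (c, j) * u c j a)" by (simp add: w_def[abs_def])
      show ?thesis using u[OF c, unfolded low_family_def, rule_format, OF True] unfolding w by simp
    next
      case False
      then have "w c a = 0" for a by (simp add: w_def)
      then show ?thesis by (simp add: qform_def)
    qed
    have "\<exists>x\<in>B. f x \<noteq> 0"
    proof -
      obtain c j where cj: "c \<in> C" "j \<in> J c" "e (c, j) \<noteq> 0" using e by auto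
      then have ex: "\<exists>j\<in>J c. e (c, j) \<noteq> 0" by blast
      have "\<exists>a\<in>I c. w c a \<noteq> 0" using u[OF cj(1), unfolded low_family_def, rule_format, OF ex] unfolding w_def by simp
      then show ?thesis using f_s cj(1) sub by (metis image_subset_iff)
    qed
    moreover have "qform K B f \<le> E * (\<Sum>x\<in>B. (f x)\<^sup>2)"
      unfolding q nrm sum_distrib_left[of _ _ C] by (intro sum_mono le)
    ultimately show "(\<exists>x\<in>B. (\<Sum>p\<in>(SIGMA c:C. J c). e p * U p x) \<noteq> 0) \<and>
      qform K B (\<lambda>x. \<Sum>p\<in>(SIGMA c:C. J c). e p * U p x) \<le> E * (\<Sum>x\<in>B. (\<Sum>p\<in>(SIGMA c:C. J c). e p * U p x)\<^sup>2)"
      unfolding f_def by blast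
  qed
  from eig_count_ge[where K = K, OF finB symK fin this] show ?thesis using finC J by simp
qed

text \<open>The high conditions of all blocks, together with the condition f(y) = 0 for each removed
  site y, form a high family; removed sites are thus the only loss.\<close>

theorem eig_count_le_sum: "eig_count E (restr_mat K B)
    \<le> (\<Sum>c\<in>C. eig_count E (restr_mat (k c) (I c))) + card (B - (\<Union>c\<in>C. s c ` I c))"
proof -
  let ?R = "B - (\<Union>c\<in>C. s c ` I c)"
  have "\<exists>J u. finite (J :: nat set) \<and> card J = eig_count E (restr_mat (k c) (I c)) \<and> high_family E (qform (k c) (I c)) (I c) J u"
    if "c \<in> C" for c
    using eig_count_high_family[of "I c" "k c" E, OF finI[OF that] symk[OF that]] by blast
  then obtain J :: "nat \<Rightarrow> nat set" and u where
    J: "\<And>c. c \<in> C \<Longrightarrow> finite (J c)" "\<And>c. c \<in> C \<Longrightarrow> card (J c) = eig_count E (restr_mat (k c) (I c))"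
    and u: "\<And>c. c \<in> C \<Longrightarrow> high_family E (qform (k c) (I c)) (I c) (J c) (u c)" by metis
  define \<phi> where "\<phi> = case_sum (\<lambda>p. ext (fst p) (u (fst p) (snd p))) (\<lambda>y x. if x = y then 1 else 0)"
  have fin: "finite ((SIGMA c:C. J c) <+> ?R)" using finC J finB by simp
  have "high_family E (qform K B) B ((SIGMA c:C. J c) <+> ?R) \<phi>" unfolding high_family_def
  proof (intro allI impI)
    fix f assume nz: "\<exists>x\<in>B. f x \<noteq> (0::real)" and 0: "\<forall>j\<in>(SIGMA c:C. J c) <+> ?R. (\<Sum>x\<in>B. \<phi> j x * f x) = 0"
    have f0: "f y = 0" if "y \<in> B" "y \<notin> (\<Union>c\<in>C. s c ` I c)" for y
    proof -
      have "(\<Sum>x\<in>B. \<phi> (Inr y) x * f x) = 0" using 0 that by blast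
      moreover have "(\<Sum>x\<in>B. \<phi> (Inr y) x * f x) = (\<Sum>x\<in>B. if x = y then f y else 0)"
        by (rule sum.cong) (auto simp: \<phi>_def)
      ultimately show ?thesis using finB that by simp
    qed
    have fc: "(\<Sum>a\<in>I c. u c j a * f (s c a)) = 0" if "c \<in> C" "j \<in> J c" for c j
    proof -
      have "(\<Sum>x\<in>B. \<phi> (Inl (c, j)) x * f x) = (\<Sum>d\<in>C. \<Sum>a\<in>I d. \<phi> (Inl (c, j)) (s d a) * f (s d a))"
        by (rule sum_blocks) (simp add: f0)
      also have "\<dots> = (\<Sum>d\<in>C. if d = c then \<Sum>a\<in>I c. u c j a * f (s c a) else 0)"
        using that by (intro sum.cong refl) (auto simp: \<phi>_def ext_s)
      finally have "(\<Sum>x\<in>B. \<phi> (Inl (c, j)) x * f x) = (\<Sum>a\<in>I c. u c j a * f (s c a))"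
        using that finC by simp
      moreover have "(\<Sum>x\<in>B. \<phi> (Inl (c, j)) x * f x) = 0" using 0 that by blast
      ultimately show ?thesis by simp
    qed
    have nrm: "(\<Sum>x\<in>B. (f x)\<^sup>2) = (\<Sum>c\<in>C. \<Sum>a\<in>I c. (f (s c a))\<^sup>2)"
      by (rule sum_blocks) (simp add: f0)
    have q: "qform K B f = (\<Sum>c\<in>C. qform (k c) (I c) (\<lambda>a. f (s c a)))"
      by (rule form) (rule f0)
    have lt: "E * (\<Sum>a\<in>I c. (f (s c a))\<^sup>2) < qform (k c) (I c) (\<lambda>a. f (s c a))" if "c \<in> C" "\<exists>a\<in>I c. f (s c a) \<noteq> 0" for c
      by (rule u[OF that(1), unfolded high_family_def, rule_format]) (use that fc in auto)
    have le: "E * (\<Sum>a\<in>I c. (f (s c a))\<^sup>2) \<le> qform (k c) (I c) (\<lambda>a. f (s c a))" if "c \<in> C" for c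
      using lt[OF that] by (cases "\<exists>a\<in>I c. f (s c a) \<noteq> 0") (auto simp: qform_def)
    obtain x where "x \<in> B" "f x \<noteq> 0" using nz by blast
    then obtain c a where ca: "c \<in> C" "a \<in> I c" "f (s c a) \<noteq> 0" using f0 by blast
    show "E * (\<Sum>x\<in>B. (f x)\<^sup>2) < qform K B f"
      unfolding q nrm sum_distrib_left[of _ _ C]
      by (rule sum_strict_mono_ex1) (use finC le lt ca in auto)
  qed
  from eig_count_le[where K = K, OF finB symK fin this] show ?thesis
    using finC J finB by (simp add: card_Plus)
qed

end

section \<open>Cells and balls as block decompositions\<close>

definition cell_kernel :: "(idx \<Rightarrow> real) \<Rightarrow> idx \<Rightarrow> idx \<Rightarrow> real" where
  "cell_kernel v x y = (if x = y then 4 + v x else 0) - (if adj x y then 1 else 0)"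

definition cell_count :: "nat \<Rightarrow> real \<Rightarrow> (idx \<Rightarrow> real) \<Rightarrow> nat" where
  "cell_count n E v = eig_count E (restr_mat (cell_kernel v) (inner_verts n))"

lemma cell_kernel_sym: "cell_kernel v x y = cell_kernel v y x"
  by (auto simp: cell_kernel_def adj_sym)

lemma H_kernel_sym: "H_kernel v x y = H_kernel v y x"
  by (auto simp: H_kernel_def sier_adj_sym)

lemma cell_verts_mem: "t \<in> cells n \<Longrightarrow> t \<in> verts n \<and> right t \<in> verts n \<and> up t \<in> verts n"
  unfolding verts_def cverts_def by blast

lemma energy_cong: "(\<And>a. a \<in> verts n \<Longrightarrow> f a = g a) \<Longrightarrow> energy n f = energy n g"
  unfolding energy_def cell_energy_def by (intro sum.cong refl) (simp add: cell_verts_mem)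

lemma energy_nonneg: "0 \<le> energy n f"
  unfolding energy_def cell_energy_def by (intro sum_nonneg) auto

lemma energy_Suc: "energy (Suc n) f = energy n f + energy n (\<lambda>a. f (sx n a)) + energy n (\<lambda>a. f (sy n a))"
  unfolding energy_def sum_cells_Suc cell_energy_def shift_right_up ..

lemma inner_subset: "inner_verts n \<subseteq> verts n"
  by (auto simp: inner_verts_def)

text \<open>Zero corner values allow the sums to run over all of \<open>verts n\<close> and remove
  the boundary term of \<open>sum_adj_verts\<close>; what remains is additive over subcells.\<close>

lemma qform_cell_kernel:
  assumes "\<And>a. a \<in> corners n \<Longrightarrow> f a = 0"
  shows "qform (cell_kernel v) (inner_verts n) f = energy n f + (\<Sum>a\<in>inner_verts n. v a * (f a)\<^sup>2)"
proof -
  have f0: "f a = 0" if "a \<in> verts n - inner_verts n" for a using assms that by (auto simp: inner_verts_def)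
  have ext: "(\<Sum>a\<in>inner_verts n. g a) = (\<Sum>a\<in>verts n. g a)" if "\<And>a. f a = 0 \<Longrightarrow> g a = 0" for g :: "idx \<Rightarrow> real"
    by (rule sum.mono_neutral_left) (use f0 that inner_subset in auto)
  have "qform (cell_kernel v) (inner_verts n) f = (\<Sum>x\<in>inner_verts n. \<Sum>y\<in>inner_verts n. (if y = x then (4 + v x) * (f x)\<^sup>2 else 0) - (if adj x y then f x * f y else 0))"
    unfolding qform_def cell_kernel_def by (intro sum.cong refl) (auto simp: power2_eq_square algebra_simps)
  also have "\<dots> = 4 * (\<Sum>x\<in>inner_verts n. (f x)\<^sup>2) + (\<Sum>x\<in>inner_verts n. v x * (f x)\<^sup>2) - (\<Sum>x\<in>inner_verts n. \<Sum>y\<in>inner_verts n. if adj x y then f x * f y else 0)"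
    by (simp add: sum_subtractf sum.distrib sum_distrib_left distrib_right)
  also have "(\<Sum>x\<in>inner_verts n. \<Sum>y\<in>inner_verts n. if adj x y then f x * f y else 0) = (\<Sum>x\<in>verts n. \<Sum>y\<in>verts n. if adj x y then f x * f y else 0)"
  proof -
    have "(\<Sum>x\<in>inner_verts n. \<Sum>y\<in>inner_verts n. if adj x y then f x * f y else 0) = (\<Sum>x\<in>inner_verts n. \<Sum>y\<in>verts n. if adj x y then f x * f y else 0)"
      by (intro sum.cong refl ext) simp
    also have "\<dots> = (\<Sum>x\<in>verts n. \<Sum>y\<in>verts n. if adj x y then f x * f y else 0)"
      by (rule ext) (auto intro!: sum.neutral)
    finally show ?thesis .
  qed
  also have "\<dots> = 4 * (\<Sum>x\<in>inner_verts n. (f x)\<^sup>2) - energy n f"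
    unfolding sum_adj_verts using assms by (subst ext) auto
  finally show ?thesis by simp
qed

text \<open>Numbers the three copies, so that they fit the index set of \<open>block_form\<close>
  and disjointness arguments need one case pattern.\<close>

definition cell_shift :: "nat \<Rightarrow> nat \<Rightarrow> idx \<Rightarrow> idx" where
  "cell_shift n c = (if c = 0 then (\<lambda>a. a) else if c = 1 then sx n else sy n)"

lemma cell_shift_simps [simp]: "cell_shift n 0 = (\<lambda>a. a)" "cell_shift n (Suc 0) = sx n" "cell_shift n 2 = sy n"
  by (simp_all add: cell_shift_def)

lemma cell_shift_inj: "inj (cell_shift n c)"
  by (auto simp: cell_shift_def)

lemma verts_Suc_shift: "verts (Suc n) = (\<Union>c\<in>{0,1,2}. cell_shift n c ` verts n)"
  unfolding verts_Suc by auto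

lemma energy_Suc_shift: "energy (Suc n) f = (\<Sum>c\<in>{0,1,2}. energy n (\<lambda>a. f (cell_shift n c a)))"
  by (simp add: energy_Suc)

lemma shift_meet:
  assumes "c \<in> {0,1,2}" "d \<in> {0,1,2}" "c \<noteq> d" "p \<in> verts n" "q \<in> verts n" "cell_shift n c p = cell_shift n d q"
  shows "p \<in> corners n"
proof -
  have c1: "p = (2 ^ n, 0)" if "p = sx n q" "p \<in> verts n" "q \<in> verts n" for p q
    using verts_Int(1)[of n] that by blast
  have c2: "p = (0, 2 ^ n)" if "p = sy n q" "p \<in> verts n" "q \<in> verts n" for p q
    using verts_Int(2)[of n] that by blast
  have c3: "sx n p = (2 ^ n, 2 ^ n) \<and> sy n q = (2 ^ n, 2 ^ n)" if "sx n p = sy n q" "p \<in> verts n" "q \<in> verts n" for p q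
  proof -
    have "sx n p \<in> {(2 ^ n, 2 ^ n)}" unfolding verts_Int(3)[of n, symmetric]
      using that by (metis IntI image_eqI)
    then show ?thesis using that by auto
  qed
  from assms(1-3) consider "c = 0" "d = 1" | "c = 0" "d = 2" | "c = 1" "d = 0" | "c = 1" "d = 2" | "c = 2" "d = 0" | "c = 2" "d = 1"
    by auto
  then show ?thesis
  proof cases
    case 1 then show ?thesis using c1[of p q] assms(4-6) by (simp add: corners_def)
  next
    case 2 then show ?thesis using c2[of p q] assms(4-6) by (simp add: corners_def)
  next
    case 3 then have "q = (2 ^ n, 0)" "q = sx n p" using c1[of q p] assms(4-6) by simp_all
    then show ?thesis by (auto simp: corners_def sx_def prod_eq_iff)
  next
    case 4 then have "sx n p = (2 ^ n, 2 ^ n)" using c3[of p q] assms(4-6) by simp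
    then show ?thesis by (auto simp: corners_def sx_def prod_eq_iff)
  next
    case 5 then have "q = (0, 2 ^ n)" "q = sy n p" using c2[of q p] assms(4-6) by simp_all
    then show ?thesis by (auto simp: corners_def sy_def prod_eq_iff)
  next
    case 6 then have "sy n p = (2 ^ n, 2 ^ n)" using c3[of q p] assms(4-6) by simp
    then show ?thesis by (auto simp: corners_def sy_def prod_eq_iff)
  qed
qed

lemma shift_mem_inner:
  assumes "c \<in> {0,1,2}" "d \<in> {0,1,2}" "p \<in> verts n" "cell_shift n c p \<in> cell_shift n d ` inner_verts n"
  shows "c = d \<and> p \<in> inner_verts n"
proof -
  obtain q where q: "q \<in> inner_verts n" "cell_shift n c p = cell_shift n d q" using assms(4) by blast
  then have qv: "q \<in> verts n" "q \<notin> corners n" by (auto simp: inner_verts_def)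
  have "c = d" using shift_meet[OF assms(2,1) _ qv(1) assms(3) q(2)[symmetric]] qv(2) by blast
  moreover then have "p = q" using q(2) cell_shift_inj by (metis injD)
  ultimately show ?thesis using q by simp
qed

lemma corners_Suc_shift: "p \<in> corners (Suc n) \<Longrightarrow> \<exists>c\<in>{0,1,2}. \<exists>q\<in>corners n. p = cell_shift n c q"
proof -
  assume "p \<in> corners (Suc n)"
  then consider "p = cell_shift n 0 (0, 0)" | "p = cell_shift n 1 (2 ^ n, 0)" | "p = cell_shift n 2 (0, 2 ^ n)"
    by (auto simp: corners_def sx_def sy_def)
  moreover have "(0, 0) \<in> corners n" "(2 ^ n, 0) \<in> corners n" "(0, 2 ^ n) \<in> corners n"
    by (auto simp: corners_def)
  ultimately show ?thesis by (metis insertI1 insertI2)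
qed

lemma shift_inner_subset: "c \<in> {0,1,2} \<Longrightarrow> cell_shift n c ` inner_verts n \<subseteq> inner_verts (Suc n)"
proof
  fix x assume c: "c \<in> {0,1,2}" and x: "x \<in> cell_shift n c ` inner_verts n"
  have "x \<in> verts (Suc n)" using c x inner_subset unfolding verts_Suc_shift by blast
  moreover have "x \<notin> corners (Suc n)"
  proof
    assume "x \<in> corners (Suc n)"
    then obtain d q where "d \<in> {0,1,2}" "q \<in> corners n" "x = cell_shift n d q" using corners_Suc_shift by blast
    then show False using shift_mem_inner[of d c q n] c x corners_subset[of n] by (auto simp: inner_verts_def)
  qed
  ultimately show "x \<in> inner_verts (Suc n)" by (simp add: inner_verts_def)
qed

lemma inner_Suc_rest: "inner_verts (Suc n) - (\<Union>c\<in>{0,1,2}. cell_shift n c ` inner_verts n) \<subseteq> {(2 ^ n, 0), (0, 2 ^ n), (2 ^ n, 2 ^ n)}"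
proof
  fix x assume x: "x \<in> inner_verts (Suc n) - (\<Union>c\<in>{0,1,2}. cell_shift n c ` inner_verts n)"
  then have "x \<in> verts (Suc n)" "x \<notin> corners (Suc n)" by (auto simp: inner_verts_def)
  then obtain c p where cp: "c \<in> {0,1,2}" "p \<in> verts n" "x = cell_shift n c p" unfolding verts_Suc_shift by blast
  then have "p \<in> corners n" using x by (auto simp: inner_verts_def)
  then show "x \<in> {(2 ^ n, 0), (0, 2 ^ n), (2 ^ n, 2 ^ n)}"
    using cp \<open>x \<notin> corners (Suc n)\<close> by (auto simp: corners_def sx_def sy_def)
qed

text \<open>Subcells share no edge, so \<open>energy\<close> splits exactly and no interaction is
  left between their interiors; only the midpoints are lost.\<close>

lemma block_form_cell:
  "block_form (cell_kernel v) (inner_verts (Suc n)) {0,1,2} (\<lambda>_. inner_verts n) (\<lambda>c. cell_kernel (\<lambda>a. v (cell_shift n c a))) (cell_shift n)"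
proof
  show "inj_on (cell_shift n c) (inner_verts n)" for c using cell_shift_inj inj_on_subset by blast
  show "c \<in> {0,1,2} \<Longrightarrow> cell_shift n c ` inner_verts n \<subseteq> inner_verts (Suc n)" for c by (rule shift_inner_subset)
  show dis: "cell_shift n c ` inner_verts n \<inter> cell_shift n d ` inner_verts n = {}" if "c \<in> {0,1,2}" "d \<in> {0,1,2}" "c \<noteq> d" for c d
    using shift_mem_inner[OF that(1,2)] that(3) inner_subset[of n] by blast
  fix f :: "idx \<Rightarrow> real"
  assume f: "\<And>x. x \<in> inner_verts (Suc n) \<Longrightarrow> x \<notin> (\<Union>c\<in>{0,1,2}. cell_shift n c ` inner_verts n) \<Longrightarrow> f x = 0"
  \<comment> \<open>\<open>f\<close> is unconstrained outside the big interior; the cut-off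
    \<open>g\<close> vanishes at all corners and midpoints, as \<open>qform_cell_kernel\<close>
    requires at both levels.\<close>
  define g where "g x = (if x \<in> (\<Union>c\<in>{0,1,2}. cell_shift n c ` inner_verts n) then f x else 0)" for x
  have gs: "g (cell_shift n c a) = (if a \<in> inner_verts n then f (cell_shift n c a) else 0)" if "c \<in> {0,1,2}" "a \<in> verts n" for c a
  proof (cases "a \<in> inner_verts n")
    case True
    then have "cell_shift n c a \<in> (\<Union>c\<in>{0,1,2}. cell_shift n c ` inner_verts n)" using that(1) by blast
    with True show ?thesis by (simp add: g_def)
  next
    case False
    then have "cell_shift n c a \<notin> (\<Union>c\<in>{0,1,2}. cell_shift n c ` inner_verts n)"
      using shift_mem_inner[OF that(1) _ that(2)] by blast
    with False show ?thesis by (simp add: g_def)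
  qed
  have sub: "(\<Union>c\<in>{0,1,2}. cell_shift n c ` inner_verts n) \<subseteq> inner_verts (Suc n)" using shift_inner_subset by blast
  have "qform (cell_kernel v) (inner_verts (Suc n)) f = qform (cell_kernel v) (inner_verts (Suc n)) g"
    by (rule qform_cong) (use f in \<open>auto simp: g_def\<close>)
  also have "\<dots> = energy (Suc n) g + (\<Sum>a\<in>inner_verts (Suc n). v a * (g a)\<^sup>2)"
    by (rule qform_cell_kernel) (use sub in \<open>auto simp: g_def inner_verts_def\<close>)
  also have "(\<Sum>a\<in>inner_verts (Suc n). v a * (g a)\<^sup>2) = (\<Sum>a\<in>(\<Union>c\<in>{0,1,2}. cell_shift n c ` inner_verts n). v a * (g a)\<^sup>2)"
    by (rule sum.mono_neutral_right) (use sub in \<open>auto simp: g_def\<close>)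
  also have "\<dots> = (\<Sum>c\<in>{0,1,2}. \<Sum>a\<in>cell_shift n c ` inner_verts n. v a * (g a)\<^sup>2)"
    by (rule sum.UNION_disjoint) (use dis in \<open>simp_all del: disjoint_iff\<close>)
  also have "\<dots> = (\<Sum>c\<in>{0,1,2}. \<Sum>a\<in>inner_verts n. v (cell_shift n c a) * (g (cell_shift n c a))\<^sup>2)"
    by (rule sum.cong[OF refl]) (simp add: sum.reindex[OF inj_on_subset[OF cell_shift_inj subset_UNIV]] o_def)
  also have "energy (Suc n) g + \<dots> = (\<Sum>c\<in>{0,1,2}. energy n (\<lambda>a. g (cell_shift n c a)) + (\<Sum>a\<in>inner_verts n. v (cell_shift n c a) * (g (cell_shift n c a))\<^sup>2))"
    unfolding energy_Suc_shift sum.distrib ..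
  also have "\<dots> = (\<Sum>c\<in>{0,1,2}. qform (cell_kernel (\<lambda>a. v (cell_shift n c a))) (inner_verts n) (\<lambda>a. f (cell_shift n c a)))"
  proof (rule sum.cong[OF refl])
    fix c :: nat assume c: "c \<in> {0,1,2}"
    have "qform (cell_kernel (\<lambda>a. v (cell_shift n c a))) (inner_verts n) (\<lambda>a. f (cell_shift n c a))
        = qform (cell_kernel (\<lambda>a. v (cell_shift n c a))) (inner_verts n) (\<lambda>a. g (cell_shift n c a))"
      by (rule qform_cong) (simp add: gs[OF c] subsetD[OF inner_subset])
    also have "\<dots> = energy n (\<lambda>a. g (cell_shift n c a)) + (\<Sum>a\<in>inner_verts n. v (cell_shift n c a) * (g (cell_shift n c a))\<^sup>2)"
    proof (rule qform_cell_kernel)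
      fix a assume "a \<in> corners n"
      moreover from this have "a \<in> verts n" using corners_subset by blast
      ultimately show "g (cell_shift n c a) = 0" by (simp add: gs[OF c] inner_verts_def)
    qed
    finally show "energy n (\<lambda>a. g (cell_shift n c a)) + (\<Sum>a\<in>inner_verts n. v (cell_shift n c a) * (g (cell_shift n c a))\<^sup>2)
       = qform (cell_kernel (\<lambda>a. v (cell_shift n c a))) (inner_verts n) (\<lambda>a. f (cell_shift n c a))" by simp
  qed
  finally show "qform (cell_kernel v) (inner_verts (Suc n)) f
     = (\<Sum>c\<in>{0,1,2}. qform (cell_kernel (\<lambda>a. v (cell_shift n c a))) (inner_verts n) (\<lambda>a. f (cell_shift n c a)))" .
qed (simp_all add: cell_kernel_sym)

lemma cell_count_Suc_ge:
  "cell_count n E v + cell_count n E (\<lambda>a. v (sx n a)) + cell_count n E (\<lambda>a. v (sy n a)) \<le> cell_count (Suc n) E v"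
  using block_form.sum_eig_count_le[OF block_form_cell[where v = v and n = n], where E = E] by (simp add: cell_count_def)

lemma cell_count_Suc_le:
  "cell_count (Suc n) E v \<le> cell_count n E v + cell_count n E (\<lambda>a. v (sx n a)) + cell_count n E (\<lambda>a. v (sy n a)) + 3"
proof -
  have "card (inner_verts (Suc n) - (\<Union>c\<in>{0,1,2}. cell_shift n c ` inner_verts n)) \<le> card {(2 ^ n, 0), (0, 2 ^ n), (2 ^ n, 2 ^ n) :: idx}"
    by (rule card_mono[OF _ inner_Suc_rest]) simp
  also have "\<dots> \<le> 3" by (simp add: card_insert_if)
  finally show ?thesis
    using block_form.eig_count_le_sum[OF block_form_cell[where v = v and n = n], where E = E] by (simp add: cell_count_def)
qed

definition emb :: "nat \<Rightarrow> idx \<Rightarrow> pt" where "emb c a = (if c = 0 then em a else mirror (em a))"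

lemma emb_simps [simp]: "emb 0 = em" "emb (Suc 0) = (\<lambda>a. mirror (em a))"
  by (auto simp: emb_def)

lemma emb_inj: "inj (emb c)"
  by (auto simp: emb_def inj_def)

lemma emb_meet: "emb c a = emb d b \<Longrightarrow> c \<in> {0,1} \<Longrightarrow> d \<in> {0,1} \<Longrightarrow> c \<noteq> d \<Longrightarrow> a = (0, 0)"
  using em_eq_mirror[of a b] em_eq_mirror[of b a] unfolding emb_def by (metis empty_iff insert_iff)

lemma ballL_emb: "ballL L = (\<Union>c\<in>{0,1}. emb c ` verts L)"
  by (auto simp: ballL_eq)

lemma emb_mem_inner:
  assumes "c \<in> {0,1}" "d \<in> {0,1}" "emb c a \<in> emb d ` inner_verts L"
  shows "c = d \<and> a \<in> inner_verts L"
proof -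
  obtain b where b: "b \<in> inner_verts L" "emb c a = emb d b" using assms(3) by blast
  have "b \<noteq> (0, 0)" using b(1) by (auto simp: inner_verts_def corners_def)
  then have "c = d" using emb_meet[OF b(2)[symmetric] assms(2,1)] by blast
  moreover then have "a = b" using b(2) emb_inj by (metis injD)
  ultimately show ?thesis using b by simp
qed

text \<open>Vanishing at the origin separates the halves, and vanishing at the far corners kills
  their surplus term.\<close>

lemma block_form_ball:
  "block_form (H_kernel v) (ballL L) {0,1} (\<lambda>_. inner_verts L) (\<lambda>c. cell_kernel (\<lambda>a. v (emb c a))) emb"
proof
  show "inj_on (emb c) (inner_verts L)" for c using emb_inj inj_on_subset by blast
  show sub: "c \<in> {0,1} \<Longrightarrow> emb c ` inner_verts L \<subseteq> ballL L" for c unfolding ballL_emb using inner_subset by blast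
  show dis: "emb c ` inner_verts L \<inter> emb d ` inner_verts L = {}" if "c \<in> {0,1}" "d \<in> {0,1}" "c \<noteq> d" for c d
    using emb_mem_inner[OF that(1,2)] that(3) by blast
  fix f :: "pt \<Rightarrow> real"
  assume f: "\<And>x. x \<in> ballL L \<Longrightarrow> x \<notin> (\<Union>c\<in>{0,1}. emb c ` inner_verts L) \<Longrightarrow> f x = 0"
  have fc: "f (emb c a) = 0" if "c \<in> {0,1}" "a \<in> corners L" for c a
  proof (rule f)
    show "emb c a \<in> ballL L" using that corners_subset unfolding ballL_emb by blast
    show "emb c a \<notin> (\<Union>c\<in>{0,1}. emb c ` inner_verts L)"
      using emb_mem_inner[OF that(1), of _ a L] that(2) unfolding inner_verts_def by blast
  qed
  have c0: "f (em (2 ^ L, 0)) = 0" "f (em (0, 2 ^ L)) = 0" "f (mirror (em (2 ^ L, 0))) = 0" "f (mirror (em (0, 2 ^ L))) = 0"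
    using fc[of 0] fc[of 1] by (simp_all add: corners_def)
  have "(\<Sum>x\<in>ballL L. v x * (f x)\<^sup>2) = (\<Sum>x\<in>(\<Union>c\<in>{0,1}. emb c ` inner_verts L). v x * (f x)\<^sup>2)"
  proof (rule sum.mono_neutral_right)
    show "(\<Union>c\<in>{0,1}. emb c ` inner_verts L) \<subseteq> ballL L" using sub by blast
    show "\<forall>x\<in>ballL L - (\<Union>c\<in>{0,1}. emb c ` inner_verts L). v x * (f x)\<^sup>2 = 0"
    proof
      fix x assume "x \<in> ballL L - (\<Union>c\<in>{0,1}. emb c ` inner_verts L)"
      then have "f x = 0" using f[of x] by blast
      then show "v x * (f x)\<^sup>2 = 0" by simp
    qed
  qed simp
  also have "\<dots> = (\<Sum>c\<in>{0,1}. \<Sum>x\<in>emb c ` inner_verts L. v x * (f x)\<^sup>2)"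
    by (rule sum.UNION_disjoint) (use dis in \<open>simp_all del: disjoint_iff\<close>)
  also have "\<dots> = (\<Sum>c\<in>{0,1}. \<Sum>a\<in>inner_verts L. v (emb c a) * (f (emb c a))\<^sup>2)"
    by (rule sum.cong[OF refl]) (simp add: sum.reindex[OF inj_on_subset[OF emb_inj subset_UNIV]] o_def)
  finally have V: "(\<Sum>x\<in>ballL L. v x * (f x)\<^sup>2) = (\<Sum>c\<in>{0,1}. \<Sum>a\<in>inner_verts L. v (emb c a) * (f (emb c a))\<^sup>2)" .
  have "qform (H_kernel v) (ballL L) f = (\<Sum>c\<in>{0,1}. energy L (\<lambda>a. f (emb c a)) + (\<Sum>a\<in>inner_verts L. v (emb c a) * (f (emb c a))\<^sup>2))"
    unfolding qform_def qform_H_kernel V by (simp add: c0)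
  also have "\<dots> = (\<Sum>c\<in>{0,1}. qform (cell_kernel (\<lambda>a. v (emb c a))) (inner_verts L) (\<lambda>a. f (emb c a)))"
    by (intro sum.cong refl, subst qform_cell_kernel) (use fc in auto)
  finally show "qform (H_kernel v) (ballL L) f = (\<Sum>c\<in>{0,1}. qform (cell_kernel (\<lambda>a. v (emb c a))) (inner_verts L) (\<lambda>a. f (emb c a)))" .
qed (simp_all add: cell_kernel_sym H_kernel_sym)

definition ball_count :: "nat \<Rightarrow> real \<Rightarrow> (pt \<Rightarrow> real) \<Rightarrow> nat" where
  "ball_count L E v = eig_count E (restr_mat (H_kernel v) (ballL L))"

lemma ball_count_ge:
  "cell_count L E (\<lambda>a. v (em a)) + cell_count L E (\<lambda>a. v (mirror (em a))) \<le> ball_count L E v"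
  using block_form.sum_eig_count_le[OF block_form_ball[where v = v and L = L], where E = E] by (simp add: cell_count_def ball_count_def)

lemma ball_count_le:
  "ball_count L E v \<le> cell_count L E (\<lambda>a. v (em a)) + cell_count L E (\<lambda>a. v (mirror (em a))) + 6"
proof -
  have "ballL L - (\<Union>c\<in>{0,1}. emb c ` inner_verts L) \<subseteq> em ` corners L \<union> (\<lambda>a. mirror (em a)) ` corners L"
    unfolding ballL_eq inner_verts_def by auto
  then have "card (ballL L - (\<Union>c\<in>{0,1}. emb c ` inner_verts L)) \<le> card (em ` corners L \<union> (\<lambda>a. mirror (em a)) ` corners L)"
    by (rule card_mono[rotated]) simp
  also have "\<dots> \<le> card (em ` corners L) + card ((\<lambda>a. mirror (em a)) ` corners L)" by (rule card_Un_le)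
  also have "\<dots> \<le> card (corners L) + card (corners L)" by (intro add_mono card_image_le) auto
  \<comment> \<open>The origin is counted as a corner of both halves; an upper bound
    suffices.\<close>
  also have "\<dots> \<le> 6" by (simp add: corners_def card_insert_if)
  finally show ?thesis
    using block_form.eig_count_le_sum[OF block_form_ball[where v = v and L = L], where E = E] by (simp add: cell_count_def ball_count_def)
qed

section \<open>Measurability of the eigenvalue count\<close>

definition add_pot :: "('v \<Rightarrow> 'v \<Rightarrow> real) \<Rightarrow> ('v \<Rightarrow> real) \<Rightarrow> 'v \<Rightarrow> 'v \<Rightarrow> real" where
  "add_pot K v x y = K x y + (if x = y then v x else 0)"

lemma qform_add_pot:
  assumes "finite B"
  shows "qform (add_pot K v) B f = qform K B f + (\<Sum>x\<in>B. v x * (f x)\<^sup>2)"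
proof -
  have "qform (add_pot K v) B f = (\<Sum>x\<in>B. \<Sum>y\<in>B. K x y * f x * f y + (if y = x then v x * (f x)\<^sup>2 else 0))"
    unfolding qform_def add_pot_def by (intro sum.cong refl) (auto simp: power2_eq_square algebra_simps)
  then show ?thesis using assms by (simp add: sum.distrib qform_def)
qed

text \<open>Comparison principle: with this inequality of shifted forms, a low family for the larger
  form is a low family for the smaller one.\<close>

lemma eig_count_form_mono:
  assumes B: "finite B" and symK: "\<And>x y. x \<in> B \<Longrightarrow> y \<in> B \<Longrightarrow> K x y = K y x"
    and symK': "\<And>x y. x \<in> B \<Longrightarrow> y \<in> B \<Longrightarrow> K' x y = K' y x"
    and le: "\<And>f. qform K B f - E * (\<Sum>x\<in>B. (f x)\<^sup>2) \<le> qform K' B f - E' * (\<Sum>x\<in>B. (f x)\<^sup>2)"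
  shows "eig_count E' (restr_mat K' B) \<le> eig_count E (restr_mat K B)"
proof -
  obtain J :: "nat set" and u where J: "finite J" "card J = eig_count E' (restr_mat K' B)"
    and u: "low_family E' (qform K' B) B J u"
    using eig_count_low_family[where K = K' and B = B and E = E', OF B symK'] by blast
  have "low_family E (qform K B) B J u" unfolding low_family_def
  proof (intro allI impI)
    fix c assume c: "\<exists>j\<in>J. c j \<noteq> (0::real)"
    from u[unfolded low_family_def, rule_format, OF c] le[of "\<lambda>x. \<Sum>j\<in>J. c j * u j x"]
    show "(\<exists>x\<in>B. (\<Sum>j\<in>J. c j * u j x) \<noteq> 0) \<and>
      qform K B (\<lambda>x. \<Sum>j\<in>J. c j * u j x) \<le> E * (\<Sum>x\<in>B. (\<Sum>j\<in>J. c j * u j x)\<^sup>2)"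
      by linarith
  qed
  from eig_count_ge[where K = K, OF B symK J(1) this] J(2) show ?thesis by simp
qed

context
  fixes K :: "'v \<Rightarrow> 'v \<Rightarrow> real" and B :: "'v set"
  assumes B: "finite B" and symK: "\<And>x y. x \<in> B \<Longrightarrow> y \<in> B \<Longrightarrow> K x y = K y x"
begin

lemma add_pot_sym: "x \<in> B \<Longrightarrow> y \<in> B \<Longrightarrow> add_pot K v x y = add_pot K v y x"
  using symK[of x y] by (simp add: add_pot_def)

lemma eig_count_add_pot_shift:
  assumes "\<And>x. x \<in> B \<Longrightarrow> v x \<le> v' x + t"
  shows "eig_count E (restr_mat (add_pot K v') B) \<le> eig_count (E + t) (restr_mat (add_pot K v) B)"
proof (rule eig_count_form_mono[OF B add_pot_sym add_pot_sym])
  fix f :: "'v \<Rightarrow> real"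
  have "(\<Sum>x\<in>B. v x * (f x)\<^sup>2) \<le> (\<Sum>x\<in>B. (v' x + t) * (f x)\<^sup>2)"
    by (intro sum_mono mult_right_mono assms) auto
  then show "qform (add_pot K v) B f - (E + t) * (\<Sum>x\<in>B. (f x)\<^sup>2) \<le> qform (add_pot K v') B f - E * (\<Sum>x\<in>B. (f x)\<^sup>2)"
    by (simp add: qform_add_pot[OF B] distrib_right sum.distrib sum_distrib_left)
qed

text \<open>Eigenvalues are never treated as measurable functions. The count decreases in the
  potential and is locally constant to the right in the energy, so a superlevel set can be described
  with countably many rational potentials.\<close>

lemma measurable_eig_count:
  assumes v: "\<And>x. x \<in> B \<Longrightarrow> v x \<in> borel_measurable M"
  shows "(\<lambda>\<omega>. real (eig_count E (restr_mat (add_pot K (\<lambda>x. v x \<omega>)) B))) \<in> borel_measurable M"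
proof -
  define c where "c r = eig_count E (restr_mat (add_pot K r) B)" for r
  define R where "R = PiE B (\<lambda>_. \<rat> :: real set)"
  have R: "countable R" unfolding R_def by (rule countable_PiE[OF B]) (rule countable_rat)
  \<comment> \<open>Forwards, a rational potential just below \<open>v'\<close> has at least the
    same count. Backwards, approximation within \<open>1 / real (Suc n)\<close> costs a shift of the
    energy, which is harmless once it is below the spectral gap \<epsilon>.\<close>
  have eq: "k \<le> c v' \<longleftrightarrow> (\<forall>n::nat. \<exists>r\<in>R. k \<le> c r \<and> (\<forall>x\<in>B. \<bar>v' x - r x\<bar> \<le> 1 / real (Suc n)))" for k v'
  proof
    assume k: "k \<le> c v'"
    show "\<forall>n::nat. \<exists>r\<in>R. k \<le> c r \<and> (\<forall>x\<in>B. \<bar>v' x - r x\<bar> \<le> 1 / real (Suc n))"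
    proof
      fix n :: nat
      have "\<exists>q\<in>\<rat>. v' x - 1 / real (Suc n) < q \<and> q < v' x" for x by (rule Rats_dense_in_real) simp
      then obtain q where q: "\<And>x. q x \<in> \<rat>" "\<And>x. v' x - 1 / real (Suc n) < q x" "\<And>x. q x < v' x" by metis
      define r where "r = restrict q B"
      have "r \<in> R" using q(1) by (auto simp: R_def r_def)
      moreover have "c v' \<le> c r" unfolding c_def
        using eig_count_add_pot_shift[of r v' 0 E] q(3) by (simp add: r_def less_imp_le)
      moreover have "\<bar>v' x - r x\<bar> \<le> 1 / real (Suc n)" if "x \<in> B" for x
        using q(2,3)[of x] that by (simp add: r_def)
      ultimately show "\<exists>r\<in>R. k \<le> c r \<and> (\<forall>x\<in>B. \<bar>v' x - r x\<bar> \<le> 1 / real (Suc n))" using k by (intro bexI[of _ r]) auto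
    qed
  next
    assume h: "\<forall>n::nat. \<exists>r\<in>R. k \<le> c r \<and> (\<forall>x\<in>B. \<bar>v' x - r x\<bar> \<le> 1 / real (Suc n))"
    obtain \<epsilon> where \<epsilon>: "\<epsilon> > 0" "eig_count (E + \<epsilon>) (restr_mat (add_pot K v') B) = c v'"
      using eig_count_right_continuous[where K = "add_pot K v'", OF B add_pot_sym] unfolding c_def by blast
    obtain n where n: "1 / real (Suc n) < \<epsilon>" using \<epsilon>(1) nat_approx_posE by metis
    obtain r where r: "k \<le> c r" "\<And>x. x \<in> B \<Longrightarrow> \<bar>v' x - r x\<bar> \<le> 1 / real (Suc n)" using h by blast
    have "c r \<le> eig_count (E + \<epsilon>) (restr_mat (add_pot K v') B)"
      unfolding c_def
    proof (rule eig_count_add_pot_shift)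
      fix x assume "x \<in> B"
      then show "v' x \<le> r x + \<epsilon>" using r(2)[of x] n by linarith
    qed
    then show "k \<le> c v'" using r(1) \<epsilon>(2) by simp
  qed
  have meas: "{\<omega> \<in> space M. k \<le> c (\<lambda>x. v x \<omega>)} \<in> sets M" for k
  proof -
    have 1: "{\<omega> \<in> space M. \<bar>v x \<omega> - r\<bar> \<le> d} \<in> sets M" if "x \<in> B" for x r d
      using v[OF that] by measurable
    have 2: "{\<omega> \<in> space M. \<forall>x\<in>B. \<bar>v x \<omega> - r x\<bar> \<le> d} \<in> sets M" for r d
      by (rule sets.sets_Collect_finite_All[OF _ B]) (use 1 in auto)
    have 3: "{\<omega> \<in> space M. k \<le> c r \<and> (\<forall>x\<in>B. \<bar>v x \<omega> - r x\<bar> \<le> d)} \<in> sets M" for r d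
      using 2[of r d] by (cases "k \<le> c r") auto
    have "{\<omega> \<in> space M. \<exists>r\<in>R. k \<le> c r \<and> (\<forall>x\<in>B. \<bar>v x \<omega> - r x\<bar> \<le> d)} \<in> sets M" for d
      by (rule sets.sets_Collect_countable_Ex'[OF _ R]) (rule 3)
    then have "{\<omega> \<in> space M. \<forall>n::nat. \<exists>r\<in>R. k \<le> c r \<and> (\<forall>x\<in>B. \<bar>v x \<omega> - r x\<bar> \<le> 1 / real (Suc n))} \<in> sets M"
      by (intro sets.sets_Collect_countable_All)
    moreover have "{\<omega> \<in> space M. k \<le> c (\<lambda>x. v x \<omega>)}
        = {\<omega> \<in> space M. \<forall>n::nat. \<exists>r\<in>R. k \<le> c r \<and> (\<forall>x\<in>B. \<bar>v x \<omega> - r x\<bar> \<le> 1 / real (Suc n))}"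
      by (rule Collect_cong) (rule conj_cong[OF refl eq])
    ultimately show ?thesis by simp
  qed
  show ?thesis unfolding borel_measurable_iff_ge c_def[symmetric]
  proof
    fix a :: real
    have e: "a \<le> real m \<longleftrightarrow> nat \<lceil>a\<rceil> \<le> m" for m unfolding nat_le_iff ceiling_le_iff by simp
    show "{\<omega> \<in> space M. a \<le> real (c (\<lambda>x. v x \<omega>))} \<in> sets M" unfolding e by (rule meas)
  qed
qed

end

lemma cell_kernel_add_pot: "cell_kernel v = add_pot (cell_kernel (\<lambda>_. 0)) v"
  by (auto simp: cell_kernel_def add_pot_def fun_eq_iff)

lemma H_kernel_add_pot: "H_kernel v = add_pot (H_kernel (\<lambda>_. 0)) v"
  by (auto simp: H_kernel_def add_pot_def fun_eq_iff)

lemma measurable_cell_count: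
  assumes "\<And>a. a \<in> inner_verts n \<Longrightarrow> v a \<in> borel_measurable M"
  shows "(\<lambda>\<omega>. real (cell_count n E (\<lambda>a. v a \<omega>))) \<in> borel_measurable M"
  unfolding cell_count_def by (subst cell_kernel_add_pot) (intro measurable_eig_count assms finite_inner_verts cell_kernel_sym)

lemma measurable_ball_count:
  assumes "\<And>a. a \<in> ballL n \<Longrightarrow> v a \<in> borel_measurable M"
  shows "(\<lambda>\<omega>. real (ball_count n E (\<lambda>a. v a \<omega>))) \<in> borel_measurable M"
  unfolding ball_count_def by (subst H_kernel_add_pot) (intro measurable_eig_count assms finite_ballL H_kernel_sym)

text \<open>The comparison principle with shift 0 in both directions.\<close>

lemma cell_count_cong: "(\<And>a. a \<in> inner_verts n \<Longrightarrow> v a = w a) \<Longrightarrow> cell_count n E v = cell_count n E w"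
  unfolding cell_count_def cell_kernel_add_pot[of v] cell_kernel_add_pot[of w]
  using eig_count_add_pot_shift[of "inner_verts n" "cell_kernel (\<lambda>_. 0)" v w 0 E]
    eig_count_add_pot_shift[of "inner_verts n" "cell_kernel (\<lambda>_. 0)" w v 0 E]
  by (intro antisym) (simp_all add: cell_kernel_sym)

lemma cell_count_le_card: "cell_count n E v \<le> card (inner_verts n)"
  unfolding cell_count_def by (rule eig_count_le_card) (simp_all add: cell_kernel_sym)

lemma ball_count_le_card: "ball_count n E v \<le> card (ballL n)"
  unfolding ball_count_def by (rule eig_count_le_card) (simp_all add: H_kernel_sym)

lemma ball_count_mono: "E \<le> E' \<Longrightarrow> ball_count n E v \<le> ball_count n E' v"
  unfolding ball_count_def by (rule eig_count_mono) (simp_all add: H_kernel_sym)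

section \<open>Law of large numbers for cell counts\<close>

lemma inner_verts_0: "inner_verts 0 = {}"
  by (auto simp: inner_verts_def verts_0 corners_def)

lemma sier_V_emb: "a \<in> verts n \<Longrightarrow> em a \<in> sier_V" "a \<in> verts n \<Longrightarrow> mirror (em a) \<in> sier_V"
  unfolding sier_V_eq by blast+

locale anderson = prob_space M for M :: "'a measure" +
  fixes V :: "pt \<Rightarrow> 'a \<Rightarrow> real" and P0 :: "real measure"
  assumes indep_V: "indep_vars (\<lambda>_. borel) V sier_V"
    and distr_V: "\<And>x. x \<in> sier_V \<Longrightarrow> distr M borel (V x) = P0"
begin

lemma meas_V: "x \<in> sier_V \<Longrightarrow> V x \<in> borel_measurable M"
  using indep_V unfolding indep_vars_def by blast

lemma indep_reindex:
  assumes "inj_on g I" "g ` I \<subseteq> sier_V"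
  shows "indep_vars (\<lambda>_. borel) (\<lambda>a. V (g a)) I"
proof -
  have "indep_vars (\<lambda>a. PiM {g a} (\<lambda>_. borel)) (\<lambda>a \<omega>. restrict (\<lambda>x. V x \<omega>) {g a}) I"
    by (rule indep_vars_restrict[OF indep_V]) (use assms in \<open>auto simp: disjoint_family_on_def inj_on_def\<close>)
  then have "indep_vars (\<lambda>_. borel) (\<lambda>a \<omega>. (\<lambda>y. y (g a)) (restrict (\<lambda>x. V x \<omega>) {g a})) I"
    by (rule indep_vars_compose2) (auto intro: measurable_component_singleton)
  then show ?thesis by simp
qed

lemma law_reindex:
  assumes "inj_on g I" "g ` I \<subseteq> sier_V" "I \<noteq> {}"
  shows "distr M (PiM I (\<lambda>_. borel)) (\<lambda>\<omega>. \<lambda>a\<in>I. V (g a) \<omega>) = PiM I (\<lambda>_. P0)"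
proof -
  have "distr M (PiM I (\<lambda>_. borel)) (\<lambda>\<omega>. \<lambda>a\<in>I. V (g a) \<omega>) = PiM I (\<lambda>a. distr M borel (V (g a)))"
  proof (rule iffD1[OF indep_vars_iff_distr_eq_PiM' indep_reindex[OF assms(1,2)]])
    show "V (g a) \<in> borel_measurable M" if "a \<in> I" for a
      by (rule meas_V) (use that assms(2) in blast)
  qed fact
  also have "\<dots> = PiM I (\<lambda>_. P0)"
  proof (rule PiM_cong[OF refl])
    show "distr M borel (V (g a)) = P0" if "a \<in> I" for a
      by (rule distr_V) (use that assms(2) in blast)
  qed
  finally show ?thesis .
qed

text \<open>Along any injective map into the lattice, the i.i.d. potential has the same product law;
  this replaces translation invariance, which the lattice does not have.\<close>

lemma expectation_reindex:
  fixes F :: "('i \<Rightarrow> real) \<Rightarrow> real"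
  assumes g: "inj_on g I" "g ` I \<subseteq> sier_V" and h: "inj_on h I" "h ` I \<subseteq> sier_V"
    and F: "F \<in> borel_measurable (PiM I (\<lambda>_. borel))" and cong: "\<And>v w. (\<And>a. a \<in> I \<Longrightarrow> v a = w a) \<Longrightarrow> F v = F w"
  shows "expectation (\<lambda>\<omega>. F (\<lambda>a. V (g a) \<omega>)) = expectation (\<lambda>\<omega>. F (\<lambda>a. V (h a) \<omega>))"
proof (cases "I = {}")
  case True
  then have "F v = F w" for v w using cong by blast
  then show ?thesis by metis
next
  case False
  have "expectation (\<lambda>\<omega>. F (\<lambda>a. V (g a) \<omega>)) = integral\<^sup>L (PiM I (\<lambda>_. P0)) F"
    if g: "inj_on g I" "g ` I \<subseteq> sier_V" for g
  proof -
    have m: "(\<lambda>\<omega>. \<lambda>a\<in>I. V (g a) \<omega>) \<in> measurable M (PiM I (\<lambda>_. borel))"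
    proof (rule measurable_restrict)
      show "V (g a) \<in> borel_measurable M" if "a \<in> I" for a
        by (rule meas_V) (use that g(2) in blast)
    qed
    have "integral\<^sup>L (PiM I (\<lambda>_. P0)) F = expectation (\<lambda>\<omega>. F (\<lambda>a\<in>I. V (g a) \<omega>))"
      unfolding law_reindex[OF g False, symmetric] by (rule integral_distr[OF m F])
    also have "\<dots> = expectation (\<lambda>\<omega>. F (\<lambda>a. V (g a) \<omega>))"
      by (intro Bochner_Integration.integral_cong refl cong) simp
    finally show ?thesis ..
  qed
  then show ?thesis using g h by metis
qed

definition cell_rv :: "nat \<Rightarrow> real \<Rightarrow> (idx \<Rightarrow> pt) \<Rightarrow> 'a \<Rightarrow> real" where
  "cell_rv n E g \<omega> = real (cell_count n E (\<lambda>a. V (g a) \<omega>))"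

definition cell_mean :: "nat \<Rightarrow> real \<Rightarrow> real" where
  "cell_mean n E = expectation (cell_rv n E em)"

definition cell_var :: "nat \<Rightarrow> real \<Rightarrow> real" where
  "cell_var n E = expectation (\<lambda>\<omega>. (cell_rv n E em \<omega> - cell_mean n E)\<^sup>2)"

text \<open>Injectivity is all that the i.i.d. law sees, so means and variances of a cell are the
  same in every position.\<close>

definition placement :: "nat \<Rightarrow> (idx \<Rightarrow> pt) \<Rightarrow> bool" where
  "placement n g \<longleftrightarrow> inj_on g (verts n) \<and> g ` verts n \<subseteq> sier_V"

lemma placement_em: "placement n em" "placement n (\<lambda>a. mirror (em a))"
  using sier_V_emb by (auto simp: placement_def inj_on_def)

lemma placement_shift: "placement (Suc n) g \<Longrightarrow> c \<in> {0,1,2} \<Longrightarrow> placement n (\<lambda>a. g (cell_shift n c a))"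
proof -
  assume g: "placement (Suc n) g" and c: "c \<in> {0,1,2}"
  have "cell_shift n c ` verts n \<subseteq> verts (Suc n)" using c unfolding verts_Suc_shift by blast
  then show ?thesis using g cell_shift_inj[of n c] unfolding placement_def inj_on_def inj_def
    by (auto simp: image_subset_iff simp del: split_paired_All)
qed

lemma placement_inner:
  assumes "placement n g"
  shows "inj_on g (inner_verts n)" "g ` inner_verts n \<subseteq> sier_V"
proof -
  show "inj_on g (inner_verts n)"
    using assms inj_on_subset[OF _ inner_subset] unfolding placement_def by blast
  show "g ` inner_verts n \<subseteq> sier_V"
    using assms image_mono[OF inner_subset, of g n] unfolding placement_def by (blast intro: order_trans)
qed

lemma meas_cell_rv: "placement n g \<Longrightarrow> cell_rv n E g \<in> borel_measurable M"
  unfolding cell_rv_def[abs_def]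
  by (rule measurable_cell_count) (use placement_inner(2) meas_V in blast)

lemma cell_rv_bound: "0 \<le> cell_rv n E g \<omega>" "cell_rv n E g \<omega> \<le> card (inner_verts n)"
  using cell_count_le_card by (simp_all add: cell_rv_def)

lemma integrable_bounded:
  assumes "f \<in> borel_measurable M" "\<And>\<omega>. \<bar>f \<omega>\<bar> \<le> B"
  shows "integrable M (f :: 'a \<Rightarrow> real)"
  by (rule integrable_const_bound[where B = B]) (use assms in auto)

lemma integrable_cell_rv: "placement n g \<Longrightarrow> integrable M (cell_rv n E g)"
proof (rule integrable_bounded[where B = "card (inner_verts n)"])
  show "\<bar>cell_rv n E g \<omega>\<bar> \<le> card (inner_verts n)" for \<omega>
    using cell_rv_bound[of n E g \<omega>] by linarith
qed (rule meas_cell_rv)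

lemma meas_cell_count_PiM: "(\<lambda>v. real (cell_count n E v)) \<in> borel_measurable (PiM (inner_verts n) (\<lambda>_. borel))"
  by (rule measurable_cell_count[where v = "\<lambda>a v. v a"]) (rule measurable_component_singleton)

lemma expectation_cell_rv:
  assumes "placement n g"
  shows "expectation (cell_rv n E g) = cell_mean n E"
  unfolding cell_mean_def cell_rv_def[abs_def]
proof (rule expectation_reindex[where I = "inner_verts n"])
  show "real (cell_count n E v) = real (cell_count n E w)" if "\<And>a. a \<in> inner_verts n \<Longrightarrow> v a = w a" for v w
    using cell_count_cong[OF that] by simp
qed (rule placement_inner[OF assms] placement_inner[OF placement_em(1)] meas_cell_count_PiM)+

lemma variance_cell_rv:
  assumes "placement n g"
  shows "expectation (\<lambda>\<omega>. (cell_rv n E g \<omega> - cell_mean n E)\<^sup>2) = cell_var n E"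
  unfolding cell_var_def cell_rv_def
proof (rule expectation_reindex[where I = "inner_verts n" and F = "\<lambda>v. (real (cell_count n E v) - cell_mean n E)\<^sup>2"])
  show "(real (cell_count n E v) - cell_mean n E)\<^sup>2 = (real (cell_count n E w) - cell_mean n E)\<^sup>2"
    if "\<And>a. a \<in> inner_verts n \<Longrightarrow> v a = w a" for v w
    using cell_count_cong[OF that] by simp
  show "(\<lambda>v. (real (cell_count n E v) - cell_mean n E)\<^sup>2) \<in> borel_measurable (PiM (inner_verts n) (\<lambda>_. borel))"
    by (intro borel_measurable_power borel_measurable_diff meas_cell_count_PiM borel_measurable_const)
qed (rule placement_inner[OF assms] placement_inner[OF placement_em(1)])+

lemma cell_rv_indep:
  assumes g: "placement n g" and h: "placement n h" and dis: "g ` inner_verts n \<inter> h ` inner_verts n = {}"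
  shows "indep_var borel (cell_rv n E g) borel (cell_rv n E h)"
proof -
  let ?A = "g ` inner_verts n" and ?B = "h ` inner_verts n"
  have "indep_var (PiM ?A (\<lambda>_. borel)) (\<lambda>\<omega>. restrict (\<lambda>i. V i \<omega>) ?A) (PiM ?B (\<lambda>_. borel)) (\<lambda>\<omega>. restrict (\<lambda>i. V i \<omega>) ?B)"
    by (rule indep_var_restrict[OF indep_V dis]) (use placement_inner g h in auto)
  note ind = this
  have m: "(\<lambda>x. real (cell_count n E (\<lambda>a. x (g a)))) \<in> borel_measurable (PiM (g ` inner_verts n) (\<lambda>_. borel))" for g :: "idx \<Rightarrow> pt"
    by (rule measurable_cell_count) (auto intro: measurable_component_singleton)
  have "indep_var borel ((\<lambda>x. real (cell_count n E (\<lambda>a. x (g a)))) \<circ> (\<lambda>\<omega>. restrict (\<lambda>i. V i \<omega>) ?A))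
      borel ((\<lambda>x. real (cell_count n E (\<lambda>a. x (h a)))) \<circ> (\<lambda>\<omega>. restrict (\<lambda>i. V i \<omega>) ?B))"
    by (rule indep_var_compose[OF ind m m])
  moreover have "(\<lambda>x. real (cell_count n E (\<lambda>a. x (g a)))) \<circ> (\<lambda>\<omega>. restrict (\<lambda>i. V i \<omega>) (g ` inner_verts n)) = cell_rv n E g" for g :: "idx \<Rightarrow> pt"
    by (auto simp: fun_eq_iff cell_rv_def intro!: cell_count_cong)
  ultimately show ?thesis by simp
qed

lemma cell_rv_Suc:
  "(\<Sum>c\<in>{0,1,2}. cell_rv n E (\<lambda>a. g (cell_shift n c a)) \<omega>) \<le> cell_rv (Suc n) E g \<omega>"
  "cell_rv (Suc n) E g \<omega> \<le> (\<Sum>c\<in>{0,1,2}. cell_rv n E (\<lambda>a. g (cell_shift n c a)) \<omega>) + 3"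
  using cell_count_Suc_ge[of n E "\<lambda>a. V (g a) \<omega>"] cell_count_Suc_le[of n E "\<lambda>a. V (g a) \<omega>"]
  by (simp_all add: cell_rv_def flip: of_nat_add)

lemma cell_mean_Suc: "3 * cell_mean n E \<le> cell_mean (Suc n) E" "cell_mean (Suc n) E \<le> 3 * cell_mean n E + 3"
proof -
  define S where "S \<omega> = (\<Sum>c\<in>{0,1,2}. cell_rv n E (\<lambda>a. em (cell_shift n c a)) \<omega>)" for \<omega>
  have pl: "placement n (\<lambda>a. em (cell_shift n c a))" if "c \<in> {0,1,2}" for c
    using placement_shift[OF placement_em(1) that] .
  have iS: "integrable M S" unfolding S_def using pl by (intro Bochner_Integration.integrable_sum integrable_cell_rv) auto
  have ES: "expectation S = 3 * cell_mean n E"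
    unfolding S_def using pl by (subst Bochner_Integration.integral_sum) (auto simp del: cell_shift_simps simp: expectation_cell_rv integrable_cell_rv)
  have iY: "integrable M (cell_rv (Suc n) E em)" by (rule integrable_cell_rv[OF placement_em(1)])
  have "expectation S \<le> expectation (cell_rv (Suc n) E em)"
    by (rule integral_mono[OF iS iY]) (simp only: S_def cell_rv_Suc)
  moreover have "expectation (cell_rv (Suc n) E em) \<le> expectation (\<lambda>\<omega>. S \<omega> + 3)"
  proof (rule integral_mono[OF iY])
    show "cell_rv (Suc n) E em \<omega> \<le> S \<omega> + 3" for \<omega> unfolding S_def by (rule cell_rv_Suc(2))
  qed (use iS in simp)
  moreover have "expectation (\<lambda>\<omega>. S \<omega> + 3) = expectation S + 3" using iS by (simp add: prob_space)
  ultimately show "3 * cell_mean n E \<le> cell_mean (Suc n) E" "cell_mean (Suc n) E \<le> 3 * cell_mean n E + 3"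
    unfolding ES cell_mean_def[of "Suc n"] by linarith+
qed

text \<open>The centred count is a sum \<open>W\<close> of three independent centred counts, with
  variance 3 times the old one, plus an error bounded by 3. Paying a factor 4/3 on \<open>W\<close>
  for the cross term gives growth 4 per level, safely below the 9 of the squared volume.\<close>

lemma cell_var_Suc: "cell_var (Suc n) E \<le> 4 * cell_var n E + 36"
proof -
  define Z where "Z c \<omega> = cell_rv n E (\<lambda>a. em (cell_shift n c a)) \<omega> - cell_mean n E" for c \<omega>
  define Y where "Y = cell_rv (Suc n) E em"
  define D where "D \<omega> = Y \<omega> - (\<Sum>c\<in>{0,1,2}. cell_rv n E (\<lambda>a. em (cell_shift n c a)) \<omega>)" for \<omega>
  define W where "W \<omega> = Z 0 \<omega> + Z (Suc 0) \<omega> + Z 2 \<omega>" for \<omega>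
  define b where "b = cell_mean (Suc n) E - 3 * cell_mean n E"
  have pl: "placement n (\<lambda>a. em (cell_shift n c a))" if "c \<in> {0,1,2}" for c
    using placement_shift[OF placement_em(1) that] .
  have mZ: "Z c \<in> borel_measurable M" if "c \<in> {0,1,2}" for c
    unfolding Z_def[abs_def] using meas_cell_rv[OF pl[OF that]] by simp
  have iZ: "integrable M (Z c)" if "c \<in> {0,1,2}" for c
    unfolding Z_def[abs_def] using integrable_cell_rv[OF pl[OF that]] by simp
  have EZ: "expectation (Z c) = 0" if "c \<in> {0,1,2}" for c
    unfolding Z_def[abs_def] using integrable_cell_rv[OF pl[OF that]] expectation_cell_rv[OF pl[OF that]] by (simp add: prob_space)
  have bZ: "\<bar>Z c \<omega>\<bar> \<le> card (inner_verts n) + \<bar>cell_mean n E\<bar>" for c \<omega>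
    unfolding Z_def using cell_rv_bound[of n E "\<lambda>a. em (cell_shift n c a)" \<omega>] by linarith
  have iZZ: "integrable M (\<lambda>\<omega>. Z c \<omega> * Z d \<omega>)" if "c \<in> {0,1,2}" "d \<in> {0,1,2}" for c d
  proof (rule integrable_bounded)
    show "(\<lambda>\<omega>. Z c \<omega> * Z d \<omega>) \<in> borel_measurable M" using mZ that by simp
    show "\<bar>Z c \<omega> * Z d \<omega>\<bar> \<le> (card (inner_verts n) + \<bar>cell_mean n E\<bar>) * (card (inner_verts n) + \<bar>cell_mean n E\<bar>)" for \<omega>
      unfolding abs_mult by (intro mult_mono bZ) auto
  qed
  have EZZ: "expectation (\<lambda>\<omega>. Z c \<omega> * Z d \<omega>) = (if c = d then cell_var n E else 0)" if cd: "c \<in> {0,1,2}" "d \<in> {0,1,2}" for c d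
  proof (cases "c = d")
    case True
    then show ?thesis using variance_cell_rv[OF pl[OF cd(1)], of E] by (simp add: Z_def power2_eq_square)
  next
    case False
    have "cell_shift n c ` inner_verts n \<inter> cell_shift n d ` inner_verts n = {}"
      using shift_mem_inner[OF cd] False inner_subset by blast
    then have "(\<lambda>a. em (cell_shift n c a)) ` inner_verts n \<inter> (\<lambda>a. em (cell_shift n d a)) ` inner_verts n = {}"
      using em_eq_iff[THEN iffD1] by blast
    from cell_rv_indep[OF pl[OF cd(1)] pl[OF cd(2)] this]
    have "indep_var borel (cell_rv n E (\<lambda>a. em (cell_shift n c a))) borel (cell_rv n E (\<lambda>a. em (cell_shift n d a)))" .
    from indep_var_compose[OF this, of "\<lambda>x. x - cell_mean n E" borel "\<lambda>x. x - cell_mean n E" borel]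
    have "indep_var borel (Z c) borel (Z d)" by (simp add: Z_def[abs_def] comp_def)
    from indep_var_lebesgue_integral[OF this iZ[OF cd(1)] iZ[OF cd(2)]] show ?thesis
      using False EZ cd by simp
  qed
  have mem: "(0::nat) \<in> {0,1,2}" "Suc 0 \<in> {0,1,2}" "(2::nat) \<in> {0,1,2}" by auto
  have Wsq: "(W \<omega>)\<^sup>2 = Z 0 \<omega> * Z 0 \<omega> + Z (Suc 0) \<omega> * Z (Suc 0) \<omega> + Z 2 \<omega> * Z 2 \<omega> + 2 * (Z 0 \<omega> * Z (Suc 0) \<omega>) + 2 * (Z 0 \<omega> * Z 2 \<omega>) + 2 * (Z (Suc 0) \<omega> * Z 2 \<omega>)" for \<omega>
    by (simp add: W_def power2_eq_square algebra_simps)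
  note iz = iZZ[OF mem(1) mem(1)] iZZ[OF mem(2) mem(2)] iZZ[OF mem(3) mem(3)] iZZ[OF mem(1) mem(2)] iZZ[OF mem(1) mem(3)] iZZ[OF mem(2) mem(3)]
  have iW: "integrable M (\<lambda>\<omega>. (W \<omega>)\<^sup>2)"
    unfolding Wsq using iz by (intro Bochner_Integration.integrable_add integrable_mult_right)
  have EW: "expectation (\<lambda>\<omega>. (W \<omega>)\<^sup>2) = 3 * cell_var n E"
    unfolding Wsq using iz by (simp add: EZZ[OF mem(1) mem(1)] EZZ[OF mem(2) mem(2)] EZZ[OF mem(3) mem(3)]
      EZZ[OF mem(1) mem(2)] EZZ[OF mem(1) mem(3)] EZZ[OF mem(2) mem(3)])
  have mY: "Y \<in> borel_measurable M" unfolding Y_def by (rule meas_cell_rv[OF placement_em(1)])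
  have bY: "\<bar>Y \<omega>\<bar> \<le> card (inner_verts (Suc n))" for \<omega>
    unfolding Y_def using cell_rv_bound[of "Suc n" E em \<omega>] by linarith
  have iY2: "integrable M (\<lambda>\<omega>. (Y \<omega> - cell_mean (Suc n) E)\<^sup>2)"
  proof (rule integrable_bounded)
    show "(\<lambda>\<omega>. (Y \<omega> - cell_mean (Suc n) E)\<^sup>2) \<in> borel_measurable M" using mY by simp
    fix \<omega>
    have "\<bar>Y \<omega> - cell_mean (Suc n) E\<bar> \<le> card (inner_verts (Suc n)) + \<bar>cell_mean (Suc n) E\<bar>" using bY[of \<omega>] by linarith
    then have "\<bar>Y \<omega> - cell_mean (Suc n) E\<bar>\<^sup>2 \<le> (card (inner_verts (Suc n)) + \<bar>cell_mean (Suc n) E\<bar>)\<^sup>2" by (rule power_mono) simp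
    then show "\<bar>(Y \<omega> - cell_mean (Suc n) E)\<^sup>2\<bar> \<le> (card (inner_verts (Suc n)) + \<bar>cell_mean (Suc n) E\<bar>)\<^sup>2" by simp
  qed
  have pt: "(Y \<omega> - cell_mean (Suc n) E)\<^sup>2 \<le> 4 / 3 * (W \<omega>)\<^sup>2 + 36" for \<omega>
  proof -
    have "0 \<le> D \<omega>" "D \<omega> \<le> 3" unfolding D_def Y_def
      using cell_rv_Suc[of n E em \<omega>] by linarith+
    then have d: "\<bar>D \<omega> - b\<bar> \<le> 3" using cell_mean_Suc[of n E] unfolding b_def by linarith
    have "\<bar>D \<omega> - b\<bar>\<^sup>2 \<le> 3\<^sup>2" by (rule power_mono[OF d]) simp
    then have d2: "(D \<omega> - b)\<^sup>2 \<le> 9" by simp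
    have eq: "Y \<omega> - cell_mean (Suc n) E = W \<omega> + (D \<omega> - b)"
      by (simp add: D_def W_def Z_def b_def)
    \<comment> \<open>Expanding this square is exactly (w + d)^2 \<le> 4/3 w^2 + 4 d^2; with d^2
      \<le> 9 it gives the constant 36.\<close>
    have "0 \<le> (W \<omega> - 3 * (D \<omega> - b))\<^sup>2" by simp
    then have "(W \<omega> + (D \<omega> - b))\<^sup>2 \<le> 4 / 3 * (W \<omega>)\<^sup>2 + 4 * (D \<omega> - b)\<^sup>2"
      by (simp add: power2_eq_square algebra_simps)
    then show ?thesis unfolding eq using d2 by linarith
  qed
  have "cell_var (Suc n) E \<le> expectation (\<lambda>\<omega>. 4 / 3 * (W \<omega>)\<^sup>2 + 36)"
    unfolding cell_var_def Y_def[symmetric] by (rule integral_mono[OF iY2]) (use iW pt in auto)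
  also have "\<dots> = 4 * cell_var n E + 36" using iW EW by (simp add: prob_space)
  finally show ?thesis .
qed

lemma cell_var_bound: "cell_var n E \<le> 12 * 4 ^ n"
proof -
  \<comment> \<open>The shift by 12 makes the recursion x -> 4 x + 36 homogeneous.\<close>
  have "cell_var n E + 12 \<le> 4 ^ n * 12"
  proof (induct n)
    case 0
    have z: "cell_rv 0 E em \<omega> = 0" for \<omega> using cell_rv_bound[of 0 E em \<omega>] by (simp add: inner_verts_0)
    have "cell_mean 0 E = 0" unfolding cell_mean_def z[abs_def] by simp
    then show ?case using z by (simp add: cell_var_def)
  next
    case (Suc n)
    then show ?case using cell_var_Suc[of n E] by simp
  qed
  then show ?thesis by simp
qed

text \<open>The normalised means change by at most 3 / \<open>3 ^ Suc n\<close> from one level to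
  the next, hence telescope to a convergent series.\<close>

lemma cell_mean_converges: "convergent (\<lambda>n. cell_mean n E / 3 ^ n)"
proof -
  define d where "d n = cell_mean (Suc n) E / 3 ^ Suc n - cell_mean n E / 3 ^ n" for n
  have "summable (\<lambda>n. (1 / 3 :: real) ^ n)" by (rule summable_geometric) simp
  moreover have "norm (d n) \<le> (1 / 3) ^ n" for n
  proof -
    have "d n = (cell_mean (Suc n) E - 3 * cell_mean n E) / 3 ^ Suc n" by (simp add: d_def diff_divide_distrib)
    then have "norm (d n) = \<bar>cell_mean (Suc n) E - 3 * cell_mean n E\<bar> / 3 ^ Suc n" by simp
    also have "\<dots> \<le> 3 / 3 ^ Suc n"
    proof (rule divide_right_mono)
      show "\<bar>cell_mean (Suc n) E - 3 * cell_mean n E\<bar> \<le> 3" using cell_mean_Suc[of n E] by linarith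
    qed simp
    also have "\<dots> = (1 / 3) ^ n" by (simp add: power_divide)
    finally show ?thesis .
  qed
  ultimately have "summable d" by (rule summable_comparison_test'[where N = 0])
  then have "convergent (\<lambda>n. \<Sum>i<n. d i)" by (simp add: summable_iff_convergent)
  moreover have "(\<Sum>i<n. d i) = cell_mean n E / 3 ^ n - cell_mean 0 E" for n
    unfolding d_def by (subst sum_lessThan_telescope) simp
  ultimately have "convergent (\<lambda>n. cell_mean n E / 3 ^ n - cell_mean 0 E)" by simp
  then show ?thesis using convergent_diff_const_right_iff by blast
qed

text \<open>The threshold \<open>(5 / 2) ^ n\<close> lies between the standard deviation, of order
  \<open>2 ^ n\<close>, and the volume \<open>3 ^ n\<close>: Chebyshev gives the summable
  \<open>(16 / 25) ^ n\<close>, and the normalised deviation is at most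
  \<open>(5 / 6) ^ n\<close>.\<close>

lemma cell_rv_AE:
  assumes g: "\<And>n. placement n g"
  shows "AE \<omega> in M. (\<lambda>n. cell_rv n E g \<omega> / 3 ^ n - cell_mean n E / 3 ^ n) \<longlonglongrightarrow> 0"
proof -
  define A where "A n = {\<omega> \<in> space M. \<bar>cell_rv n E g \<omega> - cell_mean n E\<bar> \<ge> (5 / 2) ^ n}" for n
  have A: "A n \<in> sets M" for n
    unfolding A_def using meas_cell_rv[OF g, of n E] by measurable
  have "measure M (A n) \<le> 12 * (16 / 25) ^ n" for n
  proof -
    have "integrable M (\<lambda>\<omega>. (cell_rv n E g \<omega>)\<^sup>2)"
    proof (rule integrable_bounded)
      show "(\<lambda>\<omega>. (cell_rv n E g \<omega>)\<^sup>2) \<in> borel_measurable M" using meas_cell_rv[OF g, of n E] by simp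
      show "\<bar>(cell_rv n E g \<omega>)\<^sup>2\<bar> \<le> (real (card (inner_verts n)))\<^sup>2" for \<omega>
        using cell_rv_bound[of n E g \<omega>] by (simp add: power_mono)
    qed
    from Chebyshev_inequality[OF meas_cell_rv[OF g, of n E] this, of "(5 / 2) ^ n"]
    have "measure M (A n) \<le> cell_var n E / ((5 / 2) ^ n)\<^sup>2"
      unfolding A_def expectation_cell_rv[OF g] variance_cell_rv[OF g] by simp
    also have "\<dots> \<le> 12 * 4 ^ n / ((5 / 2) ^ n)\<^sup>2"
      by (intro divide_right_mono cell_var_bound) simp
    also have "\<dots> = 12 * (16 / 25) ^ n"
    proof -
      have "((5 / 2 :: real) ^ n)\<^sup>2 = (25 / 4) ^ n" by (simp add: power2_eq_square power_mult_distrib[symmetric])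
      then show ?thesis by (simp add: power_divide[symmetric] flip: times_divide_eq_right)
    qed
    finally show ?thesis .
  qed
  note le = this
  have geo: "summable (\<lambda>n. 12 * (16 / 25 :: real) ^ n)"
    by (intro summable_mult summable_geometric) simp
  have "summable (\<lambda>n. measure M (A n))"
    by (rule summable_comparison_test'[OF geo, where N = 0]) (simp add: le)
  from borel_cantelli_AE1[OF A _ this]
  have "AE \<omega> in M. eventually (\<lambda>n. \<omega> \<in> space M - A n) sequentially" by (simp add: emeasure_eq_measure)
  then show ?thesis
  proof (rule AE_mp, intro AE_I2 impI)
    fix \<omega> assume \<omega>: "\<omega> \<in> space M" and ev: "eventually (\<lambda>n. \<omega> \<in> space M - A n) sequentially"
    have "eventually (\<lambda>n. norm (cell_rv n E g \<omega> / 3 ^ n - cell_mean n E / 3 ^ n) \<le> (5 / 6) ^ n) sequentially"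
      using ev
    proof eventually_elim
      case (elim n)
      then have "\<bar>cell_rv n E g \<omega> - cell_mean n E\<bar> \<le> (5 / 2) ^ n" using \<omega> by (auto simp: A_def)
      then have "\<bar>cell_rv n E g \<omega> - cell_mean n E\<bar> / 3 ^ n \<le> (5 / 2) ^ n / 3 ^ n" by (intro divide_right_mono) auto
      then show ?case by (simp add: power_divide[symmetric] flip: diff_divide_distrib)
    qed
    moreover have "(\<lambda>n. (5 / 6 :: real) ^ n) \<longlonglongrightarrow> 0" by (rule LIMSEQ_power_zero) simp
    ultimately show "(\<lambda>n. cell_rv n E g \<omega> / 3 ^ n - cell_mean n E / 3 ^ n) \<longlonglongrightarrow> 0"
      by (rule Lim_null_comparison)
  qed
qed

text \<open>A ball consists of two level-L cells and has \<open>3 ^ Suc L + 2\<close> sites, whence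
  the factor 2/3.\<close>

definition ids_fixed :: "real \<Rightarrow> real" where
  "ids_fixed E = 2 / 3 * lim (\<lambda>n. cell_mean n E / 3 ^ n)"

definition ball_density :: "nat \<Rightarrow> real \<Rightarrow> 'a \<Rightarrow> real" where
  "ball_density L E \<omega> = real (ball_count L E (\<lambda>x. V x \<omega>)) / real (card (ballL L))"

definition mean_ball_density :: "nat \<Rightarrow> real \<Rightarrow> real" where
  "mean_ball_density L E = expectation (\<lambda>\<omega>. real (ball_count L E (\<lambda>x. V x \<omega>))) / real (card (ballL L))"

lemma ball_scale: "(\<lambda>L. 3 ^ L / real (card (ballL L))) \<longlonglongrightarrow> 1 / 3" "(\<lambda>L. 6 / real (card (ballL L))) \<longlonglongrightarrow> 0"
  unfolding card_ballL by (simp_all, real_asymp+)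

lemma density_limit:
  assumes x: "(\<lambda>n. x n / 3 ^ n) \<longlonglongrightarrow> l" and y: "(\<lambda>n. y n / 3 ^ n) \<longlonglongrightarrow> l"
    and b: "\<And>n. x n + y n \<le> b n" "\<And>n. b n \<le> x n + y n + 6"
  shows "(\<lambda>n. b n / real (card (ballL n))) \<longlonglongrightarrow> 2 / 3 * l"
proof (rule tendsto_sandwich)
  have "(\<lambda>n. (x n / 3 ^ n + y n / 3 ^ n) * (3 ^ n / real (card (ballL n)))) \<longlonglongrightarrow> (l + l) * (1 / 3)"
    by (intro tendsto_mult tendsto_add x y ball_scale)
  note lim0 = this
  have eq: "(x n / 3 ^ n + y n / 3 ^ n) * (3 ^ n / real (card (ballL n))) = (x n + y n) / real (card (ballL n))" for n
    by (simp add: add_divide_distrib[symmetric])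
  show lim: "(\<lambda>n. (x n + y n) / real (card (ballL n))) \<longlonglongrightarrow> 2 / 3 * l"
    using lim0 unfolding eq by simp
  show "(\<lambda>n. (x n + y n) / real (card (ballL n)) + 6 / real (card (ballL n))) \<longlonglongrightarrow> 2 / 3 * l"
    using tendsto_add[OF lim ball_scale(2)] by simp
  show "\<forall>\<^sub>F n in sequentially. (x n + y n) / real (card (ballL n)) \<le> b n / real (card (ballL n))"
    by (intro always_eventually allI divide_right_mono b(1)) simp
  show "\<forall>\<^sub>F n in sequentially. b n / real (card (ballL n)) \<le> (x n + y n) / real (card (ballL n)) + 6 / real (card (ballL n))"
    unfolding add_divide_distrib[symmetric] by (intro always_eventually allI divide_right_mono b(2)) simp
qed

lemma cell_mean_LIMSEQ: "(\<lambda>n. cell_mean n E / 3 ^ n) \<longlonglongrightarrow> lim (\<lambda>n. cell_mean n E / 3 ^ n)"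
  using cell_mean_converges convergent_LIMSEQ_iff by blast

lemma ball_count_bounds:
  "cell_rv L E em \<omega> + cell_rv L E (\<lambda>a. mirror (em a)) \<omega> \<le> real (ball_count L E (\<lambda>x. V x \<omega>))"
  "real (ball_count L E (\<lambda>x. V x \<omega>)) \<le> cell_rv L E em \<omega> + cell_rv L E (\<lambda>a. mirror (em a)) \<omega> + 6"
  using ball_count_ge[of L E "\<lambda>x. V x \<omega>"] ball_count_le[of L E "\<lambda>x. V x \<omega>"]
  by (simp_all add: cell_rv_def flip: of_nat_add)

lemma ballL_subset_sier_V: "ballL L \<subseteq> sier_V"
  by (auto simp: ballL_def)

lemma integrable_ball_count: "integrable M (\<lambda>\<omega>. real (ball_count L E (\<lambda>x. V x \<omega>)))"
proof (rule integrable_bounded[where B = "card (ballL L)"])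
  show "(\<lambda>\<omega>. real (ball_count L E (\<lambda>x. V x \<omega>))) \<in> borel_measurable M"
    by (rule measurable_ball_count) (use meas_V ballL_subset_sier_V in blast)
qed (use ball_count_le_card in simp)

theorem mean_ball_density_LIMSEQ: "(\<lambda>L. mean_ball_density L E) \<longlonglongrightarrow> ids_fixed E"
  unfolding mean_ball_density_def ids_fixed_def
proof (rule density_limit[OF cell_mean_LIMSEQ cell_mean_LIMSEQ])
  fix L
  let ?X = "\<lambda>\<omega>. cell_rv L E em \<omega> + cell_rv L E (\<lambda>a. mirror (em a)) \<omega>"
  have i: "integrable M (cell_rv L E em)" "integrable M (cell_rv L E (\<lambda>a. mirror (em a)))"
    by (rule integrable_cell_rv[OF placement_em(1)], rule integrable_cell_rv[OF placement_em(2)])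
  have EX: "expectation ?X = cell_mean L E + cell_mean L E"
    using i expectation_cell_rv[OF placement_em(1)] expectation_cell_rv[OF placement_em(2)] by simp
  have iX: "integrable M ?X" using i by simp
  show "cell_mean L E + cell_mean L E \<le> expectation (\<lambda>\<omega>. real (ball_count L E (\<lambda>x. V x \<omega>)))"
    unfolding EX[symmetric] by (rule integral_mono[OF iX integrable_ball_count ball_count_bounds(1)])
  have "expectation (\<lambda>\<omega>. real (ball_count L E (\<lambda>x. V x \<omega>))) \<le> expectation (\<lambda>\<omega>. ?X \<omega> + 6)"
    by (rule integral_mono[OF integrable_ball_count _ ball_count_bounds(2)]) (use iX in simp)
  also have "\<dots> = cell_mean L E + cell_mean L E + 6"
    using iX EX by (subst Bochner_Integration.integral_add) (simp_all add: prob_space)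
  finally show "expectation (\<lambda>\<omega>. real (ball_count L E (\<lambda>x. V x \<omega>))) \<le> cell_mean L E + cell_mean L E + 6" .
qed

theorem ball_density_AE: "AE \<omega> in M. (\<lambda>L. ball_density L E \<omega>) \<longlonglongrightarrow> ids_fixed E"
  using cell_rv_AE[OF placement_em(1), of E] cell_rv_AE[OF placement_em(2), of E]
proof (rule AE_mp[OF AE_conjI], intro AE_I2 impI, elim conjE)
  fix \<omega>
  assume 1: "(\<lambda>n. cell_rv n E em \<omega> / 3 ^ n - cell_mean n E / 3 ^ n) \<longlonglongrightarrow> 0"
    and 2: "(\<lambda>n. cell_rv n E (\<lambda>a. mirror (em a)) \<omega> / 3 ^ n - cell_mean n E / 3 ^ n) \<longlonglongrightarrow> 0"
  show "(\<lambda>L. ball_density L E \<omega>) \<longlonglongrightarrow> ids_fixed E"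
    unfolding ball_density_def ids_fixed_def
    using tendsto_add[OF 1 cell_mean_LIMSEQ[of E]] tendsto_add[OF 2 cell_mean_LIMSEQ[of E]]
    by (intro density_limit[OF _ _ ball_count_bounds]) simp_all
qed

lemma ball_density_mono: "E \<le> E' \<Longrightarrow> ball_density L E \<omega> \<le> ball_density L E' \<omega>"
  unfolding ball_density_def by (intro divide_right_mono) (simp_all add: ball_count_mono)

lemma mean_ball_density_mono: "E \<le> E' \<Longrightarrow> mean_ball_density L E \<le> mean_ball_density L E'"
  unfolding mean_ball_density_def
  by (intro divide_right_mono integral_mono integrable_ball_count) (simp_all add: ball_count_mono)

lemma ids_fixed_mono: "E \<le> E' \<Longrightarrow> ids_fixed E \<le> ids_fixed E'"
  by (rule LIMSEQ_le[OF mean_ball_density_LIMSEQ mean_ball_density_LIMSEQ]) (simp add: mean_ball_density_mono)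

lemma ids_fixed_nonneg: "0 \<le> ids_fixed E"
  by (rule LIMSEQ_le_const[OF mean_ball_density_LIMSEQ]) (simp add: mean_ball_density_def)

end

section \<open>Right-continuous regularisation of a monotone limit\<close>

definition right_limit :: "(real \<Rightarrow> real) \<Rightarrow> real \<Rightarrow> real" where
  "right_limit n E = Inf (n ` {E<..})"

context
  fixes n :: "real \<Rightarrow> real"
  assumes mono_n: "\<And>x y. x \<le> y \<Longrightarrow> n x \<le> n y" and nonneg_n: "\<And>x. 0 \<le> n x"
begin

lemma right_limit_le: "E < E' \<Longrightarrow> right_limit n E \<le> n E'"
  unfolding right_limit_def by (rule cInf_lower) (auto intro!: bdd_belowI[of _ 0] nonneg_n)

lemma right_limit_ge: "n E \<le> right_limit n E"
  unfolding right_limit_def by (rule cInf_greatest) (auto intro: mono_n)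

lemma right_limit_less: "right_limit n E < y \<Longrightarrow> \<exists>E'>E. n E' < y"
proof (rule ccontr)
  assume lt: "right_limit n E < y" and ne: "\<not> (\<exists>E'>E. n E' < y)"
  have "y \<le> right_limit n E" unfolding right_limit_def
  proof (rule cInf_greatest)
    fix z assume "z \<in> n ` {E<..}"
    then show "y \<le> z" using ne by (auto simp del: not_ex simp: not_less[symmetric])
  qed simp
  with lt show False by simp
qed

lemma mono_right_limit: "mono (right_limit n)"
proof (rule monoI)
  fix x y :: real assume "x \<le> y"
  then show "right_limit n x \<le> right_limit n y"
    unfolding right_limit_def by (intro cInf_superset_mono) (auto intro!: bdd_belowI[of _ 0] nonneg_n)
qed

lemma right_limit_continuous: "continuous (at_right E) (right_limit n)"
  unfolding continuous_within
proof (rule order_tendstoI)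
  fix a assume "a < right_limit n E"
  then show "\<forall>\<^sub>F x in at_right E. a < right_limit n x"
    unfolding eventually_at_right_field using monoD[OF mono_right_limit, of E]
    by (intro exI[of _ "E + 1"]) (auto intro: less_le_trans)
next
  fix a assume "right_limit n E < a"
  then obtain E' where "E' > E" "n E' < a" using right_limit_less by blast
  then show "\<forall>\<^sub>F x in at_right E. right_limit n x < a"
    unfolding eventually_at_right_field using right_limit_le by (intro exI[of _ E']) (auto intro: le_less_trans)
qed

text \<open>Monotonicity squeezes the value at E between rational energies on both sides. The upper
  side follows from the definition of \<open>right_limit\<close> as an infimum; continuity supplies
  the lower side.\<close>

lemma tendsto_right_limit:
  assumes mono_a: "\<And>L x y. x \<le> y \<Longrightarrow> a L x \<le> a L y" and lim: "\<And>q. q \<in> \<rat> \<Longrightarrow> (\<lambda>L. a L q) \<longlonglongrightarrow> n q"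
    and cont: "isCont (right_limit n) E"
  shows "(\<lambda>L. a L E) \<longlonglongrightarrow> right_limit n E"
proof (rule order_tendstoI)
  fix y assume "y < right_limit n E"
  then have "\<forall>\<^sub>F x in at E. y < right_limit n x" using cont unfolding isCont_def by (rule order_tendstoD(1)[rotated])
  then have "\<forall>\<^sub>F x in at_left E. y < right_limit n x" by (simp add: eventually_at_split)
  then obtain b where b: "b < E" "\<And>x. b < x \<Longrightarrow> x < E \<Longrightarrow> y < right_limit n x"
    unfolding eventually_at_left_field by blast
  obtain x where x: "b < x" "x < E" using dense[OF b(1)] by blast
  obtain q where q: "q \<in> \<rat>" "x < q" "q < E" using Rats_dense_in_real[OF x(2)] by blast
  have "y < n q" using b(2)[OF x] right_limit_le[OF q(2)] by linarith
  then have "\<forall>\<^sub>F L in sequentially. y < a L q" using lim[OF q(1)] by (rule order_tendstoD(1)[rotated])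
  then show "\<forall>\<^sub>F L in sequentially. y < a L E"
    by eventually_elim (use mono_a[of q E] q(3) in \<open>meson less_imp_le less_le_trans\<close>)
next
  fix y assume "right_limit n E < y"
  then obtain E' where E': "E' > E" "n E' < y" using right_limit_less by blast
  obtain q where q: "q \<in> \<rat>" "E < q" "q < E'" using Rats_dense_in_real[OF E'(1)] by blast
  have "n q < y" using mono_n[of q E'] q(3) E'(2) by simp
  then have "\<forall>\<^sub>F L in sequentially. a L q < y" using lim[OF q(1)] by (rule order_tendstoD(2)[rotated])
  then show "\<forall>\<^sub>F L in sequentially. a L E < y"
    by eventually_elim (use mono_a[of E q] q(2) in \<open>meson less_imp_le le_less_trans\<close>)
qed

end

context anderson
begin

text \<open>Limits at fixed energies are monotone but right-continuity is not known for them; the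
  right limit enforces it and agrees with the limit of the counts at continuity points.\<close>

definition ids :: "real \<Rightarrow> real" where "ids = right_limit ids_fixed"

text \<open>Countably many rational energies give one null set, outside of which the squeeze works
  for all continuity points at once.\<close>

theorem ids_limit:
  "AE \<omega> in M. \<forall>E. isCont ids E \<longrightarrow>
     ((\<lambda>L. mean_ball_density L E) \<longlonglongrightarrow> ids E) \<and> ((\<lambda>L. ball_density L E \<omega>) \<longlonglongrightarrow> ids E)"
proof -
  have "AE \<omega> in M. \<forall>q\<in>\<rat>. (\<lambda>L. ball_density L q \<omega>) \<longlonglongrightarrow> ids_fixed q"
    by (subst AE_ball_countable[OF countable_rat]) (use ball_density_AE in blast)
  then show ?thesis
  proof (rule AE_mp, intro AE_I2 impI allI conjI)
    fix \<omega> E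
    assume q: "\<forall>q\<in>\<rat>. (\<lambda>L. ball_density L q \<omega>) \<longlonglongrightarrow> ids_fixed q" and c: "isCont ids E"
    show "(\<lambda>L. mean_ball_density L E) \<longlonglongrightarrow> ids E" unfolding ids_def
      by (rule tendsto_right_limit[OF ids_fixed_mono ids_fixed_nonneg mean_ball_density_mono mean_ball_density_LIMSEQ])
        (use c in \<open>simp_all add: ids_def\<close>)
    show "(\<lambda>L. ball_density L E \<omega>) \<longlonglongrightarrow> ids E" unfolding ids_def
      by (rule tendsto_right_limit[OF ids_fixed_mono ids_fixed_nonneg ball_density_mono])
        (use c q in \<open>simp_all add: ids_def\<close>)
  qed
qed

lemma mono_ids: "mono ids"
  unfolding ids_def by (rule mono_right_limit[OF ids_fixed_mono ids_fixed_nonneg])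

lemma continuous_ids: "continuous (at_right E) ids"
  unfolding ids_def by (rule right_limit_continuous[OF ids_fixed_mono ids_fixed_nonneg])

lemma ids_le: "E < E' \<Longrightarrow> ids E \<le> ids_fixed E'"
  unfolding ids_def by (rule right_limit_le[OF ids_fixed_mono ids_fixed_nonneg])

lemma ids_ge: "ids_fixed E \<le> ids E"
  unfolding ids_def by (rule right_limit_ge[OF ids_fixed_mono ids_fixed_nonneg])

end

section \<open>Energy estimates on cells\<close>

text \<open>The sum over vertices with weight 1/2 at the corners (\<open>wsum_eq\<close>). Unlike
  the plain sum it is exactly additive under subdivision, since a midpoint receives one half from
  each side.\<close>

definition wsum :: "nat \<Rightarrow> (idx \<Rightarrow> real) \<Rightarrow> real" where
  "wsum n g = (\<Sum>t\<in>cells n. csum g t) / 2"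

lemma wsum_Suc: "wsum (Suc n) g = wsum n g + wsum n (\<lambda>a. g (sx n a)) + wsum n (\<lambda>a. g (sy n a))"
  unfolding wsum_def sum_cells_Suc csum_shift by (simp add: add_divide_distrib)

lemma wsum_eq: "wsum n g = sum g (verts n) - sum g (corners n) / 2"
  unfolding wsum_def sum_csum_cells by (simp add: diff_divide_distrib)

lemma wsum_cong: "(\<And>a. a \<in> verts n \<Longrightarrow> f a = g a) \<Longrightarrow> wsum n f = wsum n g"
  unfolding wsum_def csum_def using cell_verts_mem by (intro arg_cong[where f = "\<lambda>x. x / 2"] sum.cong) simp_all

lemma wsum_mono: "(\<And>a. a \<in> verts n \<Longrightarrow> f a \<le> g a) \<Longrightarrow> wsum n f \<le> wsum n g"
  unfolding wsum_def csum_def using cell_verts_mem by (intro divide_right_mono sum_mono add_mono) simp_all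

lemma wsum_nonneg: "(\<And>a. a \<in> verts n \<Longrightarrow> 0 \<le> g a) \<Longrightarrow> 0 \<le> wsum n g"
  using wsum_mono[of n "\<lambda>_. 0" g] by (simp add: wsum_def csum_def)

lemma wsum_add: "wsum n (\<lambda>a. f a + g a) = wsum n f + wsum n g"
  unfolding wsum_def csum_def by (simp add: sum.distrib add_divide_distrib)

lemma wsum_cmult: "wsum n (\<lambda>a. c * g a) = c * wsum n g"
  unfolding wsum_def csum_def by (simp add: sum_distrib_left distrib_left)

lemma wsum_const: "wsum n (\<lambda>_. c) = 3 / 2 * 3 ^ n * c"
  unfolding wsum_def csum_def by (simp add: card_cells)

text \<open>Of the three terms of \<open>csum g t\<close> only the value at the lower left vertex is
  kept, which names each site at most once.\<close>

lemma wsum_ge_cells: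
  assumes "\<And>a. a \<in> verts n \<Longrightarrow> 0 \<le> g a" "A \<subseteq> cells n"
  shows "sum g A / 2 \<le> wsum n g"
proof -
  have "sum g A \<le> sum g (cells n)"
    by (rule sum_mono2) (use assms cell_verts_mem in auto)
  also have "\<dots> \<le> (\<Sum>t\<in>cells n. csum g t)"
    unfolding csum_def
  proof (rule sum_mono)
    fix t assume "t \<in> cells n"
    then show "g t \<le> g t + g (right t) + g (up t)"
      using cell_verts_mem[of t n] assms(1)[of "right t"] assms(1)[of "up t"] by simp
  qed
  finally show ?thesis by (simp add: wsum_def)
qed

lemma wsum_pos:
  assumes "\<And>a. a \<in> verts n \<Longrightarrow> 0 \<le> g a" "\<exists>a\<in>verts n. g a > 0"
  shows "0 < wsum n g"
proof -
  have "sum g (corners n) \<le> sum g (verts n)"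
    by (rule sum_mono2) (use assms corners_subset in auto)
  moreover obtain a where "a \<in> verts n" "g a > 0" using assms(2) by blast
  then have "0 < sum g (verts n)"
    by (intro sum_pos2[of _ a]) (simp_all add: assms(1))
  ultimately show ?thesis unfolding wsum_eq by simp
qed

section \<open>Energy renormalisation and the test function\<close>

definition corner_energy :: "real \<Rightarrow> real \<Rightarrow> real \<Rightarrow> real" where
  "corner_energy a b c = (a - b)\<^sup>2 + (a - c)\<^sup>2 + (b - c)\<^sup>2"

lemma energy_0: "energy 0 f = corner_energy (f (0, 0)) (f (1, 0)) (f (0, 1))"
  by (simp add: energy_def cell_energy_def corner_energy_def right_def up_def)

text \<open>Completing the square around the harmonic values (the 1/5-2/5 rule) at the three midpoints.\<close>
lemma corner_energy_split:
  fixes A B C x y z :: real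
  defines "p \<equiv> x - (2 * A + 2 * B + C) / 5" and "q \<equiv> y - (2 * A + 2 * C + B) / 5" and "r \<equiv> z - (2 * B + 2 * C + A) / 5"
  shows "corner_energy A x y + corner_energy x B z + corner_energy y z C
     = 3 / 5 * corner_energy A B C + ((p - q)\<^sup>2 + (p - r)\<^sup>2 + (q - r)\<^sup>2 + 2 * (p\<^sup>2 + q\<^sup>2 + r\<^sup>2))"
  unfolding p_def q_def r_def corner_energy_def by (simp add: field_simps power2_eq_square)

lemma corner_energy_ge:
  "3 / 5 * corner_energy A B C \<le> corner_energy A x y + corner_energy x B z + corner_energy y z C"
proof -
  have "0 \<le> (p - q)\<^sup>2 + (p - r)\<^sup>2 + (q - r)\<^sup>2 + 2 * (p\<^sup>2 + q\<^sup>2 + r\<^sup>2)" for p q r :: real by simp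
  then show ?thesis unfolding corner_energy_split[of A x y B z C] by (simp only: le_add_same_cancel1)
qed

lemma corner_values:
  "sx n (0, 0) = (2 ^ n, 0)" "sx n (2 ^ n, 0) = (2 ^ Suc n, 0)" "sx n (0, 2 ^ n) = (2 ^ n, 2 ^ n)"
  "sy n (0, 0) = (0, 2 ^ n)" "sy n (2 ^ n, 0) = (2 ^ n, 2 ^ n)" "sy n (0, 2 ^ n) = (0, 2 ^ Suc n)"
  by (simp_all add: sx_def sy_def)

text \<open>Harmonic midpoint values minimise the energy of the three subtriangles, and the minimum
  is 3/5 of the corner energy; iteration costs this factor once per level.\<close>

lemma energy_ge_corner: "(3 / 5) ^ n * corner_energy (f (0, 0)) (f (2 ^ n, 0)) (f (0, 2 ^ n)) \<le> energy n f"
proof (induct n arbitrary: f)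
  case 0
  then show ?case by (simp add: energy_0)
next
  case (Suc n)
  have "3 / 5 * corner_energy (f (0, 0)) (f (2 ^ Suc n, 0)) (f (0, 2 ^ Suc n))
     \<le> corner_energy (f (0, 0)) (f (2 ^ n, 0)) (f (0, 2 ^ n))
       + corner_energy (f (2 ^ n, 0)) (f (2 ^ Suc n, 0)) (f (2 ^ n, 2 ^ n))
       + corner_energy (f (0, 2 ^ n)) (f (2 ^ n, 2 ^ n)) (f (0, 2 ^ Suc n))"
    by (rule corner_energy_ge)
  then have "(3 / 5) ^ n * (3 / 5 * corner_energy (f (0, 0)) (f (2 ^ Suc n, 0)) (f (0, 2 ^ Suc n)))
     \<le> (3 / 5) ^ n * (corner_energy (f (0, 0)) (f (2 ^ n, 0)) (f (0, 2 ^ n))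
       + corner_energy (f (2 ^ n, 0)) (f (2 ^ Suc n, 0)) (f (2 ^ n, 2 ^ n))
       + corner_energy (f (0, 2 ^ n)) (f (2 ^ n, 2 ^ n)) (f (0, 2 ^ Suc n)))"
    by (rule mult_left_mono) simp
  also have "\<dots> \<le> energy n f + energy n (\<lambda>a. f (sx n a)) + energy n (\<lambda>a. f (sy n a))"
    unfolding distrib_left
    using Suc[of f] Suc[of "\<lambda>a. f (sx n a)"] Suc[of "\<lambda>a. f (sy n a)"] unfolding corner_values by (intro add_mono)
  finally show ?case unfolding energy_Suc by (simp add: mult.assoc mult.left_commute)
qed

text \<open>The hypotheses are agreement at the three midpoints, the only places where copies
  overlap.\<close>

lemma glue:
  assumes "f0 (2 ^ n, 0) = f1 (0, 0)" "f0 (0, 2 ^ n) = f2 (0, 0)" "f1 (0, 2 ^ n) = f2 (2 ^ n, 0)"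
  shows "\<exists>f. \<forall>a\<in>verts n. f a = (f0 a :: real) \<and> f (sx n a) = f1 a \<and> f (sy n a) = f2 a"
proof -
  define f where "f a = (if a \<in> verts n then f0 a else if a \<in> sx n ` verts n then f1 (inv_into UNIV (sx n) a) else f2 (inv_into UNIV (sy n) a))" for a
  have "f (sx n a) = f1 a" if a: "a \<in> verts n" for a
  proof (cases "sx n a \<in> verts n")
    case True
    then have "sx n a \<in> {(2 ^ n, 0)}" unfolding verts_Int(1)[of n, symmetric] using a by blast
    then have "a = (0, 0)" "sx n a = (2 ^ n, 0)" by (auto simp: sx_def prod_eq_iff)
    then show ?thesis using assms(1) by (simp add: f_def)
  next
    case False
    then show ?thesis using a by (simp add: f_def inv_f_f[OF sx_inj])
  qed
  moreover have "f (sy n a) = f2 a" if a: "a \<in> verts n" for a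
  proof (cases "sy n a \<in> verts n")
    case True
    then have "sy n a \<in> {(0, 2 ^ n)}" unfolding verts_Int(2)[of n, symmetric] using a by blast
    then have "a = (0, 0)" "sy n a = (0, 2 ^ n)" by (auto simp: sy_def prod_eq_iff)
    then show ?thesis using assms(2) by (simp add: f_def)
  next
    case False
    show ?thesis
    proof (cases "sy n a \<in> sx n ` verts n")
      case True
      then have "sy n a \<in> {(2 ^ n, 2 ^ n)}" unfolding verts_Int(3)[of n, symmetric] using a by blast
      then have *: "a = (2 ^ n, 0)" "sy n a = sx n (0, 2 ^ n)" by (auto simp: sy_def sx_def prod_eq_iff)
      have "f (sy n a) = f1 (inv_into UNIV (sx n) (sy n a))" using False True by (simp add: f_def)
      also have "\<dots> = f1 (0, 2 ^ n)" unfolding *(2) by (simp only: inv_f_f[OF sx_inj])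
      finally show ?thesis using assms(3) *(1) by simp
    next
      case F: False
      then show ?thesis using a False by (simp add: f_def inv_f_f[OF sy_inj])
    qed
  qed
  moreover have "f a = f0 a" if "a \<in> verts n" for a using that by (simp add: f_def)
  ultimately show ?thesis by blast
qed

lemma glued:
  assumes "\<forall>a\<in>verts n. f a = (f0 a :: real) \<and> f (sx n a) = f1 a \<and> f (sy n a) = f2 a"
  shows "energy (Suc n) f = energy n f0 + energy n f1 + energy n f2"
    "wsum (Suc n) (\<lambda>a. (f a)\<^sup>2) = wsum n (\<lambda>a. (f0 a)\<^sup>2) + wsum n (\<lambda>a. (f1 a)\<^sup>2) + wsum n (\<lambda>a. (f2 a)\<^sup>2)"
    "f (0, 0) = f0 (0, 0)" "f (2 ^ Suc n, 0) = f1 (2 ^ n, 0)" "f (0, 2 ^ Suc n) = f2 (0, 2 ^ n)"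
proof -
  have h: "f a = f0 a" "f (sx n a) = f1 a" "f (sy n a) = f2 a" if "a \<in> verts n" for a using assms that by blast+
  show "energy (Suc n) f = energy n f0 + energy n f1 + energy n f2"
    unfolding energy_Suc by (intro arg_cong2[where f = "(+)"] energy_cong) (simp_all add: h)
  show "wsum (Suc n) (\<lambda>a. (f a)\<^sup>2) = wsum n (\<lambda>a. (f0 a)\<^sup>2) + wsum n (\<lambda>a. (f1 a)\<^sup>2) + wsum n (\<lambda>a. (f2 a)\<^sup>2)"
    unfolding wsum_Suc by (intro arg_cong2[where f = "(+)"] wsum_cong) (simp_all add: h)
  show "f (0, 0) = f0 (0, 0)" by (rule h(1)) simp
  show "f (2 ^ Suc n, 0) = f1 (2 ^ n, 0)" unfolding corner_values(2)[symmetric] by (rule h(2)) simp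
  show "f (0, 2 ^ Suc n) = f2 (0, 2 ^ n)" unfolding corner_values(6)[symmetric] by (rule h(3)) simp
qed

text \<open>The norm bound is phrased through the sum of the corner values because this passes
  through the induction: the corner sums of the three subtriangles add up to 3 (A + B + C), and
  Cauchy-Schwarz does the rest.\<close>

lemma harmonic_extension:
  "\<exists>f. f (0, 0) = A \<and> f (2 ^ n, 0) = B \<and> f (0, 2 ^ n) = C \<and>
     energy n f = (3 / 5) ^ n * corner_energy A B C \<and> 3 ^ n * ((A + B + C)\<^sup>2 / 6) \<le> wsum n (\<lambda>a. (f a)\<^sup>2)"
proof (induct n arbitrary: A B C)
  case 0
  define f where "f a = (if a = (0, 0) then A else if a = (1, 0) then B else C)" for a :: idx
  have "wsum 0 (\<lambda>a. (f a)\<^sup>2) = (A\<^sup>2 + B\<^sup>2 + C\<^sup>2) / 2"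
    by (simp add: wsum_def csum_def f_def right_def up_def)
  moreover have "(A + B + C)\<^sup>2 / 6 \<le> (A\<^sup>2 + B\<^sup>2 + C\<^sup>2) / 2"
  proof -
    have "0 \<le> (A - B)\<^sup>2 + (A - C)\<^sup>2 + (B - C)\<^sup>2" by simp
    then show ?thesis by (simp add: power2_eq_square field_simps)
  qed
  ultimately show ?case by (intro exI[of _ f]) (simp add: energy_0, simp add: f_def)
next
  case (Suc n)
  define x y z where "x = (2 * A + 2 * B + C) / 5" "y = (2 * A + 2 * C + B) / 5" "z = (2 * B + 2 * C + A) / 5"
  obtain f0 where f0: "f0 (0, 0) = A" "f0 (2 ^ n, 0) = x" "f0 (0, 2 ^ n) = y"
    "energy n f0 = (3 / 5) ^ n * corner_energy A x y" "3 ^ n * ((A + x + y)\<^sup>2 / 6) \<le> wsum n (\<lambda>a. (f0 a)\<^sup>2)"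
    using Suc[of A x y] by blast
  obtain f1 where f1: "f1 (0, 0) = x" "f1 (2 ^ n, 0) = B" "f1 (0, 2 ^ n) = z"
    "energy n f1 = (3 / 5) ^ n * corner_energy x B z" "3 ^ n * ((x + B + z)\<^sup>2 / 6) \<le> wsum n (\<lambda>a. (f1 a)\<^sup>2)"
    using Suc[of x B z] by blast
  obtain f2 where f2: "f2 (0, 0) = y" "f2 (2 ^ n, 0) = z" "f2 (0, 2 ^ n) = C"
    "energy n f2 = (3 / 5) ^ n * corner_energy y z C" "3 ^ n * ((y + z + C)\<^sup>2 / 6) \<le> wsum n (\<lambda>a. (f2 a)\<^sup>2)"
    using Suc[of y z C] by blast
  obtain f where f: "\<forall>a\<in>verts n. f a = f0 a \<and> f (sx n a) = f1 a \<and> f (sy n a) = f2 a"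
    using glue[of f0 n f1 f2] f0 f1 f2 by auto
  note g = glued[OF f]
  have "corner_energy A x y + corner_energy x B z + corner_energy y z C = 3 / 5 * corner_energy A B C"
    unfolding corner_energy_split by (simp add: x_y_z_def)
  then have en: "energy (Suc n) f = (3 / 5) ^ Suc n * corner_energy A B C"
    unfolding g(1) f0(4) f1(4) f2(4) by (simp flip: distrib_left)
  have "3 * ((A + B + C)\<^sup>2 / 6) \<le> (A + x + y)\<^sup>2 / 6 + (x + B + z)\<^sup>2 / 6 + (y + z + C)\<^sup>2 / 6"
  proof -
    define a b c where "a = A + x + y" "b = x + B + z" "c = y + z + C"
    have s: "a + b + c = 3 * (A + B + C)" by (simp add: a_b_c_def x_y_z_def field_simps)
    have "0 \<le> (a - b)\<^sup>2 + (a - c)\<^sup>2 + (b - c)\<^sup>2" by simp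
    then have "(a + b + c)\<^sup>2 \<le> 3 * (a\<^sup>2 + b\<^sup>2 + c\<^sup>2)" by (simp add: power2_eq_square algebra_simps)
    then have "9 * (A + B + C)\<^sup>2 \<le> 3 * (a\<^sup>2 + b\<^sup>2 + c\<^sup>2)" unfolding s power_mult_distrib by simp
    then show ?thesis unfolding a_b_c_def[symmetric] by simp
  qed
  then have "3 ^ n * (3 * ((A + B + C)\<^sup>2 / 6)) \<le> 3 ^ n * ((A + x + y)\<^sup>2 / 6 + (x + B + z)\<^sup>2 / 6 + (y + z + C)\<^sup>2 / 6)"
    by (rule mult_left_mono) simp
  also have "\<dots> \<le> wsum (Suc n) (\<lambda>a. (f a)\<^sup>2)"
    unfolding g(2) distrib_left by (intro add_mono f0(5) f1(5) f2(5))
  finally have w: "3 ^ Suc n * ((A + B + C)\<^sup>2 / 6) \<le> wsum (Suc n) (\<lambda>a. (f a)\<^sup>2)" by simp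
  show ?case
    using g(3-5) f0 f1 f2 en w by (intro exI[of _ f] conjI) simp_all
qed

text \<open>Value 1 at the midpoints, 0 at the outer corners, harmonic in each of the three
  subcells. Each contributes energy \<open>2 * (3 / 5) ^ n\<close> and squared norm at least
  \<open>3 ^ n * (4 / 6)\<close>.\<close>

lemma test_function:
  "\<exists>f. (\<forall>a\<in>corners (Suc n). f a = 0) \<and> energy (Suc n) f = 6 * (3 / 5) ^ n \<and>
     2 * 3 ^ n \<le> (\<Sum>a\<in>inner_verts (Suc n). (f a)\<^sup>2)"
proof -
  obtain f0 where f0: "f0 (0, 0) = 0" "f0 (2 ^ n, 0) = 1" "f0 (0, 2 ^ n) = 1"
    "energy n f0 = (3 / 5) ^ n * corner_energy 0 1 1" "3 ^ n * ((0 + 1 + 1)\<^sup>2 / 6) \<le> wsum n (\<lambda>a. (f0 a)\<^sup>2)"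
    using harmonic_extension[of 0 n 1 1] by blast
  obtain f1 where f1: "f1 (0, 0) = 1" "f1 (2 ^ n, 0) = 0" "f1 (0, 2 ^ n) = 1"
    "energy n f1 = (3 / 5) ^ n * corner_energy 1 0 1" "3 ^ n * ((1 + 0 + 1)\<^sup>2 / 6) \<le> wsum n (\<lambda>a. (f1 a)\<^sup>2)"
    using harmonic_extension[of 1 n 0 1] by blast
  obtain f2 where f2: "f2 (0, 0) = 1" "f2 (2 ^ n, 0) = 1" "f2 (0, 2 ^ n) = 0"
    "energy n f2 = (3 / 5) ^ n * corner_energy 1 1 0" "3 ^ n * ((1 + 1 + 0)\<^sup>2 / 6) \<le> wsum n (\<lambda>a. (f2 a)\<^sup>2)"
    using harmonic_extension[of 1 n 1 0] by blast
  obtain f where f: "\<forall>a\<in>verts n. f a = f0 a \<and> f (sx n a) = f1 a \<and> f (sy n a) = f2 a"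
    using glue[of f0 n f1 f2] f0 f1 f2 by auto
  note g = glued[OF f]
  have 0: "f a = 0" if "a \<in> corners (Suc n)" for a
    using that g(3-5) f0(1) f1(2) f2(3) by (auto simp: corners_def)
  have "wsum (Suc n) (\<lambda>a. (f a)\<^sup>2) = (\<Sum>a\<in>verts (Suc n). (f a)\<^sup>2)"
    unfolding wsum_eq using 0 by simp
  also have "\<dots> = (\<Sum>a\<in>inner_verts (Suc n). (f a)\<^sup>2)"
    by (rule sum.mono_neutral_right) (use 0 in \<open>auto simp: inner_verts_def\<close>)
  finally have "2 * 3 ^ n \<le> (\<Sum>a\<in>inner_verts (Suc n). (f a)\<^sup>2)"
    using g(2) f0(5) f1(5) f2(5) by simp
  moreover have "energy (Suc n) f = 6 * (3 / 5) ^ n"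
    unfolding g(1) f0(4) f1(4) f2(4) by (simp add: corner_energy_def)
  ultimately show ?thesis using 0 by blast
qed

lemma energy_cmult: "energy n (\<lambda>a. c * f a) = c\<^sup>2 * energy n f"
  unfolding energy_def cell_energy_def sum_distrib_left
  by (intro sum.cong refl) (simp add: power2_eq_square algebra_simps)

text \<open>The Rayleigh quotient of the test function is at most 6 (3/5)^n / (2 * 3^n) = 3 (1/5)^n,
  and the potential adds at most \<epsilon>.\<close>

lemma cell_count_pos:
  assumes E: "3 * (1 / 5) ^ n + \<epsilon> \<le> E" and v: "\<And>a. a \<in> inner_verts (Suc n) \<Longrightarrow> v a \<le> \<epsilon>"
  shows "1 \<le> cell_count (Suc n) E v"
proof -
  obtain f where f: "\<forall>a\<in>corners (Suc n). f a = 0" "energy (Suc n) f = 6 * (3 / 5) ^ n"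
    "2 * 3 ^ n \<le> (\<Sum>a\<in>inner_verts (Suc n). (f a)\<^sup>2)" using test_function by blast
  let ?S = "\<Sum>a\<in>inner_verts (Suc n). (f a)\<^sup>2"
  have "energy (Suc n) f = 3 * (1 / 5) ^ n * (2 * 3 ^ n)"
    unfolding f(2) by (simp add: power_divide)
  also have "\<dots> \<le> 3 * (1 / 5) ^ n * ?S" by (rule mult_left_mono[OF f(3)]) simp
  finally have en: "energy (Suc n) f \<le> 3 * (1 / 5) ^ n * ?S" .
  have "low_family E (qform (cell_kernel v) (inner_verts (Suc n))) (inner_verts (Suc n)) {0::nat} (\<lambda>_. f)"
    unfolding low_family_def
  proof (intro allI impI)
    fix c :: "nat \<Rightarrow> real" assume "\<exists>j\<in>{0}. c j \<noteq> 0"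
    then have c: "c 0 \<noteq> 0" by simp
    have "?S > 0" using f(3) by (smt (verit) zero_less_power)
    then have "\<exists>a\<in>inner_verts (Suc n). f a \<noteq> 0" by (metis less_irrefl sum.neutral zero_power2)
    then have 1: "\<exists>a\<in>inner_verts (Suc n). c 0 * f a \<noteq> 0" using c by simp
    have "qform (cell_kernel v) (inner_verts (Suc n)) (\<lambda>a. c 0 * f a)
       = (c 0)\<^sup>2 * energy (Suc n) f + (\<Sum>a\<in>inner_verts (Suc n). v a * (c 0 * f a)\<^sup>2)"
      by (subst qform_cell_kernel) (use f(1) in \<open>auto simp: energy_cmult\<close>)
    also have "\<dots> \<le> (c 0)\<^sup>2 * (3 * (1 / 5) ^ n * ?S) + (\<Sum>a\<in>inner_verts (Suc n). \<epsilon> * (c 0 * f a)\<^sup>2)"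
      by (intro add_mono mult_left_mono en sum_mono mult_right_mono v) auto
    also have "\<dots> = (3 * (1 / 5) ^ n + \<epsilon>) * ((c 0)\<^sup>2 * ?S)"
      by (simp add: power_mult_distrib sum_distrib_left sum.distrib algebra_simps)
    also have "\<dots> \<le> E * ((c 0)\<^sup>2 * ?S)"
      by (rule mult_right_mono[OF E]) (simp add: sum_nonneg)
    finally have 2: "qform (cell_kernel v) (inner_verts (Suc n)) (\<lambda>a. c 0 * f a) \<le> E * (\<Sum>a\<in>inner_verts (Suc n). (c 0 * f a)\<^sup>2)"
      by (simp add: power_mult_distrib sum_distrib_left)
    show "(\<exists>x\<in>inner_verts (Suc n). (\<Sum>j\<in>{0}. c j * f x) \<noteq> 0) \<and>
      qform (cell_kernel v) (inner_verts (Suc n)) (\<lambda>x. \<Sum>j\<in>{0}. c j * f x)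
        \<le> E * (\<Sum>x\<in>inner_verts (Suc n). (\<Sum>j\<in>{0}. c j * f x)\<^sup>2)"
      using 1 2 by simp
  qed
  from eig_count_ge[where K = "cell_kernel v", OF finite_inner_verts cell_kernel_sym _ this]
  show ?thesis by (simp add: cell_count_def)
qed

section \<open>Oscillation bounds and counting by bad cells\<close>

lemma corner_diff:
  "a \<in> corners n \<Longrightarrow> \<bar>f a - f (0, 0)\<bar> \<le> sqrt (5 / 3) ^ n * sqrt (energy n f)"
proof -
  assume a: "a \<in> corners n"
  have "(f a - f (0, 0))\<^sup>2 \<le> corner_energy (f (0, 0)) (f (2 ^ n, 0)) (f (0, 2 ^ n))"
    using a by (auto simp: corners_def corner_energy_def power2_commute)
  also have "\<dots> = (5 / 3) ^ n * ((3 / 5) ^ n * corner_energy (f (0, 0)) (f (2 ^ n, 0)) (f (0, 2 ^ n)))"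
    by (simp add: power_divide)
  also have "\<dots> \<le> (5 / 3) ^ n * energy n f"
    by (rule mult_left_mono[OF energy_ge_corner]) simp
  finally have "\<bar>f a - f (0, 0)\<bar> \<le> sqrt ((5 / 3) ^ n * energy n f)"
    by (metis real_sqrt_abs real_sqrt_le_iff)
  then show ?thesis by (simp add: real_sqrt_mult real_sqrt_power)
qed

text \<open>Go from the point to the first corner of its subcell, by induction, and from there to
  the origin by \<open>corner_diff\<close>. The constant 5 is reproduced because 5 + 1 \<le> 5
  sqrt(5/3).\<close>

lemma oscillation:
  "a \<in> verts n \<Longrightarrow> \<bar>f a - f (0, 0)\<bar> \<le> 5 * (sqrt (5 / 3) ^ n * sqrt (energy n f))"
proof (induct n arbitrary: a f)
  case 0
  then have "a \<in> corners 0" by (auto simp: verts_0 corners_def)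
  from corner_diff[OF this, of f] have "\<bar>f a - f (0, 0)\<bar> \<le> sqrt (energy 0 f)" by simp
  also have "\<dots> \<le> 5 * sqrt (energy 0 f)" using energy_nonneg[of 0 f] by simp
  finally show ?case by simp
next
  case (Suc n)
  let ?e = "sqrt (energy (Suc n) f)"
  obtain c b where c: "c \<in> {0,1,2}" and b: "b \<in> verts n" "a = cell_shift n c b"
    using Suc.prems unfolding verts_Suc_shift by blast
  have le: "energy n (\<lambda>p. f (cell_shift n d p)) \<le> energy (Suc n) f" if "d \<in> {0,1,2}" for d
    unfolding energy_Suc_shift by (rule member_le_sum[OF that]) (simp_all add: energy_nonneg)
  have s0: "0 \<le> sqrt (5 / 3) ^ n" by simp
  have "\<bar>f a - f (cell_shift n c (0, 0))\<bar> \<le> 5 * (sqrt (5 / 3) ^ n * sqrt (energy n (\<lambda>p. f (cell_shift n c p))))"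
    unfolding b(2) by (rule Suc.hyps[OF b(1)])
  also have "\<dots> \<le> 5 * (sqrt (5 / 3) ^ n * ?e)"
    using le[OF c] s0 by (intro mult_left_mono) auto
  finally have 1: "\<bar>f a - f (cell_shift n c (0, 0))\<bar> \<le> 5 * (sqrt (5 / 3) ^ n * ?e)" .
  have "cell_shift n c (0, 0) \<in> corners n" using c by (auto simp: corners_def sx_def sy_def)
  from corner_diff[OF this, of f] have "\<bar>f (cell_shift n c (0, 0)) - f (0, 0)\<bar> \<le> sqrt (5 / 3) ^ n * sqrt (energy n f)" .
  also have "\<dots> \<le> sqrt (5 / 3) ^ n * ?e" using le[of 0] s0 by (intro mult_left_mono) auto
  finally have 2: "\<bar>f (cell_shift n c (0, 0)) - f (0, 0)\<bar> \<le> sqrt (5 / 3) ^ n * ?e" .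
  have "\<bar>f a - f (0, 0)\<bar> \<le> 6 * (sqrt (5 / 3) ^ n * ?e)" using 1 2 by linarith
  also have "\<dots> \<le> (5 * sqrt (5 / 3)) * (sqrt (5 / 3) ^ n * ?e)"
  proof (rule mult_right_mono)
    have "6 / 5 \<le> sqrt (5 / 3)" by (rule real_le_rsqrt) (simp add: power2_eq_square)
    then show "6 \<le> 5 * sqrt (5 / 3)" by simp
    show "0 \<le> sqrt (5 / 3) ^ n * ?e" using s0 energy_nonneg by simp
  qed
  finally show ?case by (simp add: mult_ac)
qed

lemma oscillation_sq:
  assumes "a \<in> verts n"
  shows "(f a - f (0, 0))\<^sup>2 \<le> 25 * (5 / 3) ^ n * energy n f"
proof -
  have "\<bar>f a - f (0, 0)\<bar>\<^sup>2 \<le> (5 * (sqrt (5 / 3) ^ n * sqrt (energy n f)))\<^sup>2"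
    by (rule power_mono[OF oscillation[OF assms]]) simp
  also have "\<dots> = 25 * (5 / 3) ^ n * energy n f"
    using energy_nonneg[of n f] by (simp add: power_mult_distrib power_mult[symmetric] mult.commute[of n] power_mult)
  finally show ?thesis by simp
qed

text \<open>Sites are sampled through lower left vertices of unit triangles: these are
  \<open>3 ^ n\<close> distinct sites, hence \<open>3 ^ n\<close> independent values of the
  potential.\<close>

definition good_cell :: "nat \<Rightarrow> real \<Rightarrow> real \<Rightarrow> (idx \<Rightarrow> real) \<Rightarrow> bool" where
  "good_cell n \<delta> \<epsilon> v \<longleftrightarrow> \<delta> * 3 ^ n \<le> real (card {t \<in> cells n. \<epsilon> \<le> v t})"

text \<open>If the form were small, the energy bound would force \<open>f\<close> to be close to the
  constant \<open>f (0, 0)\<close> in mean square. A nearly constant function feels the potential at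
  a fraction \<delta> of the sites, and this already exceeds the assumed bound.\<close>

lemma good_cell_form:
  assumes \<delta>: "0 < \<delta>" "\<delta> \<le> 1" and \<epsilon>: "0 < \<epsilon>" and v: "\<And>a. a \<in> verts n \<Longrightarrow> 0 \<le> v a"
    and good: "good_cell n \<delta> \<epsilon> v" and E: "E \<le> \<delta> * min 1 \<epsilon> / 2000 * (1 / 5) ^ n" and f: "\<exists>a\<in>verts n. f a \<noteq> 0"
  shows "E * wsum n (\<lambda>a. (f a)\<^sup>2) < energy n f + wsum n (\<lambda>a. v a * (f a)\<^sup>2)"
proof (rule ccontr)
  assume neg: "\<not> ?thesis"
  \<comment> \<open>The 2000 is generous: it makes \<open>D\<close> at most 3/160 of
    \<open>\<delta> * W\<close>. Then \<open>3 ^ n * m^2\<close> is at least \<open>W / 4\<close>,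
    and the mass on \<open>A\<close> exceeds \<open>\<delta> * W / 50\<close>, far above what
    \<open>c\<close> permits.\<close>
  define c where "c = \<delta> * min 1 \<epsilon> / 2000"
  define W where "W = wsum n (\<lambda>a. (f a)\<^sup>2)"
  define U where "U = wsum n (\<lambda>a. v a * (f a)\<^sup>2)"
  define m where "m = f (0, 0)"
  define D where "D = wsum n (\<lambda>a. (f a - m)\<^sup>2)"
  define A where "A = {t \<in> cells n. \<epsilon> \<le> v t}"
  have c: "0 < c" "c \<le> \<delta> / 2000" "c \<le> \<delta> * \<epsilon> / 2000" using \<delta> \<epsilon>
    by (auto simp: c_def min_def mult_le_cancel_left1)
  have W: "0 < W" unfolding W_def using f by (intro wsum_pos) auto
  have U: "0 \<le> U" unfolding U_def by (rule wsum_nonneg) (simp add: v)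
  have "energy n f + U \<le> E * W" using neg by (simp add: W_def U_def)
  also have "\<dots> \<le> c * (1 / 5) ^ n * W" using E W by (intro mult_right_mono) (simp_all add: c_def)
  finally have main: "energy n f + U \<le> c * (1 / 5) ^ n * W" .
  have "D \<le> wsum n (\<lambda>_. 25 * (5 / 3) ^ n * energy n f)"
    unfolding D_def m_def by (rule wsum_mono) (rule oscillation_sq)
  \<comment> \<open>The volume 3/2 * 3^n cancels the denominator of (5/3)^n; the remaining 5^n is
    compensated by the threshold of order (1/5)^n.\<close>
  also have "\<dots> = 75 / 2 * (5 ^ n * energy n f)" unfolding wsum_const by (simp add: power_divide)
  also have "\<dots> \<le> 75 / 2 * (5 ^ n * (c * (1 / 5) ^ n * W))"
    using main U by (intro mult_left_mono) auto
  also have "\<dots> = 75 / 2 * c * W" by (simp add: power_divide)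
  finally have D: "D \<le> 75 / 2 * c * W" .
  have "W \<le> wsum n (\<lambda>a. 2 * m\<^sup>2 + 2 * (f a - m)\<^sup>2)"
    unfolding W_def
  proof (rule wsum_mono)
    fix a
    have "0 \<le> (f a - 2 * m)\<^sup>2" by simp
    then show "(f a)\<^sup>2 \<le> 2 * m\<^sup>2 + 2 * (f a - m)\<^sup>2" by (simp add: power2_eq_square algebra_simps)
  qed
  also have "\<dots> = 3 * 3 ^ n * m\<^sup>2 + 2 * D" unfolding wsum_add wsum_cmult wsum_const D_def by simp
  finally have Wm: "W \<le> 3 * 3 ^ n * m\<^sup>2 + 2 * D" .
  have A: "A \<subseteq> cells n" "finite A" by (auto simp: A_def)
  have cardA: "\<delta> * 3 ^ n \<le> real (card A)" using good unfolding good_cell_def A_def .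
  have "\<epsilon> * ((\<Sum>t\<in>A. (f t)\<^sup>2) / 2) = (\<Sum>t\<in>A. \<epsilon> * (f t)\<^sup>2) / 2" by (simp add: sum_distrib_left)
  also have "\<dots> \<le> (\<Sum>t\<in>A. v t * (f t)\<^sup>2) / 2"
    by (intro divide_right_mono sum_mono mult_right_mono) (auto simp: A_def)
  also have "\<dots> \<le> U" unfolding U_def by (rule wsum_ge_cells[OF _ A(1)]) (simp add: v)
  finally have U1: "\<epsilon> * ((\<Sum>t\<in>A. (f t)\<^sup>2) / 2) \<le> U" .
  have "real (card A) * (m\<^sup>2 / 2) - (\<Sum>t\<in>A. (f t - m)\<^sup>2) = (\<Sum>t\<in>A. m\<^sup>2 / 2 - (f t - m)\<^sup>2)"
    by (simp add: sum_subtractf)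
  \<comment> \<open>The nearly constant value is transferred to the sites of \<open>A\<close>, at
    half strength and up to the squared deviation.\<close>
  also have "\<dots> \<le> (\<Sum>t\<in>A. (f t)\<^sup>2)"
  proof (rule sum_mono)
    fix t
    have "0 \<le> (2 * f t - m)\<^sup>2" by simp
    then show "m\<^sup>2 / 2 - (f t - m)\<^sup>2 \<le> (f t)\<^sup>2" by (simp add: power2_eq_square algebra_simps)
  qed
  finally have "real (card A) * (m\<^sup>2 / 2) - (\<Sum>t\<in>A. (f t - m)\<^sup>2) \<le> (\<Sum>t\<in>A. (f t)\<^sup>2)" .
  moreover have "(\<Sum>t\<in>A. (f t - m)\<^sup>2) / 2 \<le> D" unfolding D_def by (rule wsum_ge_cells[OF _ A(1)]) simp
  moreover have "\<delta> * 3 ^ n * (m\<^sup>2 / 2) \<le> real (card A) * (m\<^sup>2 / 2)" by (rule mult_right_mono[OF cardA]) simp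
  ultimately have S: "\<delta> * 3 ^ n * m\<^sup>2 / 4 - D \<le> (\<Sum>t\<in>A. (f t)\<^sup>2) / 2" by (simp add: field_simps)
  have cW: "c * W \<le> \<delta> / 2000 * W" using c W by (intro mult_right_mono) auto
  have dW: "\<delta> * W \<le> W" using \<delta> W by simp
  have D': "D \<le> 75 / 2 * (c * W)" and Wm': "W \<le> 3 * (3 ^ n * m\<^sup>2) + 2 * D" and cW': "c * W \<le> (\<delta> * W) / 2000"
    using D Wm cW by (simp_all add: mult.assoc)
  have "3 ^ n * m\<^sup>2 \<ge> W / 4" using Wm' D' cW' dW W by linarith
  then have "\<delta> * (W / 4) \<le> \<delta> * (3 ^ n * m\<^sup>2)" using \<delta> by (intro mult_left_mono) auto
  moreover have "\<delta> * (3 ^ n * m\<^sup>2) / 4 - D \<le> (\<Sum>t\<in>A. (f t)\<^sup>2) / 2" using S by (simp add: mult.assoc)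
  moreover have "\<delta> * (W / 4) = \<delta> * W / 4" by simp
  ultimately have "\<delta> * W / 50 < (\<Sum>t\<in>A. (f t)\<^sup>2) / 2"
    using D' cW' mult_pos_pos[OF \<delta>(1) W] by linarith
  then have "\<epsilon> * (\<delta> * W / 50) < \<epsilon> * ((\<Sum>t\<in>A. (f t)\<^sup>2) / 2)" using \<epsilon> by (rule mult_strict_left_mono)
  also have "\<dots> \<le> c * (1 / 5) ^ n * W" using U1 main energy_nonneg[of n f] by linarith
  also have "\<dots> \<le> c * 1 * W" using c W by (intro mult_right_mono mult_left_mono power_le_one) auto
  also have "\<dots> \<le> \<delta> * \<epsilon> / 2000 * W" using c W by (simp add: mult_right_mono)
  finally show False using mult_pos_pos[OF mult_pos_pos[OF \<delta>(1) \<epsilon>] W] by (simp add: mult_ac)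
qed

text \<open>Total number of vertices, with repetition, of the level-n subcells that fail
  \<open>good\<close> in a cell of level n + m. The corners are included, since \<open>f\<close>
  must vanish on the whole bad subcell.\<close>

fun bad_sites :: "nat \<Rightarrow> ((idx \<Rightarrow> real) \<Rightarrow> bool) \<Rightarrow> nat \<Rightarrow> (idx \<Rightarrow> real) \<Rightarrow> nat" where
  "bad_sites n good 0 v = (if good v then 0 else card (verts n))"
| "bad_sites n good (Suc m) v = bad_sites n good m v + bad_sites n good m (\<lambda>a. v (sx (n + m) a)) + bad_sites n good m (\<lambda>a. v (sy (n + m) a))"

text \<open>The weak inequality lets subcells be added on which \<open>f\<close> vanishes;
  strictness survives as soon as one subcell carries a nonzero value.\<close>

definition form_above :: "real \<Rightarrow> nat \<Rightarrow> (idx \<Rightarrow> real) \<Rightarrow> (idx \<Rightarrow> real) \<Rightarrow> bool" where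
  "form_above E n v f \<longleftrightarrow> E * wsum n (\<lambda>a. (f a)\<^sup>2) \<le> energy n f + wsum n (\<lambda>a. v a * (f a)\<^sup>2) \<and>
    ((\<exists>a\<in>verts n. f a \<noteq> 0) \<longrightarrow> E * wsum n (\<lambda>a. (f a)\<^sup>2) < energy n f + wsum n (\<lambda>a. v a * (f a)\<^sup>2))"

lemma form_above_zero: "(\<And>a. a \<in> verts n \<Longrightarrow> f a = 0) \<Longrightarrow> form_above E n v f"
proof -
  assume f: "\<And>a. a \<in> verts n \<Longrightarrow> f a = 0"
  have "wsum n (\<lambda>a. (f a)\<^sup>2) = wsum n (\<lambda>_. 0)" "wsum n (\<lambda>a. v a * (f a)\<^sup>2) = wsum n (\<lambda>_. 0)"
    by (rule wsum_cong, simp add: f)+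
  then show ?thesis using f energy_nonneg unfolding form_above_def wsum_const by auto
qed

lemma form_above_Suc:
  assumes "form_above E n v f" "form_above E n (\<lambda>a. v (sx n a)) (\<lambda>a. f (sx n a))" "form_above E n (\<lambda>a. v (sy n a)) (\<lambda>a. f (sy n a))"
  shows "form_above E (Suc n) v f"
  using assms unfolding form_above_def wsum_Suc energy_Suc verts_Suc distrib_left
  by (auto simp del: split_paired_All split_paired_Ex)

text \<open>\<open>S\<close> collects all vertices of bad subcells. A function vanishing on
  \<open>S\<close> is zero on these, and the good subcells satisfy the inequality by
  assumption.\<close>

lemma bad_sites_set:
  assumes good: "\<And>v f. (\<And>a. a \<in> verts n \<Longrightarrow> 0 \<le> v a) \<Longrightarrow> good v \<Longrightarrow> form_above E n v f"
    and v: "\<And>a. a \<in> verts (n + m) \<Longrightarrow> 0 \<le> v a"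
  shows "\<exists>S. S \<subseteq> verts (n + m) \<and> card S \<le> bad_sites n good m v \<and> (\<forall>f. (\<forall>a\<in>S. f a = 0) \<longrightarrow> form_above E (n + m) v f)"
  using v
proof (induct m arbitrary: v)
  case 0
  show ?case
  proof (cases "good v")
    case True
    then show ?thesis using good 0 by (intro exI[of _ "{}"]) auto
  next
    case False
    then show ?thesis using form_above_zero by (intro exI[of _ "verts n"]) auto
  qed
next
  case (Suc m)
  have nn: "0 \<le> v a" "0 \<le> v (sx (n + m) a)" "0 \<le> v (sy (n + m) a)" if "a \<in> verts (n + m)" for a
    using Suc.prems that unfolding add_Suc_right verts_Suc by blast+
  obtain S0 where S0: "S0 \<subseteq> verts (n + m)" "card S0 \<le> bad_sites n good m v" "\<forall>f. (\<forall>a\<in>S0. f a = 0) \<longrightarrow> form_above E (n + m) v f"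
    using Suc.hyps[of v, OF nn(1)] by blast
  obtain S1 where S1: "S1 \<subseteq> verts (n + m)" "card S1 \<le> bad_sites n good m (\<lambda>a. v (sx (n + m) a))"
    "\<forall>f. (\<forall>a\<in>S1. f a = 0) \<longrightarrow> form_above E (n + m) (\<lambda>a. v (sx (n + m) a)) f"
    using Suc.hyps[of "\<lambda>a. v (sx (n + m) a)", OF nn(2)] by blast
  obtain S2 where S2: "S2 \<subseteq> verts (n + m)" "card S2 \<le> bad_sites n good m (\<lambda>a. v (sy (n + m) a))"
    "\<forall>f. (\<forall>a\<in>S2. f a = 0) \<longrightarrow> form_above E (n + m) (\<lambda>a. v (sy (n + m) a)) f"
    using Suc.hyps[of "\<lambda>a. v (sy (n + m) a)", OF nn(3)] by blast
  have fin: "finite S0" "finite S1" "finite S2" using S0(1) S1(1) S2(1) finite_subset finite_verts by blast+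
  let ?S = "S0 \<union> sx (n + m) ` S1 \<union> sy (n + m) ` S2"
  have "card ?S \<le> card S0 + card (sx (n + m) ` S1) + card (sy (n + m) ` S2)"
    by (meson add_le_mono1 card_Un_le le_trans)
  also have "\<dots> \<le> card S0 + card S1 + card S2" using fin by (intro add_mono card_image_le) auto
  also have "\<dots> \<le> bad_sites n good (Suc m) v" using S0(2) S1(2) S2(2) by simp
  finally have "card ?S \<le> bad_sites n good (Suc m) v" .
  moreover have "?S \<subseteq> verts (n + Suc m)" using S0(1) S1(1) S2(1) unfolding add_Suc_right verts_Suc by blast
  moreover have "form_above E (n + Suc m) v f" if "\<forall>a\<in>?S. f a = 0" for f
  proof -
    have z: "a \<in> S0 \<Longrightarrow> f a = 0" "a \<in> S1 \<Longrightarrow> f (sx (n + m) a) = 0" "a \<in> S2 \<Longrightarrow> f (sy (n + m) a) = 0" for a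
      using that by blast+
    show ?thesis unfolding add_Suc_right
      by (rule form_above_Suc[OF S0(3)[rule_format, of f] S1(3)[rule_format, of "\<lambda>a. f (sx (n + m) a)"]
        S2(3)[rule_format, of "\<lambda>a. f (sy (n + m) a)"]]) (simp_all only: z)
  qed
  ultimately show ?case by blast
qed

text \<open>Vanishing at the bad sites is a high family. The origin gets weight 1/2 from each half
  and so full weight; the far corners lack one half, and their surplus term in
  \<open>qform_H_kernel\<close> pays for it as long as E is at most 4.\<close>

lemma ball_count_le_bad_sites:
  assumes good: "\<And>v f. (\<And>a. a \<in> verts n \<Longrightarrow> 0 \<le> v a) \<Longrightarrow> good v \<Longrightarrow> form_above E n v f"
    and v: "\<And>x. x \<in> ballL (n + m) \<Longrightarrow> 0 \<le> v x" and E: "E \<le> 4"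
  shows "ball_count (n + m) E v \<le> bad_sites n good m (\<lambda>a. v (em a)) + bad_sites n good m (\<lambda>a. v (mirror (em a)))"
proof -
  let ?L = "n + m" and ?em' = "\<lambda>a. mirror (em a)"
  have v': "0 \<le> v (em a)" "0 \<le> v (mirror (em a))" if "a \<in> verts ?L" for a
    using v that unfolding ballL_eq by blast+
  obtain S where S: "S \<subseteq> verts ?L" "card S \<le> bad_sites n good m (\<lambda>a. v (em a))"
    "\<forall>f. (\<forall>a\<in>S. f a = 0) \<longrightarrow> form_above E ?L (\<lambda>a. v (em a)) f"
    using bad_sites_set[of n good E m "\<lambda>a. v (em a)", OF good v'(1)] by blast
  obtain S' where S': "S' \<subseteq> verts ?L" "card S' \<le> bad_sites n good m (\<lambda>a. v (mirror (em a)))"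
    "\<forall>f. (\<forall>a\<in>S'. f a = 0) \<longrightarrow> form_above E ?L (\<lambda>a. v (mirror (em a))) f"
    using bad_sites_set[of n good E m "\<lambda>a. v (mirror (em a))", OF good v'(2)] by blast
  have fin: "finite S" "finite S'" using S(1) S'(1) finite_subset finite_verts by blast+
  let ?J = "em ` S \<union> ?em' ` S'"
  have J: "finite ?J" "?J \<subseteq> ballL ?L" using fin S(1) S'(1) unfolding ballL_eq by auto
  have "high_family E (qform (H_kernel v) (ballL ?L)) (ballL ?L) ?J (\<lambda>j x. if x = j then 1 else 0)"
    unfolding high_family_def
  proof (intro allI impI)
    fix f :: "pt \<Rightarrow> real"
    assume nz: "\<exists>x\<in>ballL ?L. f x \<noteq> 0" and 0: "\<forall>j\<in>?J. (\<Sum>x\<in>ballL ?L. (if x = j then 1 else 0) * f x) = 0"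
    have fJ: "f j = 0" if "j \<in> ?J" for j
    proof -
      have "(\<Sum>x\<in>ballL ?L. (if x = j then 1 else 0) * f x) = (\<Sum>x\<in>ballL ?L. if x = j then f j else 0)"
        by (rule sum.cong) auto
      also have "\<dots> = f j" using that J(2) by auto
      finally show ?thesis using 0 that by simp
    qed
    have 1: "form_above E ?L (\<lambda>a. v (em a)) (\<lambda>a. f (em a))" by (rule S(3)[rule_format, of "\<lambda>a. f (em a)"], rule fJ, blast)
    have 2: "form_above E ?L (\<lambda>a. v (mirror (em a))) (\<lambda>a. f (mirror (em a)))" by (rule S'(3)[rule_format, of "\<lambda>a. f (mirror (em a))"], rule fJ, blast)
    have nz': "(\<exists>a\<in>verts ?L. f (em a) \<noteq> 0) \<or> (\<exists>a\<in>verts ?L. f (mirror (em a)) \<noteq> 0)"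
      using nz unfolding ballL_eq by blast
    define q where "q = (f (em (2 ^ ?L, 0)))\<^sup>2 + (f (em (0, 2 ^ ?L)))\<^sup>2 + (f (mirror (em (2 ^ ?L, 0))))\<^sup>2 + (f (mirror (em (0, 2 ^ ?L))))\<^sup>2"
    have ws: "wsum ?L (\<lambda>a. g (em a)) + wsum ?L (\<lambda>a. g (mirror (em a)))
      = (\<Sum>x\<in>ballL ?L. g x) - (g (em (2 ^ ?L, 0)) + g (em (0, 2 ^ ?L)) + g (mirror (em (2 ^ ?L, 0))) + g (mirror (em (0, 2 ^ ?L)))) / 2" for g :: "pt \<Rightarrow> real"
      unfolding wsum_eq sum_ballL sum_corners origin_em(1)[symmetric] by (simp add: mirror_origin field_simps)
    have vc: "0 \<le> v (em (2 ^ ?L, 0))" "0 \<le> v (em (0, 2 ^ ?L))" "0 \<le> v (mirror (em (2 ^ ?L, 0)))" "0 \<le> v (mirror (em (0, 2 ^ ?L)))"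
      by (rule v', simp)+
    have "0 \<le> v (em (2 ^ ?L, 0)) * (f (em (2 ^ ?L, 0)))\<^sup>2 + v (em (0, 2 ^ ?L)) * (f (em (0, 2 ^ ?L)))\<^sup>2
        + v (mirror (em (2 ^ ?L, 0))) * (f (mirror (em (2 ^ ?L, 0))))\<^sup>2 + v (mirror (em (0, 2 ^ ?L))) * (f (mirror (em (0, 2 ^ ?L))))\<^sup>2"
      using vc by simp
    then have V: "wsum ?L (\<lambda>a. v (em a) * (f (em a))\<^sup>2) + wsum ?L (\<lambda>a. v (mirror (em a)) * (f (mirror (em a)))\<^sup>2) \<le> (\<Sum>x\<in>ballL ?L. v x * (f x)\<^sup>2)"
      using ws[of "\<lambda>x. v x * (f x)\<^sup>2"] by simp
    have N: "wsum ?L (\<lambda>a. (f (em a))\<^sup>2) + wsum ?L (\<lambda>a. (f (mirror (em a)))\<^sup>2) = (\<Sum>x\<in>ballL ?L. (f x)\<^sup>2) - q / 2"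
      using ws[of "\<lambda>x. (f x)\<^sup>2"] by (simp add: q_def)
    have "E * (wsum ?L (\<lambda>a. (f (em a))\<^sup>2) + wsum ?L (\<lambda>a. (f (mirror (em a)))\<^sup>2))
       < energy ?L (\<lambda>a. f (em a)) + energy ?L (\<lambda>a. f (mirror (em a)))
         + (wsum ?L (\<lambda>a. v (em a) * (f (em a))\<^sup>2) + wsum ?L (\<lambda>a. v (mirror (em a)) * (f (mirror (em a)))\<^sup>2))"
      using nz' 1 2 unfolding form_above_def distrib_left by (elim disjE) linarith+
    then have *: "E * ((\<Sum>x\<in>ballL ?L. (f x)\<^sup>2) - q / 2) < energy ?L (\<lambda>a. f (em a)) + energy ?L (\<lambda>a. f (mirror (em a))) + (\<Sum>x\<in>ballL ?L. v x * (f x)\<^sup>2)"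
      unfolding N using V by linarith
    \<comment> \<open>The missing half weight costs \<open>E * (q / 2)\<close>, while the form
      contains the boundary term \<open>2 * q\<close>.\<close>
    have "E * (q / 2) \<le> 4 * (q / 2)" by (rule mult_right_mono[OF E]) (simp add: q_def)
    then show "E * (\<Sum>x\<in>ballL ?L. (f x)\<^sup>2) < qform (H_kernel v) (ballL ?L) f"
      unfolding qform_def qform_H_kernel q_def[symmetric] using * by (simp add: right_diff_distrib)
  qed
  from eig_count_le[where K = "H_kernel v", OF finite_ballL H_kernel_sym J(1) this]
  have "ball_count ?L E v \<le> card ?J" by (simp add: ball_count_def)
  also have "\<dots> \<le> card (em ` S) + card (?em' ` S')" by (rule card_Un_le)
  also have "\<dots> \<le> card S + card S'" using fin by (intro add_mono card_image_le) auto
  also have "\<dots> \<le> bad_sites n good m (\<lambda>a. v (em a)) + bad_sites n good m (\<lambda>a. v (mirror (em a)))" by (intro add_mono S(2) S'(2))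
  finally show ?thesis .
qed

section \<open>The Lifshitz tail\<close>

lemma cells_subset_verts: "cells n \<subseteq> verts n"
  using cell_verts_mem by blast

lemma card_verts_le: "card (verts n) \<le> 3 * 3 ^ n"
proof -
  have "1 \<le> (3::nat) ^ n" by simp
  then show ?thesis using card_verts[of n] unfolding power_Suc by linarith
qed

text \<open>The two bounds differ by constants and one factor ln(1/E), which is lost after the
  second logarithm. Since ln E is negative, division by it exchanges the bounds.\<close>

lemma loglog_limit:
  fixes y :: "real \<Rightarrow> real"
  assumes "0 < \<alpha>" "0 < h" "0 < \<kappa>" "0 \<le> D"
    and lower: "\<forall>\<^sub>F E in at_right 0. h * E powr (- \<alpha>) - ln 2 \<le> y E"
    and upper: "\<forall>\<^sub>F E in at_right 0. y E \<le> ln (9 / 2) + (30 / E) powr \<alpha> * (1 + 9 * (\<kappa> * ln (2 / E) + D))"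
  shows "((\<lambda>E. ln (y E) / ln E) \<longlongrightarrow> - \<alpha>) (at_right 0)"
proof (rule tendsto_sandwich)
  have low1: "\<forall>\<^sub>F E in at_right 0. 0 < h * E powr (- \<alpha>) - ln 2"
    using assms(1,2) by real_asymp
  have small: "\<forall>\<^sub>F E in at_right 0. E < (1::real)" by real_asymp
  have small': "\<forall>\<^sub>F E in at_right 0. E > (0::real)" by (rule eventually_at_right_less)
  show "\<forall>\<^sub>F E in at_right 0. ln (ln (9 / 2) + (30 / E) powr \<alpha> * (1 + 9 * (\<kappa> * ln (2 / E) + D))) / ln E \<le> ln (y E) / ln E"
    using lower upper low1 small small'
  proof eventually_elim
    case (elim E)
    then have "ln (y E) \<le> ln (ln (9 / 2) + (30 / E) powr \<alpha> * (1 + 9 * (\<kappa> * ln (2 / E) + D)))" by simp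
    then show ?case using elim by (intro divide_right_mono_neg) simp_all
  qed
  show "\<forall>\<^sub>F E in at_right 0. ln (y E) / ln E \<le> ln (h * E powr (- \<alpha>) - ln 2) / ln E"
    using lower low1 small small'
  proof eventually_elim
    case (elim E)
    then have "ln (h * E powr (- \<alpha>) - ln 2) \<le> ln (y E)" by simp
    then show ?case using elim by (intro divide_right_mono_neg) simp_all
  qed
  show "((\<lambda>E. ln (h * E powr (- \<alpha>) - ln 2) / ln E) \<longlongrightarrow> - \<alpha>) (at_right 0)"
    using assms(1,2) by real_asymp
  show "((\<lambda>E. ln (ln (9 / 2) + (30 / E) powr \<alpha> * (1 + 9 * (\<kappa> * ln (2 / E) + D))) / ln E) \<longlongrightarrow> - \<alpha>) (at_right 0)"
    using assms(1-4) by real_asymp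
qed

text \<open>A point off the support has a null neighbourhood, which can be shrunk to a rational
  interval; countably many of these cover the negative half line.\<close>

lemma supp_measure_nonneg:
  assumes P: "prob_space P" "sets P = sets borel" and supp: "supp_measure P \<subseteq> {0..}"
  shows "measure P {..<0} = 0"
proof -
  interpret prob_space P by (rule P(1))
  define I where "I = {q \<in> \<rat> \<times> \<rat>. measure P {fst q<..<snd q} = 0}"
  have "countable I" unfolding I_def by (intro countable_Collect countable_SIGMA countable_rat)
  moreover have "{fst q<..<snd q} \<in> null_sets P" if "q \<in> I" for q
    using that P(2) by (auto simp: I_def null_sets_def emeasure_eq_measure)
  ultimately have N: "(\<Union>q\<in>I. {fst q<..<snd q}) \<in> null_sets P" by (rule null_sets_UN')
  have "{..<0} \<subseteq> (\<Union>q\<in>I. {fst q<..<snd q})"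
  proof
    fix x :: real assume "x \<in> {..<0}"
    then have "x \<notin> supp_measure P" using supp by auto
    then obtain e where e: "e > 0" "\<not> measure P {x - e<..<x + e} > 0"
      unfolding supp_measure_def by blast
    then have e: "e > 0" "measure P {x - e<..<x + e} = 0"
      using measure_nonneg[of P "{x - e<..<x + e}"] by linarith+
    obtain a where a: "a \<in> \<rat>" "x - e < a" "a < x" using Rats_dense_in_real[of "x - e" x] e(1) by auto
    obtain b where b: "b \<in> \<rat>" "x < b" "b < x + e" using Rats_dense_in_real[of x "x + e"] e(1) by auto
    have "measure P {a<..<b} \<le> measure P {x - e<..<x + e}"
      by (rule finite_measure_mono) (use a b P(2) in auto)
    then have "(a, b) \<in> I" using a b e(2) measure_nonneg[of P "{a<..<b}"] by (auto simp: I_def)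
    then show "x \<in> (\<Union>q\<in>I. {fst q<..<snd q})" using a b by force
  qed
  then have "measure P {..<0} \<le> measure P (\<Union>q\<in>I. {fst q<..<snd q})"
    by (rule finite_measure_mono) (use N in auto)
  also have "\<dots> = 0" using N by (simp add: measure_eq_0_null_sets)
  finally show ?thesis using measure_nonneg[of P "{..<0}"] by simp
qed

text \<open>If all tails were null, so would be the positive half line, and all mass would sit at 0.
  This fixes the level \<epsilon> that defines good cells.\<close>

lemma positive_tail:
  fixes P :: "real measure"
  assumes P: "prob_space P" "sets P = sets borel" and null: "measure P {..<0} = 0" and ne: "measure P {0} \<noteq> 1"
  shows "\<exists>\<epsilon>>0. measure P {\<epsilon>..} > (0::real)"
proof (rule ccontr)
  interpret prob_space P by (rule P(1))
  assume neg: "\<not> ?thesis"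
  have z: "measure P {1 / real (Suc k)..} = 0" for k
  proof -
    have "0 < 1 / real (Suc k)" by simp
    then have "\<not> 0 < measure P {1 / real (Suc k)..}" using neg by blast
    then show ?thesis using measure_nonneg[of P "{1 / real (Suc k)..}"] by linarith
  qed
  have N: "(\<Union>k. {1 / real (Suc k)..}) \<in> null_sets P"
    by (rule null_sets_UN) (use z P(2) in \<open>auto simp: null_sets_def emeasure_eq_measure\<close>)
  have "{0<..} \<subseteq> (\<Union>k. {1 / real (Suc k)..})"
  proof
    fix x :: real assume "x \<in> {0<..}"
    then obtain k where "1 / real (Suc k) < x" using nat_approx_posE[of x] by auto
    then show "x \<in> (\<Union>k. {1 / real (Suc k)..})" by (intro UN_I[of k]) auto
  qed
  then have N': "{0<..} \<in> null_sets P" by (rule null_sets_subset[OF N, rotated]) (simp add: P(2))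
  have N0: "{..<0} \<in> null_sets P" using null P(2) by (auto simp: null_sets_def emeasure_eq_measure)
  have sp: "space P = UNIV" using sets_eq_imp_space_eq[OF P(2)] by simp
  have "AE x in P. x \<in> {0}"
    using AE_not_in[OF N'] AE_not_in[OF N0] by eventually_elim auto
  then have "measure P {0} = 1" using P(2) by (subst prob_eq_1) auto
  with ne show False by simp
qed

section \<open>Probabilistic bounds on both sides of the tail\<close>

context anderson
begin

lemma P0_distr: "\<exists>x. x \<in> sier_V \<and> P0 = distr M borel (V x)"
  using distr_V[of "em (0, 0)"] sier_V_emb(1)[OF corner_in_verts(1)[of 0]] by metis

lemma prob_space_P0: "prob_space P0" and sets_P0: "sets P0 = sets borel"
  using P0_distr meas_V prob_space_distr by auto

lemma prob_V: "x \<in> sier_V \<Longrightarrow> A \<in> sets borel \<Longrightarrow> prob {\<omega> \<in> space M. V x \<omega> \<in> A} = measure P0 A"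
  using measure_distr[of "V x" M borel A] meas_V[of x] distr_V[of x] by (simp add: vimage_def Int_def conj_commute)

lemma AE_V_nonneg:
  assumes "measure P0 {..<0} = 0"
  shows "AE \<omega> in M. \<forall>x\<in>ballL L. 0 \<le> V x \<omega>"
proof (subst AE_finite_all[OF finite_ballL])
  show "\<forall>x\<in>ballL L. AE \<omega> in M. 0 \<le> V x \<omega>"
  proof
    fix x assume "x \<in> ballL L"
    then have x: "x \<in> sier_V" using ballL_subset_sier_V by blast
    note [measurable] = meas_V[OF x]
    have "{\<omega> \<in> space M. V x \<omega> \<in> {..<0}} \<in> null_sets M"
      using prob_V[OF x, of "{..<0}"] assms by (simp add: null_sets_def emeasure_eq_measure)
    from AE_not_in[OF this] show "AE \<omega> in M. 0 \<le> V x \<omega>" by (rule AE_mp) (auto intro!: AE_I2)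
  qed
qed

lemma measurable_good_cell:
  assumes "placement n g"
  shows "{\<omega> \<in> space M. \<not> good_cell n \<delta> \<epsilon> (\<lambda>a. V (g a) \<omega>)} \<in> sets M"
proof -
  have m: "V (g t) \<in> borel_measurable M" if "t \<in> cells n" for t
    by (rule meas_V) (use assms that cells_subset_verts in \<open>auto simp: placement_def\<close>)
  have "real (card {t \<in> cells n. \<epsilon> \<le> V (g t) \<omega>}) = (\<Sum>t\<in>cells n. indicator {\<epsilon>..} (V (g t) \<omega>))" for \<omega>
    by (simp add: indicator_def sum.If_cases Int_def)
  moreover have "(\<lambda>\<omega>. \<Sum>t\<in>cells n. indicator {\<epsilon>..} (V (g t) \<omega>) :: real) \<in> borel_measurable M"
    by (intro borel_measurable_sum) (rule measurable_compose[OF m], simp_all add: borel_measurable_indicator)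
  ultimately show ?thesis unfolding good_cell_def by simp
qed

text \<open>Hoeffding for \<open>3 ^ n\<close> independent indicators of mean p: the density p/2 in
  \<open>good_cell\<close> is half the mean, and a deviation of p * 3^n / 2 gives the exponent 2 (p
  * 3^n / 2)^2 / 3^n.\<close>

lemma prob_bad_cell:
  assumes g: "placement n g" and p: "p = measure P0 {\<epsilon>..}" "0 < p"
  shows "prob {\<omega> \<in> space M. \<not> good_cell n (p / 2) \<epsilon> (\<lambda>a. V (g a) \<omega>)} \<le> exp (- (p\<^sup>2 / 2) * 3 ^ n)"
proof -
  define X where "X t \<omega> = (indicator {\<epsilon>..} (V (g t) \<omega>) :: real)" for t \<omega>
  have gV: "g t \<in> sier_V" if "t \<in> cells n" for t
    using g that subsetD[OF cells_subset_verts that] by (simp add: placement_def image_subset_iff)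
  have "indep_vars (\<lambda>_. borel) (\<lambda>t. V (g t)) (cells n)"
  proof (rule indep_reindex)
    show "inj_on g (cells n)" by (rule inj_on_subset[OF _ cells_subset_verts]) (use g in \<open>simp add: placement_def\<close>)
  qed (use gV in blast)
  then have ind: "indep_vars (\<lambda>_. borel) X (cells n)"
    unfolding X_def[abs_def] by (rule indep_vars_compose2) auto
  have EX: "expectation (X t) = p" if "t \<in> cells n" for t
  proof -
    have "expectation (X t) = expectation (indicator {\<omega> \<in> space M. V (g t) \<omega> \<in> {\<epsilon>..}})"
      by (rule Bochner_Integration.integral_cong) (auto simp: X_def indicator_def)
    also have "\<dots> = prob {\<omega> \<in> space M. V (g t) \<omega> \<in> {\<epsilon>..}}"
    proof -
      note [measurable] = meas_V[OF gV[OF that]]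
      have "{\<omega> \<in> space M. V (g t) \<omega> \<in> {\<epsilon>..}} \<in> sets M" by measurable
      then show ?thesis by (simp add: Int_absorb2 sets.sets_into_space)
    qed
    also have "\<dots> = p" using prob_V[OF gV[OF that], of "{\<epsilon>..}"] p by simp
    finally show ?thesis .
  qed
  interpret H: Hoeffding_ineq M "cells n" X "\<lambda>_. 0" "\<lambda>_. 1" "\<Sum>t\<in>cells n. expectation (X t)"
    by unfold_locales (auto simp: ind X_def indicator_def)
  have mu: "(\<Sum>t\<in>cells n. expectation (X t)) = p * 3 ^ n" using EX by (simp add: card_cells)
  have "prob {\<omega> \<in> space M. \<not> good_cell n (p / 2) \<epsilon> (\<lambda>a. V (g a) \<omega>)}
     \<le> prob {\<omega> \<in> space M. (\<Sum>t\<in>cells n. X t \<omega>) \<le> p * 3 ^ n - p * 3 ^ n / 2}"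
  proof (rule finite_measure_mono)
    have "(\<Sum>t\<in>cells n. X t \<omega>) = real (card {t \<in> cells n. \<epsilon> \<le> V (g t) \<omega>})" for \<omega>
      by (simp add: X_def indicator_def sum.If_cases Int_def)
    then show "{\<omega> \<in> space M. \<not> good_cell n (p / 2) \<epsilon> (\<lambda>a. V (g a) \<omega>)}
      \<subseteq> {\<omega> \<in> space M. (\<Sum>t\<in>cells n. X t \<omega>) \<le> p * 3 ^ n - p * 3 ^ n / 2}"
      by (auto simp: good_cell_def)
    have "(\<lambda>\<omega>. \<Sum>t\<in>cells n. X t \<omega>) \<in> borel_measurable M"
      using ind unfolding indep_vars_def by (intro borel_measurable_sum) blast
    then show "{\<omega> \<in> space M. (\<Sum>t\<in>cells n. X t \<omega>) \<le> p * 3 ^ n - p * 3 ^ n / 2} \<in> sets M" by measurable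
  qed
  also have "\<dots> \<le> exp (- 2 * (p * 3 ^ n / 2)\<^sup>2 / (\<Sum>t\<in>cells n. (1 - 0)\<^sup>2))"
    using H.Hoeffding_ineq_le[of "p * 3 ^ n / 2"] p(2) unfolding mu by (simp add: card_cells)
  also have "- 2 * (p * 3 ^ n / 2)\<^sup>2 / (\<Sum>t\<in>cells n. (1 - 0)\<^sup>2) = - (p\<^sup>2 / 2) * 3 ^ n"
    by (simp add: card_cells power2_eq_square)
  finally show ?thesis .
qed

text \<open>Expectations add along the recursion, with \<open>3 ^ m\<close> subcells contributing at
  most \<open>card (verts n) * \<beta>\<close> each. Integrability is carried along for the
  additions.\<close>

lemma expectation_bad_sites:
  fixes \<beta> :: real
  assumes bound: "\<And>g. placement n g \<Longrightarrow> prob {\<omega> \<in> space M. \<not> good_cell n \<delta> \<epsilon> (\<lambda>a. V (g a) \<omega>)} \<le> \<beta>"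
    and g: "placement (n + m) g"
  shows "integrable M (\<lambda>\<omega>. real (bad_sites n (good_cell n \<delta> \<epsilon>) m (\<lambda>a. V (g a) \<omega>))) \<and>
    expectation (\<lambda>\<omega>. real (bad_sites n (good_cell n \<delta> \<epsilon>) m (\<lambda>a. V (g a) \<omega>))) \<le> 3 ^ m * real (card (verts n)) * \<beta>"
  using g
proof (induct m arbitrary: g)
  case 0
  let ?A = "{\<omega> \<in> space M. \<not> good_cell n \<delta> \<epsilon> (\<lambda>a. V (g a) \<omega>)}"
  have g: "placement n g" using 0 by simp
  have A: "?A \<in> sets M" by (rule measurable_good_cell[OF g])
  have eq: "real (bad_sites n (good_cell n \<delta> \<epsilon>) 0 (\<lambda>a. V (g a) \<omega>)) = real (card (verts n)) * indicator ?A \<omega>" if "\<omega> \<in> space M" for \<omega>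
    using that by simp
  have "integrable M (\<lambda>\<omega>. real (card (verts n)) * indicator ?A \<omega>)"
    using A by (intro integrable_mult_right) (simp add: emeasure_eq_measure)
  moreover have "expectation (\<lambda>\<omega>. real (card (verts n)) * indicator ?A \<omega>) = card (verts n) * prob ?A"
    using A by (simp add: Int_absorb2 sets.sets_into_space)
  moreover have "real (card (verts n)) * prob ?A \<le> real (card (verts n)) * \<beta>" by (rule mult_left_mono[OF bound[OF g]]) simp
  moreover have "integrable M (\<lambda>\<omega>. real (bad_sites n (good_cell n \<delta> \<epsilon>) 0 (\<lambda>a. V (g a) \<omega>)))
     \<longleftrightarrow> integrable M (\<lambda>\<omega>. real (card (verts n)) * indicator ?A \<omega>)"
    by (rule Bochner_Integration.integrable_cong[OF refl eq])
  moreover have "expectation (\<lambda>\<omega>. real (bad_sites n (good_cell n \<delta> \<epsilon>) 0 (\<lambda>a. V (g a) \<omega>)))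
     = expectation (\<lambda>\<omega>. real (card (verts n)) * indicator ?A \<omega>)"
    by (rule Bochner_Integration.integral_cong[OF refl eq])
  ultimately show ?case by (simp only: power_0 mult_1)
next
  case (Suc m)
  have pl: "placement (n + m) g" "placement (n + m) (\<lambda>a. g (sx (n + m) a))" "placement (n + m) (\<lambda>a. g (sy (n + m) a))"
    using placement_shift[of "n + m" g 0] placement_shift[of "n + m" g "Suc 0"] placement_shift[of "n + m" g 2] Suc.prems by simp_all
  note h = Suc.hyps[OF pl(1)] Suc.hyps[OF pl(2)] Suc.hyps[OF pl(3)]
  show ?case using h by (auto simp: Bochner_Integration.integral_add)
qed

text \<open>The subcell level n stays fixed while L grows: per site the expected number of bad sites
  is at most twice the probability of a single bad cell, uniformly in L.\<close>

lemma ids_fixed_upper: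
  assumes neg: "measure P0 {..<0} = 0" and p: "p = measure P0 {\<epsilon>..}" "0 < p" and \<epsilon>: "0 < \<epsilon>"
    and E: "E \<le> p / 2 * min 1 \<epsilon> / 2000 * (1 / 5) ^ n"
  shows "ids_fixed E \<le> 2 * exp (- (p\<^sup>2 / 2) * 3 ^ n)"
proof (rule LIMSEQ_le_const2[OF mean_ball_density_LIMSEQ])
  let ?\<beta> = "exp (- (p\<^sup>2 / 2) * 3 ^ n)"
  interpret P: prob_space P0 by (rule prob_space_P0)
  have p1: "p \<le> 1" using p(1) by simp
  \<comment> \<open>Needed for the boundary term in \<open>ball_count_le_bad_sites\<close>.\<close>
  have E4: "E \<le> 4"
  proof -
    have "p / 2 * min 1 \<epsilon> / 2000 * (1 / 5) ^ n \<le> 1 * 1"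
    proof (rule mult_mono)
      have "p / 2 * min 1 \<epsilon> \<le> 1 * 1" by (rule mult_mono) (use p1 \<epsilon> in simp_all)
      then show "p / 2 * min 1 \<epsilon> / 2000 \<le> 1" by simp
    qed (auto intro: power_le_one)
    then show ?thesis using E by simp
  qed
  have good: "form_above E n v f" if "\<And>a. a \<in> verts n \<Longrightarrow> 0 \<le> v a" "good_cell n (p / 2) \<epsilon> v" for v f
  proof (cases "\<exists>a\<in>verts n. f a \<noteq> 0")
    case True
    show ?thesis unfolding form_above_def
      using good_cell_form[of "p / 2" \<epsilon> n v E f] that E \<epsilon> p(2) p1 True by (auto intro: less_imp_le)
  next
    case False
    then show ?thesis by (intro form_above_zero) blast
  qed
  have "mean_ball_density L E \<le> 2 * ?\<beta>" if Ln: "L \<ge> n" for L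
  proof -
    obtain m where L: "L = n + m" using le_Suc_ex[OF Ln] by blast
    let ?Z = "\<lambda>g \<omega>. real (bad_sites n (good_cell n (p / 2) \<epsilon>) m (\<lambda>a. V (g a) \<omega>))"
    have bnd: "prob {\<omega> \<in> space M. \<not> good_cell n (p / 2) \<epsilon> (\<lambda>a. V (g a) \<omega>)} \<le> ?\<beta>" if "placement n g" for g
      by (rule prob_bad_cell[OF that p])
    have Z1: "integrable M (?Z em) \<and> expectation (?Z em) \<le> 3 ^ m * real (card (verts n)) * ?\<beta>"
      by (rule expectation_bad_sites[OF bnd placement_em(1)])
    have Z2: "integrable M (?Z (\<lambda>a. mirror (em a))) \<and> expectation (?Z (\<lambda>a. mirror (em a))) \<le> 3 ^ m * real (card (verts n)) * ?\<beta>"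
      by (rule expectation_bad_sites[OF bnd placement_em(2)])
    have iZ: "integrable M (?Z em)" "integrable M (?Z (\<lambda>a. mirror (em a)))"
      and eZ: "expectation (?Z em) \<le> 3 ^ m * real (card (verts n)) * ?\<beta>"
        "expectation (?Z (\<lambda>a. mirror (em a))) \<le> 3 ^ m * real (card (verts n)) * ?\<beta>"
      using Z1 Z2 by (simp_all only:)
    have "expectation (\<lambda>\<omega>. real (ball_count L E (\<lambda>x. V x \<omega>))) \<le> expectation (\<lambda>\<omega>. ?Z em \<omega> + ?Z (\<lambda>a. mirror (em a)) \<omega>)"
    proof (rule integral_mono_AE[OF integrable_ball_count])
      show "integrable M (\<lambda>\<omega>. ?Z em \<omega> + ?Z (\<lambda>a. mirror (em a)) \<omega>)" by (rule Bochner_Integration.integrable_add[OF iZ])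
      show "AE \<omega> in M. real (ball_count L E (\<lambda>x. V x \<omega>)) \<le> ?Z em \<omega> + ?Z (\<lambda>a. mirror (em a)) \<omega>"
        using AE_V_nonneg[OF neg, of L]
      proof eventually_elim
        case (elim \<omega>)
        have "ball_count (n + m) E (\<lambda>x. V x \<omega>) \<le> bad_sites n (good_cell n (p / 2) \<epsilon>) m (\<lambda>a. V (em a) \<omega>)
            + bad_sites n (good_cell n (p / 2) \<epsilon>) m (\<lambda>a. V (mirror (em a)) \<omega>)"
        proof (rule ball_count_le_bad_sites[OF good _ E4])
          show "0 \<le> V x \<omega>" if "x \<in> ballL (n + m)" for x using elim that unfolding L by blast
        qed
        then show ?case unfolding L by (simp only: of_nat_add[symmetric] of_nat_le_iff)
      qed
    qed
    also have "\<dots> = expectation (?Z em) + expectation (?Z (\<lambda>a. mirror (em a)))"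
      by (rule Bochner_Integration.integral_add[OF iZ])
    also have "\<dots> \<le> 2 * (3 ^ m * real (card (verts n)) * ?\<beta>)" unfolding mult_2 by (rule add_mono[OF eZ])
    also have "\<dots> \<le> 2 * (3 ^ m * (3 * 3 ^ n) * ?\<beta>)"
    proof -
      have "real (card (verts n)) \<le> 3 * 3 ^ n"
        using of_nat_mono[OF card_verts_le[of n], where 'a = real] by simp
      then show ?thesis by (intro mult_left_mono mult_right_mono) auto
    qed
    also have "\<dots> = 2 * ?\<beta> * 3 ^ Suc L" unfolding L by (simp add: power_add)
    also have "\<dots> \<le> 2 * ?\<beta> * real (card (ballL L))" unfolding card_ballL by (intro mult_left_mono) auto
    finally have "expectation (\<lambda>\<omega>. real (ball_count L E (\<lambda>x. V x \<omega>))) \<le> 2 * ?\<beta> * real (card (ballL L))" .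
    moreover have "0 < real (card (ballL L))" unfolding card_ballL of_nat_0_less_iff by simp
    ultimately show ?thesis unfolding mean_ball_density_def by (simp only: pos_divide_le_eq)
  qed
  then show "\<exists>N. \<forall>L\<ge>N. mean_ball_density L E \<le> 2 * ?\<beta>" by blast
qed

text \<open>Superadditivity of the Dirichlet counts makes the normalised means increasing.\<close>

lemma cell_mean_le_limit: "2 / 3 * (cell_mean k E / 3 ^ k) \<le> ids_fixed E"
proof -
  have "incseq (\<lambda>n. cell_mean n E / 3 ^ n)"
    by (rule incseq_SucI) (use cell_mean_Suc(1) in \<open>simp add: field_simps\<close>)
  from incseq_le[OF this cell_mean_LIMSEQ, of k] show ?thesis unfolding ids_fixed_def by simp
qed

text \<open>With probability at least q to the number of inner sites the potential is at most
  \<epsilon> throughout one cell, and then the test function gives an eigenvalue below E.\<close>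

lemma ids_fixed_lower:
  assumes \<epsilon>: "3 * (1 / 5) ^ n + \<epsilon> \<le> E" and q: "0 \<le> q" "q \<le> measure P0 {0..\<epsilon>}"
  shows "2 / 3 * (q ^ (9 * 3 ^ n) / 3 ^ Suc n) \<le> ids_fixed E"
proof -
  let ?I = "inner_verts (Suc n)"
  interpret P: prob_space P0 by (rule prob_space_P0)
  have q1: "q \<le> 1" using q(2) P.prob_le_1 order_trans by blast
  have qe: "q \<le> measure P0 {..\<epsilon>}"
    using q(2) P.finite_measure_mono[of "{0..\<epsilon>}" "{..\<epsilon>}"] by (auto simp: sets_P0)
  define A where "A = {\<omega> \<in> space M. \<forall>a\<in>?I. V (em a) \<omega> \<le> \<epsilon>}"
  have emV: "em a \<in> sier_V" if "a \<in> ?I" for a using that inner_subset sier_V_emb(1) by blast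
  have A: "A \<in> sets M" unfolding A_def
  proof (rule sets.sets_Collect_finite_All[OF _ finite_inner_verts])
    fix a assume "a \<in> ?I"
    note [measurable] = meas_V[OF emV[OF this]]
    show "{\<omega> \<in> space M. V (em a) \<omega> \<le> \<epsilon>} \<in> sets M" by measurable
  qed
  have ne: "?I \<noteq> {}"
  proof
    assume e: "?I = {}"
    then have "verts (Suc n) \<subseteq> corners (Suc n)" by (auto simp: inner_verts_def)
    then have "card (verts (Suc n)) \<le> card (corners (Suc n))" by (intro card_mono) auto
    also have "\<dots> \<le> 3" by (simp add: corners_def card_insert_if)
    finally have "2 * card (verts (Suc n)) \<le> 6" by simp
    moreover have "1 \<le> (3::nat) ^ n" by simp
    ultimately show False using card_verts[of "Suc n"] unfolding power_Suc by linarith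
  qed
  have "indep_vars (\<lambda>_. borel) (\<lambda>a. V (em a)) ?I"
    by (rule indep_reindex) (use emV placement_inner[OF placement_em(1)] in auto)
  from indep_varsD[OF this ne finite_inner_verts order_refl, of "\<lambda>_. {..\<epsilon>}"]
  have "prob (\<Inter>a\<in>?I. V (em a) -` {..\<epsilon>} \<inter> space M) = (\<Prod>a\<in>?I. prob (V (em a) -` {..\<epsilon>} \<inter> space M))" by simp
  also have "(\<Inter>a\<in>?I. V (em a) -` {..\<epsilon>} \<inter> space M) = A" using ne by (auto simp: A_def)
  also have "(\<Prod>a\<in>?I. prob (V (em a) -` {..\<epsilon>} \<inter> space M)) = (\<Prod>a\<in>?I. measure P0 {..\<epsilon>})"
  proof (rule prod.cong[OF refl])
    fix a assume "a \<in> ?I"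
    have "V (em a) -` {..\<epsilon>} \<inter> space M = {\<omega> \<in> space M. V (em a) \<omega> \<in> {..\<epsilon>}}" by auto
    then show "prob (V (em a) -` {..\<epsilon>} \<inter> space M) = measure P0 {..\<epsilon>}" using prob_V[OF emV[OF \<open>a \<in> ?I\<close>], of "{..\<epsilon>}"] by simp
  qed
  finally have PA: "prob A = measure P0 {..\<epsilon>} ^ card ?I" by simp
  have "card ?I \<le> card (verts (Suc n))" by (rule card_mono[OF finite_verts inner_subset])
  \<comment> \<open>A level-(n+1) cell has at most 3 * 3^(n+1) vertices; since q \<le> 1,
    overestimating the exponent only lowers the bound.\<close>
  also have "\<dots> \<le> 9 * 3 ^ n" using card_verts_le[of "Suc n"] by simp
  finally have "q ^ (9 * 3 ^ n) \<le> q ^ card ?I" using q q1 by (intro power_decreasing) auto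
  also have "\<dots> \<le> prob A" unfolding PA by (rule power_mono[OF qe q(1)])
  also have "prob A = expectation (indicator A)" using A by (simp add: Int_absorb2 sets.sets_into_space)
  also have "\<dots> \<le> expectation (cell_rv (Suc n) E em)"
  proof (rule integral_mono)
    show "integrable M (indicator A :: 'a \<Rightarrow> real)" using A by (simp add: emeasure_eq_measure)
    show "integrable M (cell_rv (Suc n) E em)" by (rule integrable_cell_rv[OF placement_em(1)])
    show "indicator A \<omega> \<le> cell_rv (Suc n) E em \<omega>" for \<omega>
    proof (cases "\<omega> \<in> A")
      case True
      then have "1 \<le> cell_count (Suc n) E (\<lambda>a. V (em a) \<omega>)"
        by (intro cell_count_pos[OF \<epsilon>]) (auto simp: A_def)
      then show ?thesis using True by (simp add: cell_rv_def)
    next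
      case False
      then show ?thesis using cell_rv_bound(1) by simp
    qed
  qed
  finally have "q ^ (9 * 3 ^ n) \<le> cell_mean (Suc n) E" by (simp add: cell_mean_def)
  then have "2 / 3 * (q ^ (9 * 3 ^ n) / 3 ^ Suc n) \<le> 2 / 3 * (cell_mean (Suc n) E / 3 ^ Suc n)"
    by (intro mult_left_mono divide_right_mono) auto
  also have "\<dots> \<le> ids_fixed E" by (rule cell_mean_le_limit)
  finally show ?thesis .
qed

text \<open>Both bounds hold along scales of order 5^(-n). A general E is bracketed between
  consecutive scales, and \<open>\<alpha>\<close> is the exponent that turns 5^n into 3^n.\<close>

theorem lifshitz_tail:
  assumes supp: "supp_measure P0 \<noteq> {}" "bdd_below (supp_measure P0)" "Inf (supp_measure P0) = 0"
    and ne: "\<not> (\<exists>c. measure P0 {c} = 1)"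
    and C: "0 < C" "0 < \<kappa>" "\<forall>\<^sub>F \<epsilon> in at_right 0. C * \<epsilon> powr \<kappa> \<le> measure P0 {0..\<epsilon>}"
  shows "((\<lambda>E. ln \<bar>ln (ids E)\<bar> / ln E) \<longlongrightarrow> - ln 3 / ln 5) (at_right 0)"
proof -
  define \<alpha> :: real where "\<alpha> = ln 3 / ln 5"
  have \<alpha>: "0 < \<alpha>" by (simp add: \<alpha>_def)
  have pow: "(5 ^ n) powr \<alpha> = 3 ^ n" for n :: nat
  proof -
    have "5 powr \<alpha> = 3" unfolding \<alpha>_def by (simp add: powr_def)
    moreover have "(5 ^ n) powr \<alpha> = (5 powr \<alpha>) ^ n"
      by (simp add: powr_realpow[symmetric] powr_powr mult.commute)
    ultimately show ?thesis by simp
  qed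
  have bracket: "\<exists>n::nat. 5 ^ n < x \<and> x \<le> 5 ^ Suc n" if x: "1 < x" for x :: real
  proof -
    obtain k0 where "x < 5 ^ k0" using real_arch_pow[of 5 x] by auto
    then have ex: "\<exists>k. x \<le> 5 ^ k" by (intro exI[of _ k0]) simp
    define k where "k = (LEAST k::nat. x \<le> 5 ^ k)"
    have k: "x \<le> 5 ^ k" unfolding k_def by (rule LeastI_ex[OF ex])
    then obtain n where n: "k = Suc n" using x by (cases k) auto
    have "\<not> x \<le> 5 ^ n" by (rule not_less_Least) (simp add: k_def[symmetric] n)
    then show ?thesis using k n by (intro exI[of _ n]) simp
  qed
  have "supp_measure P0 \<subseteq> {0..}" using cInf_lower[OF _ supp(2)] supp(3) by auto
  then have neg: "measure P0 {..<0} = 0" by (rule supp_measure_nonneg[OF prob_space_P0 sets_P0])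
  have "measure P0 {0} \<noteq> 1" using ne by blast
  from positive_tail[OF prob_space_P0 sets_P0 neg this] obtain \<epsilon> where \<epsilon>: "0 < \<epsilon>" "0 < measure P0 {\<epsilon>..}" by blast
  define p where "p = measure P0 {\<epsilon>..}"
  define c where "c = p / 2 * min 1 \<epsilon> / 2000"
  have p: "0 < p" using \<epsilon>(2) by (simp add: p_def)
  have c: "0 < c" using p \<epsilon>(1) by (simp add: c_def)
  \<comment> \<open>One third of the Hoeffding rate p^2 / 2, because bracketing controls
    \<open>3 ^ Suc n\<close> while the estimate has \<open>3 ^ n\<close>.\<close>
  define h where "h = p\<^sup>2 / 6 * c powr \<alpha>"
  have h: "0 < h" using p c by (simp add: h_def)
  have upper: "ids E \<le> 2 * exp (- (h * E powr (- \<alpha>)))" if E: "0 < E" "E < c" for E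
  proof -
    have "1 < c / E" using E by simp
    \<comment> \<open>The coarsest usable scale: c 5^(-n) is still strictly above E, and strictness
      is what \<open>ids_le\<close> needs to return from the right limit to
      \<open>ids_fixed\<close>.\<close>
    then obtain n where n: "5 ^ n < c / E" "c / E \<le> 5 ^ Suc n" using bracket by blast
    have "E < c * (1 / 5) ^ n" using n(1) E(1) by (simp add: field_simps power_divide)
    from ids_le[OF this] have "ids E \<le> ids_fixed (c * (1 / 5) ^ n)" .
    also have "\<dots> \<le> 2 * exp (- (p\<^sup>2 / 2) * 3 ^ n)"
      by (rule ids_fixed_upper[OF neg p_def p \<epsilon>(1)]) (simp add: c_def)
    also have "\<dots> \<le> 2 * exp (- (h * E powr (- \<alpha>)))"
    proof -
      have "c powr \<alpha> * E powr (- \<alpha>) = (c / E) powr \<alpha>" using c E by (simp add: powr_divide powr_minus_divide)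
      also have "\<dots> \<le> (5 ^ Suc n) powr \<alpha>" using n(2) \<alpha> c E by (intro powr_mono2) auto
      also have "\<dots> = 3 ^ Suc n" by (rule pow)
      finally have "p\<^sup>2 / 6 * (c powr \<alpha> * E powr (- \<alpha>)) \<le> p\<^sup>2 / 6 * 3 ^ Suc n" by (rule mult_left_mono) simp
      then have "h * E powr (- \<alpha>) \<le> p\<^sup>2 / 2 * 3 ^ n" by (simp add: h_def mult_ac)
      then show ?thesis by simp
    qed
    finally show ?thesis .
  qed
  have pos_lower: "0 < ids E \<and> - ln (ids E) \<le> ln (9 / 2) + (30 / E) powr \<alpha> * (1 + 9 * (\<kappa> * ln (2 / E) + \<bar>ln C\<bar>))"
    if E: "0 < E" "E < 1" and q: "C * (E / 2) powr \<kappa> \<le> measure P0 {0..E / 2}" for E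
  proof -
    \<comment> \<open>E is split in halves: E/2 for the potential, and E/2 for 3 * 5^(-N), that is
      \<open>6 / E \<le> 5 ^ N\<close>. The minimal such scale overshoots by at most a factor 5,
      hence the 30.\<close>
    have "1 < 6 / E" using E by (simp add: field_simps)
    then obtain n where n: "5 ^ n < 6 / E" "6 / E \<le> 5 ^ Suc n" using bracket by blast
    define N where "N = Suc n"
    have N: "6 / E \<le> 5 ^ N" "5 ^ N \<le> 30 / E" using n by (simp_all add: N_def)
    define q where "q = C * (E / 2) powr \<kappa>"
    have q0: "0 < q" using C(1) E by (simp add: q_def)
    have "3 * (1 / 5) ^ N + E / 2 \<le> E" using N(1) E(1) by (simp add: field_simps power_divide)
    from ids_fixed_lower[OF this, of q] q q0
    have "2 / 3 * (q ^ (9 * 3 ^ N) / 3 ^ Suc N) \<le> ids_fixed E" by (simp add: q_def)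
    then have le: "2 / 3 * (q ^ (9 * 3 ^ N) / 3 ^ Suc N) \<le> ids E" using ids_ge[of E] by linarith
    have lp: "0 < 2 / 3 * (q ^ (9 * 3 ^ N) / 3 ^ Suc N)" using q0 by simp
    then have ip: "0 < ids E" using le by linarith
    have "ln (2 / 3 * (q ^ (9 * 3 ^ N) / 3 ^ Suc N)) \<le> ln (ids E)" using lp le ip by simp
    also have "ln (2 / 3 * (q ^ (9 * 3 ^ N) / 3 ^ Suc N)) = ln (2 / 9) + 9 * 3 ^ N * ln q - real N * ln 3"
    proof -
      have "2 / 3 * (q ^ (9 * 3 ^ N) / 3 ^ Suc N) = 2 / 9 * (q ^ (9 * 3 ^ N) / 3 ^ N)" by simp
      also have "ln \<dots> = ln (2 / 9) + (ln (q ^ (9 * 3 ^ N)) - ln (3 ^ N))"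
        using q0 by (subst ln_mult_pos) (simp_all add: ln_div)
      finally show ?thesis using q0 by (simp add: ln_realpow)
    qed
    finally have 1: "- ln (ids E) \<le> - ln (2 / 9) - 9 * 3 ^ N * ln q + real N * ln 3" by linarith
    \<comment> \<open>The normalisation by the volume costs N ln 3, which is absorbed into the main
      order \<open>3 ^ N\<close>; this is the 1 in the factor \<open>1 + 9 * ...\<close>.\<close>
    have "real N * ln 3 = ln (3 ^ N)" by (simp add: ln_realpow)
    also have "\<dots> \<le> 3 ^ N" using ln_le_minus_one[of "3 ^ N :: real"] by simp
    finally have 2: "real N * ln 3 \<le> 3 ^ N" .
    have "- ln q = \<kappa> * ln (2 / E) - ln C"
      unfolding q_def using C(1) E by (simp add: ln_mult_pos ln_powr ln_div algebra_simps)
    then have 3: "- ln q \<le> \<kappa> * ln (2 / E) + \<bar>ln C\<bar>" by linarith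
    have "3 ^ N = (5 ^ N) powr \<alpha>" by (rule pow[symmetric])
    also have "\<dots> \<le> (30 / E) powr \<alpha>" using N(2) \<alpha> by (intro powr_mono2) auto
    finally have 4: "3 ^ N \<le> (30 / E) powr \<alpha>" .
    have 5: "0 \<le> 1 + 9 * (\<kappa> * ln (2 / E) + \<bar>ln C\<bar>)" using C(2) E by (intro add_nonneg_nonneg mult_nonneg_nonneg) auto
    have "- ln (ids E) \<le> ln (9 / 2) + 3 ^ N * (1 + 9 * (- ln q))"
      using 1 2 ln_inverse[of "2 / 9 :: real"] by (simp add: algebra_simps)
    also have "\<dots> \<le> ln (9 / 2) + 3 ^ N * (1 + 9 * (\<kappa> * ln (2 / E) + \<bar>ln C\<bar>))"
      using 3 by (intro add_left_mono mult_left_mono) auto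
    also have "\<dots> \<le> ln (9 / 2) + (30 / E) powr \<alpha> * (1 + 9 * (\<kappa> * ln (2 / E) + \<bar>ln C\<bar>))"
      by (intro add_left_mono mult_right_mono 4 5)
    finally show ?thesis using ip by simp
  qed
  have evq: "\<forall>\<^sub>F E in at_right 0. C * (E / 2) powr \<kappa> \<le> measure P0 {0..E / 2}"
  proof -
    obtain b where b: "0 < b" "\<And>\<epsilon>. 0 < \<epsilon> \<Longrightarrow> \<epsilon> < b \<Longrightarrow> C * \<epsilon> powr \<kappa> \<le> measure P0 {0..\<epsilon>}"
      using C(3) unfolding eventually_at_right_field by auto
    show ?thesis unfolding eventually_at_right_field
      by (intro exI[of _ b]) (use b in auto)
  qed
  have ev1: "\<forall>\<^sub>F E in at_right 0. E < (1::real)" "\<forall>\<^sub>F E in at_right 0. E < c"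
    unfolding eventually_at_right_field by (intro exI[of _ 1], simp, intro exI[of _ c], use c in simp)
  have ev0: "\<forall>\<^sub>F E in at_right 0. E > (0::real)" by (rule eventually_at_right_less)
  \<comment> \<open>For E this small, \<open>ids E\<close> is below 1, so that the absolute value of
    its logarithm is the negative logarithm.\<close>
  have evl: "\<forall>\<^sub>F E in at_right 0. 0 < h * E powr (- \<alpha>) - ln 2" using h \<alpha> by real_asymp
  have key: "\<forall>\<^sub>F E in at_right 0. h * E powr (- \<alpha>) - ln 2 \<le> \<bar>ln (ids E)\<bar> \<and>
     \<bar>ln (ids E)\<bar> \<le> ln (9 / 2) + (30 / E) powr \<alpha> * (1 + 9 * (\<kappa> * ln (2 / E) + \<bar>ln C\<bar>))"
    using evq ev1 ev0 evl
  proof eventually_elim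
    case (elim E)
    note L = pos_lower[OF elim(4) elim(2) elim(1)]
    have "ln (ids E) \<le> ln (2 * exp (- (h * E powr (- \<alpha>))))"
      using L upper[OF elim(4) elim(3)] by simp
    also have "\<dots> = ln 2 - h * E powr (- \<alpha>)" by (simp add: ln_mult_pos)
    finally show ?case using L elim(5) by auto
  qed
  have "((\<lambda>E. ln \<bar>ln (ids E)\<bar> / ln E) \<longlongrightarrow> - \<alpha>) (at_right 0)"
    by (rule loglog_limit[OF \<alpha> h C(2), of "\<bar>ln C\<bar>"]) (use key in \<open>auto elim: eventually_mono\<close>)
  then show ?thesis by (simp add: \<alpha>_def)
qed

end

theorem theorem1p2:
  fixes M :: "'a measure" and V :: "pt \<Rightarrow> 'a \<Rightarrow> real" and P0 :: "real measure"
  assumes "prob_space M"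
    and "prob_space.indep_vars M (\<lambda>_. borel) V sier_V"
    and "\<forall>x\<in>sier_V. distr M borel (V x) = P0"
  shows "\<exists>N :: real \<Rightarrow> real.
     mono N \<and> (\<forall>E. continuous (at_right E) N) \<and>
     (AE \<omega> in M. \<forall>E. isCont N E \<longrightarrow>
        ((\<lambda>L. prob_space.expectation M
                 (\<lambda>\<omega>'. real (eig_count E (restr_mat (H_kernel (\<lambda>x. V x \<omega>')) (ballL L))))
               / real (card (ballL L))) \<longlonglongrightarrow> N E) \<and>
        ((\<lambda>L. real (eig_count E (restr_mat (H_kernel (\<lambda>x. V x \<omega>)) (ballL L)))
               / real (card (ballL L))) \<longlonglongrightarrow> N E)) \<and>
     ((supp_measure P0 \<noteq> {} \<and> bdd_below (supp_measure P0) \<and> Inf (supp_measure P0) = 0 \<and>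
       \<not> (\<exists>c. measure P0 {c} = 1) \<and>
       (\<exists>C \<kappa>. C > 0 \<and> \<kappa> > 0 \<and>
          (\<forall>\<^sub>F \<epsilon> in at_right 0. measure P0 {0..\<epsilon>} \<ge> C * \<epsilon> powr \<kappa>)))
      \<longrightarrow> ((\<lambda>E. ln \<bar>ln (N E)\<bar> / ln E) \<longlongrightarrow> - ln 3 / ln 5) (at_right 0))"
proof -
  interpret anderson M V P0
    using assms by (simp add: anderson_def anderson_axioms_def)
  show ?thesis
  proof (intro exI[of _ ids] conjI allI impI)
    show "AE \<omega> in M. \<forall>E. isCont ids E \<longrightarrow>
        ((\<lambda>L. expectation (\<lambda>\<omega>'. real (eig_count E (restr_mat (H_kernel (\<lambda>x. V x \<omega>')) (ballL L))))
               / real (card (ballL L))) \<longlonglongrightarrow> ids E) \<and>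
        ((\<lambda>L. real (eig_count E (restr_mat (H_kernel (\<lambda>x. V x \<omega>)) (ballL L)))
               / real (card (ballL L))) \<longlonglongrightarrow> ids E)"
      using ids_limit unfolding mean_ball_density_def ball_density_def ball_count_def .
  qed (use mono_ids continuous_ids lifshitz_tail in blast)+
qed

end
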